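(* Let ${\bf u}(t,{\bf x})$ be a smooth time-dependent vector field on $\mathbb R^3$ whose dynamics is governed by $$\frac{\partial {\bf u}}{\partial t}+{\bf u}\cdot\nabla{\bf u}={\bf F}$$ for some force field ${\bf F}$, and assume that a smooth time-dependent divergence-free field ${\bf B}(t,{\bf x})$ and a smooth function $\varphi(t,{\bf x})$ satisfy the frozen field equations $$\frac{\partial {\bf B}}{\partial t}-\nabla\times({\bf u}\times{\bf B})=0,\qquad \frac{\partial\varphi}{\partial t}+{\bf u}\cdot\nabla\varphi=0,$$ with ${\bf B}\cdot\nabla\varphi\neq0$ everywhere. Then: (1) The two-form $$\Omega=-(\nabla\varphi+{\bf u}\times{\bf B})\cdot d{\bf x}\wedge dt+{\bf B}\cdot(d{\bf x}\wedge d{\bf x})$$ on $\mathbb R\times\mathbb R^3$ is symplectic, and $\partial_t+u$, $u={\bf u}\cdot\nabla$, is a Hamiltonian vector field for $\Omega$ with Hamiltonian function $\varphi$, i.e. $i(\partial_t+u)(\Omega)=d\varphi$. (2) $\rho_\varphi:=-{\bf B}\cdot\nabla\varphi$ is the invariant Liouville volume density, i.e. $\frac12\Omega\wedge\Omega=\rho_\varphi\,dx\wedge dy\wedge dz\wedge dt$ and $\frac{\partial\rho_\varphi}{\partial t}+\nabla\cdot(\rho_\varphi{\bf u})=0$. (3) If moreover ${\bf B}=\nabla\times{\bf A}$ for some smooth time-dependent vector potential ${\bf A}$, then $\Omega$ is exact: $$\Omega=-d\theta,\qquad -\theta=\psi\,dt+{\bf A}\cdot d{\bf x},$$ where the function $\psi$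 is determined by the equation $$\frac{\partial{\bf A}}{\partial t}-{\bf u}\times(\nabla\times{\bf A})=\nabla(\varphi+\psi).$$ (4) In the situation of (3), the Darboux coordinates for $\Omega$ define the Clebsch representation of the vector potential ${\bf A}$: around every point there are local coordinates $(q,p,t,h_{can})$ with $\Omega=dp\wedge dq+dh_{can}\wedge dt$, and in any such coordinates (on a simply connected neighbourhood) ${\bf A}=\nabla s+p\,\nabla q$, where $s$ is the generating function of the canonical transformation.
   Context: Coordinates on $\mathbb R\times\mathbb R^3$ are $(t,{\bf x})=(t,x,y,z)$; $\nabla$, $\nabla\cdot$, $\nabla\times$ act on the spatial variables only, while $d$ is the exterior derivative on the four-dimensional space $\mathbb R\times\mathbb R^3$. For a vector ${\bf V}=(V_1,V_2,V_3)$: ${\bf V}\cdot d{\bf x}=V_1dx+V_2dy+V_3dz$ and ${\bf V}\cdot(d{\bf x}\wedge d{\bf x})=V_1\,dy\wedge dz+V_2\,dz\wedge dx+V_3\,dx\wedge dy$. A symplectic form is a closed nondegenerate two-form. $i(X)$ denotes the inner product (contraction) with the vector field $X$, and $X$ is Hamiltonian with Hamiltonian function $\varphi$ if $i(X)(\Omega)=d\varphi$. The generating function $s$ of the canonical transformation to the coordinates $(q,p,t,h_{can})$ is a (local) function with $ds=\theta_{can}-\theta$, where $-\theta_{can}=p\,dq+h_{can}\,dt$. In (3), "determined" means: a function $\psi$ satisfying the equation exists (unique up to adding a function of $t$ alone), and $\Omega=-d\theta$ for any such $\psi$. *)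

theory Defs
  imports "HOL-Analysis.Analysis" "HOL-Library.Function_Algebras"
begin

type_synonym spacetime = "real \<times> (real ^ 3)"


section \<open>Smooth functions\<close>

text \<open>Meant for open sets: all derivatives are taken in the full space.\<close>

primrec Ck_on :: "nat \<Rightarrow> 'a::real_normed_vector set \<Rightarrow> ('a \<Rightarrow> 'b::real_normed_vector) \<Rightarrow> bool" where
  "Ck_on 0 S f \<longleftrightarrow> continuous_on S f"
| "Ck_on (Suc k) S f \<longleftrightarrow>
     (\<forall>x\<in>S. f differentiable (at x)) \<and> (\<forall>v. Ck_on k S (\<lambda>x. frechet_derivative f (at x) v))"

definition smooth_on :: "'a::real_normed_vector set \<Rightarrow> ('a \<Rightarrow> 'b::real_normed_vector) \<Rightarrow> bool" where
  "smooth_on S f \<longleftrightarrow> (\<forall>k. Ck_on k S f)"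

abbreviation smooth :: "('a::real_normed_vector \<Rightarrow> 'b::real_normed_vector) \<Rightarrow> bool" where
  "smooth \<equiv> smooth_on UNIV"


section \<open>Vector calculus for time-dependent fields\<close>

definition time_deriv :: "(spacetime \<Rightarrow> 'b::real_normed_vector) \<Rightarrow> spacetime \<Rightarrow> 'b" where
  "time_deriv f z = vector_derivative (\<lambda>s. f (s, snd z)) (at (fst z))"

definition space_deriv :: "3 \<Rightarrow> (spacetime \<Rightarrow> 'b::real_normed_vector) \<Rightarrow> spacetime \<Rightarrow> 'b" where
  "space_deriv i f z = frechet_derivative (\<lambda>x. f (fst z, x)) (at (snd z)) (axis i 1)"

definition grad :: "(spacetime \<Rightarrow> real) \<Rightarrow> spacetime \<Rightarrow> real ^ 3" where
  "grad f z = (\<chi> i. space_deriv i f z)"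

definition divergence :: "(spacetime \<Rightarrow> real ^ 3) \<Rightarrow> spacetime \<Rightarrow> real" where
  "divergence V z = (\<Sum>i\<in>UNIV. space_deriv i (\<lambda>w. V w $ i) z)"

definition curl :: "(spacetime \<Rightarrow> real ^ 3) \<Rightarrow> spacetime \<Rightarrow> real ^ 3" where
  "curl V z = vector
    [space_deriv 2 (\<lambda>w. V w $ 3) z - space_deriv 3 (\<lambda>w. V w $ 2) z,
     space_deriv 3 (\<lambda>w. V w $ 1) z - space_deriv 1 (\<lambda>w. V w $ 3) z,
     space_deriv 1 (\<lambda>w. V w $ 2) z - space_deriv 2 (\<lambda>w. V w $ 1) z]"

text \<open>The operator \<open>u \<cdot> \<nabla>\<close>, on scalar and on vector fields.\<close>

definition advect ::
  "(spacetime \<Rightarrow> real ^ 3) \<Rightarrow> (spacetime \<Rightarrow> 'b::real_normed_vector) \<Rightarrow> spacetime \<Rightarrow> 'b" where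
  "advect u f z = (\<Sum>i\<in>UNIV. (u z $ i) *\<^sub>R space_deriv i f z)"


section \<open>Differential forms\<close>

text \<open>
  A \<open>k\<close>-form takes a point and a sequence of tangent vectors, of which only the entries with
  index below \<open>k\<close> matter. Forms are added, negated and (for functions viewed as 0-forms)
  multiplied pointwise, with the operations of \<open>Function_Algebras\<close>.
\<close>

type_synonym 'a form = "'a \<Rightarrow> (nat \<Rightarrow> 'a) \<Rightarrow> real"

definition alternating :: "nat \<Rightarrow> ((nat \<Rightarrow> 'a::real_vector) \<Rightarrow> real) \<Rightarrow> bool" where
  "alternating k a \<longleftrightarrow>
     (\<forall>v w. (\<forall>i<k. v i = w i) \<longrightarrow> a v = a w) \<and>
     (\<forall>v. \<forall>i<k. linear (\<lambda>x. a (v(i := x)))) \<and>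
     (\<forall>v i j. i < j \<and> j < k \<and> v i = v j \<longrightarrow> a v = 0)"

definition differential_form :: "nat \<Rightarrow> 'a::real_normed_vector form \<Rightarrow> bool" where
  "differential_form k \<omega> \<longleftrightarrow> (\<forall>z. alternating k (\<omega> z)) \<and> (\<forall>v. smooth (\<lambda>z. \<omega> z v))"

definition form0 :: "('a \<Rightarrow> real) \<Rightarrow> 'a form" where
  "form0 f = (\<lambda>z v. f z)"

text \<open>
  Normalised so that \<open>(\<alpha> \<and> \<beta>)(v, w) = \<alpha>(v) \<beta>(w) - \<alpha>(w) \<beta>(v)\<close> for 1-forms.
\<close>

definition wedge :: "nat \<Rightarrow> nat \<Rightarrow> 'a form \<Rightarrow> 'a form \<Rightarrow> 'a form" where
  "wedge k l \<alpha> \<beta> = (\<lambda>z v.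
     (\<Sum>\<sigma> | \<sigma> permutes {..<k + l}.
        of_int (sign \<sigma>) * \<alpha> z (\<lambda>i. v (\<sigma> i)) * \<beta> z (\<lambda>i. v (\<sigma> (k + i)))) / (fact k * fact l))"

text \<open>
  On a vector space the invariant formula for \<open>d\<close>, evaluated on constant vector fields, has no
  Lie bracket terms; the \<open>i\<close>-th summand omits the argument \<open>v i\<close>.
\<close>

definition ext_deriv :: "nat \<Rightarrow> 'a::real_normed_vector form \<Rightarrow> 'a form" where
  "ext_deriv k \<omega> = (\<lambda>z v. \<Sum>i\<le>k.
     (- 1) ^ i * frechet_derivative (\<lambda>w. \<omega> w (\<lambda>j. v (if j < i then j else Suc j))) (at z) (v i))"

abbreviation differential :: "('a::real_normed_vector \<Rightarrow> real) \<Rightarrow> 'a form" where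
  "differential f \<equiv> ext_deriv 0 (form0 f)"

definition interior_product :: "('a \<Rightarrow> 'a) \<Rightarrow> 'a form \<Rightarrow> 'a form" where
  "interior_product X \<omega> = (\<lambda>z v. \<omega> z (case_nat (X z) v))"

definition nondegenerate :: "'a::real_vector form \<Rightarrow> bool" where
  "nondegenerate \<omega> \<longleftrightarrow> (\<forall>z x. (\<forall>v. \<omega> z (case_nat x v) = 0) \<longrightarrow> x = 0)"

definition symplectic_form :: "'a::real_normed_vector form \<Rightarrow> bool" where
  "symplectic_form \<omega> \<longleftrightarrow> differential_form 2 \<omega> \<and> ext_deriv 2 \<omega> = 0 \<and> nondegenerate \<omega>"

definition hamiltonian_vector_field ::
  "'a::real_normed_vector form \<Rightarrow> ('a \<Rightarrow> 'a) \<Rightarrow> ('a \<Rightarrow> real) \<Rightarrow> bool" where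
  "hamiltonian_vector_field \<omega> X f \<longleftrightarrow> interior_product X \<omega> = differential f"


section \<open>Forms on space-time\<close>

abbreviation dt :: "spacetime form" where
  "dt \<equiv> differential fst"

abbreviation dx :: "3 \<Rightarrow> spacetime form" where
  "dx i \<equiv> differential (\<lambda>z. snd z $ i)"

definition dot_dx :: "(spacetime \<Rightarrow> real ^ 3) \<Rightarrow> spacetime form" where
  "dot_dx V = form0 (\<lambda>z. V z $ 1) * dx 1 + form0 (\<lambda>z. V z $ 2) * dx 2 + form0 (\<lambda>z. V z $ 3) * dx 3"

definition dot_dx_dx :: "(spacetime \<Rightarrow> real ^ 3) \<Rightarrow> spacetime form" where
  "dot_dx_dx V =
     form0 (\<lambda>z. V z $ 1) * wedge 1 1 (dx 2) (dx 3) +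
     form0 (\<lambda>z. V z $ 2) * wedge 1 1 (dx 3) (dx 1) +
     form0 (\<lambda>z. V z $ 3) * wedge 1 1 (dx 1) (dx 2)"

definition volume_form :: "spacetime form" where
  "volume_form = wedge 3 1 (wedge 2 1 (wedge 1 1 (dx 1) (dx 2)) (dx 3)) dt"

definition Omega ::
  "(spacetime \<Rightarrow> real ^ 3) \<Rightarrow> (spacetime \<Rightarrow> real ^ 3) \<Rightarrow> (spacetime \<Rightarrow> real) \<Rightarrow> spacetime form" where
  "Omega u B \<phi> =
     - wedge 1 1 (dot_dx (\<lambda>z. grad \<phi> z + cross3 (u z) (B z))) dt + dot_dx_dx B"

definition theta :: "(spacetime \<Rightarrow> real) \<Rightarrow> (spacetime \<Rightarrow> real ^ 3) \<Rightarrow> spacetime form" where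
  "theta \<psi> A = - (form0 \<psi> * dt + dot_dx A)"

definition potential_equation ::
  "(spacetime \<Rightarrow> real ^ 3) \<Rightarrow> (spacetime \<Rightarrow> real ^ 3) \<Rightarrow> (spacetime \<Rightarrow> real) \<Rightarrow> (spacetime \<Rightarrow> real) \<Rightarrow> bool"
where
  "potential_equation u A \<phi> \<psi> \<longleftrightarrow>
     (\<forall>z. time_deriv A z - cross3 (u z) (curl A z) = grad (\<lambda>w. \<phi> w + \<psi> w) z)"


section \<open>Canonical coordinates\<close>

definition local_coordinates ::
  "'a::real_normed_vector set \<Rightarrow> ('a \<Rightarrow> 'b::real_normed_vector) \<Rightarrow> bool" where
  "local_coordinates U \<Phi> \<longleftrightarrow>
     open U \<and> smooth_on U \<Phi> \<and> inj_on \<Phi> U \<and>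
     open (\<Phi> ` U) \<and> smooth_on (\<Phi> ` U) (inv_into U \<Phi>)"

definition darboux_coordinates ::
  "spacetime form \<Rightarrow> spacetime set \<Rightarrow>
   (spacetime \<Rightarrow> real) \<Rightarrow> (spacetime \<Rightarrow> real) \<Rightarrow> (spacetime \<Rightarrow> real) \<Rightarrow> bool" where
  "darboux_coordinates \<omega> U q p h \<longleftrightarrow>
     local_coordinates U (\<lambda>z. vector [q z, p z, fst z, h z] :: real ^ 4) \<and>
     (\<forall>z\<in>U. \<omega> z = (wedge 1 1 (differential p) (differential q) + wedge 1 1 (differential h) dt) z)"

definition theta_can ::
  "(spacetime \<Rightarrow> real) \<Rightarrow> (spacetime \<Rightarrow> real) \<Rightarrow> (spacetime \<Rightarrow> real) \<Rightarrow> spacetime form" where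
  "theta_can q p h = - (form0 p * differential q + form0 h * dt)"

definition generating_function ::
  "spacetime set \<Rightarrow> spacetime form \<Rightarrow> spacetime form \<Rightarrow> (spacetime \<Rightarrow> real) \<Rightarrow> bool" where
  "generating_function U \<theta>\<^sub>c \<theta> s \<longleftrightarrow>
     smooth_on U s \<and> (\<forall>z\<in>U. differential s z = (\<theta>\<^sub>c - \<theta>) z)"

end

theory Submission
  imports Defs
begin

text \<open>
  With \<open>E = \<nabla>\<phi> + u \<times> B\<close> the form \<open>\<Omega>\<close> is \<open>- E \<cdot> dx \<and> dt + B \<cdot> (dx \<and> dx)\<close>. Since \<open>curl E = curl (u \<times> B)\<close>, the
  frozen field equation is Faraday's law \<open>\<partial>B/\<partial>t = curl E\<close>, which together with \<open>div B = 0\<close> says that \<open>\<Omega>\<close> is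
  closed; \<open>E \<cdot> B = B \<cdot> \<nabla>\<phi>\<close> is its Pfaffian. With a vector potential, \<open>\<partial>A/\<partial>t - E\<close> is curl-free in space
  and hence the gradient of some \<open>\<psi>\<close>.

  For the Darboux coordinates, the flow of \<open>B\<close> at fixed time straightens \<open>B\<close>; the flux of \<open>B\<close> is
  constant along the flow because \<open>div B = 0\<close>, and integrating it over one transversal variable gives
  Euler potentials \<open>B = \<nabla>p \<times> \<nabla>q\<close>, smooth in time as well. Then \<open>\<Omega> - dp \<and> dq\<close> has no purely spatial
  part, and closedness makes it \<open>dh \<and> dt\<close>. Nondegeneracy of \<open>\<Omega>\<close> and the inverse function theorem turn
  \<open>(q, p, t, h)\<close> into coordinates. The smooth flow is obtained from an integral equation solved by
  contraction for short times: its derivative in a parameter solves an equation of the same kind, which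
  gives smoothness by induction.

  In any Darboux coordinates \<open>\<theta>\<^sub>c - \<theta>\<close> is closed, so it is exact on a simply connected domain; the spatial
  part of its primitive \<open>s\<close> is the Clebsch representation.
\<close>


section \<open>Functions of class \<open>C\<^sup>k\<close>\<close>

text \<open>Darboux's theorem alone would not give part (4): the time \<open>t\<close> must itself
  be one of the coordinates. Hence \<open>p\<close> and \<open>q\<close> are built inside the time
  slices, and must be smooth in \<open>t\<close> as well. For this the field \<open>(0, B)\<close>
  is flowed on space-time: its flow preserves every slice, and \<open>t\<close> is part of its
  initial point, so smooth dependence on the initial point is all that is needed.

  The time interval of the flow obeys \<open>a * L \<le> 1/2\<close>, where \<open>L\<close> bounds
  the derivative of the right-hand side in the unknown. Differentiating the equation in a parameter
  does not change that derivative, so the same \<open>a\<close> and \<open>L\<close> serve at every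
  order and the interval never shrinks in the induction.

  \<open>Ck_on\<close> asks that the derivative in each fixed direction be of class C^k, not the
  derivative as an operator-valued map. So codomains stay the same through all inductions; the price
  is that a direction varying with the point has to be expanded in a basis, whence the recurring
  sums over \<open>Basis\<close>.\<close>

lemma Ck_on_cong:
  assumes "open S" "\<And>x. x \<in> S \<Longrightarrow> f x = g x"
  shows "Ck_on k S f \<longleftrightarrow> Ck_on k S g"
proof -
  have "Ck_on k S g" if "Ck_on k S f" "\<And>x. x \<in> S \<Longrightarrow> f x = g x" for f g
    using that
  proof (induction k arbitrary: f g)
    case 0
    then show ?case using continuous_on_cong by fastforce
  next
    case (Suc k)
    have der: "(g has_derivative frechet_derivative f (at x)) (at x)" if "x \<in> S" for x
      using Suc.prems that assms(1)
      by (auto intro: has_derivative_transform_within_open simp: frechet_derivative_works)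
    have "frechet_derivative f (at x) v = frechet_derivative g (at x) v" if "x \<in> S" for x v
      using frechet_derivative_at[OF der[OF that]] by simp
    then have "Ck_on k S (\<lambda>x. frechet_derivative g (at x) v)" for v
      using Suc.IH[of "\<lambda>x. frechet_derivative f (at x) v"] Suc.prems(1) by simp
    then show ?case using der by (auto simp: differentiable_def)
  qed
  then show ?thesis using assms(2) by (metis (mono_tags, lifting))
qed

text \<open>\<open>Ck_on\<close> refers to the selected derivative
  \<open>frechet_derivative\<close>; by uniqueness of derivatives any explicit formula may take its
  place.\<close>

lemma Ck_on_SucI:
  assumes "open S" "\<And>x. x \<in> S \<Longrightarrow> (f has_derivative f' x) (at x)" "\<And>v. Ck_on k S (\<lambda>x. f' x v)"
  shows "Ck_on (Suc k) S f"
proof -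
  have "Ck_on k S (\<lambda>x. frechet_derivative f (at x) v)" for v
    using Ck_on_cong[OF assms(1), of "\<lambda>x. f' x v" "\<lambda>x. frechet_derivative f (at x) v" k]
      frechet_derivative_at[OF assms(2)] assms(3) by metis
  then show ?thesis using assms(2) by (auto simp: differentiable_def)
qed

lemma Ck_on_Suc_derivative:
  assumes "Ck_on (Suc k) S f" "x \<in> S"
  shows "(f has_derivative frechet_derivative f (at x)) (at x)"
  using assms by (auto simp: frechet_derivative_works)

lemma Ck_on_SucE: "Ck_on (Suc k) S f \<Longrightarrow> Ck_on k S f"
proof (induction k arbitrary: f)
  case 0
  then show ?case
    by (auto intro!: continuous_at_imp_continuous_on simp: differentiable_imp_continuous_within)
next
  case (Suc k)
  then show ?case by (metis Ck_on.simps(2))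
qed

lemma Ck_on_le: "Ck_on k S f \<Longrightarrow> m \<le> k \<Longrightarrow> Ck_on m S f"
  by (induction k) (auto simp: le_Suc_eq simp del: Ck_on.simps dest: Ck_on_SucE)

lemma Ck_on_continuous: "Ck_on k S f \<Longrightarrow> continuous_on S f"
  using Ck_on_le[of k S f 0] by simp

lemma Ck_on_subset: "Ck_on k S f \<Longrightarrow> T \<subseteq> S \<Longrightarrow> Ck_on k T f"
  by (induction k arbitrary: f) (auto intro: continuous_on_subset)

lemma Ck_on_if_locally:
  assumes "open S" "\<And>x. x \<in> S \<Longrightarrow> \<exists>T. open T \<and> x \<in> T \<and> Ck_on k T f"
  shows "Ck_on k S f"
  using assms(2)
proof (induction k arbitrary: f)
  case 0
  then show ?case
    by (meson Ck_on.simps(1) continuous_at_imp_continuous_on continuous_on_eq_continuous_at)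
next
  case (Suc k)
  have "Ck_on k S (\<lambda>x. frechet_derivative f (at x) v)" for v
    using Suc.prems by (intro Suc.IH) (metis Ck_on.simps(2))
  then show ?case using Suc.prems by (metis Ck_on.simps(2))
qed

lemma Ck_on_const: "open S \<Longrightarrow> Ck_on k S (\<lambda>x. c)"
proof (induction k arbitrary: c)
  case (Suc k)
  then show ?case by (intro Ck_on_SucI[where f' = "\<lambda>x v. 0"]) auto
qed auto

lemma Ck_on_bounded_linear:
  assumes "open S" "bounded_linear L" "Ck_on k S f"
  shows "Ck_on k S (\<lambda>x. L (f x))"
  using assms(3)
proof (induction k arbitrary: f)
  case 0
  then show ?case using assms by (auto intro: bounded_linear.continuous_on)
next
  case (Suc k)
  have "((\<lambda>x. L (f x)) has_derivative (\<lambda>v. L (frechet_derivative f (at x) v))) (at x)" if "x \<in> S" for x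
    by (rule bounded_linear.has_derivative[OF assms(2) Ck_on_Suc_derivative[OF Suc.prems that]])
  then show ?case using Suc by (intro Ck_on_SucI[OF assms(1)]) auto
qed

lemma Ck_on_ident:
  assumes "open S" shows "Ck_on k S (\<lambda>x. x)"
proof (cases k)
  case (Suc n)
  then show ?thesis
    using assms by (auto intro!: Ck_on_SucI[where f' = "\<lambda>x v. v"] Ck_on_const simp del: Ck_on.simps)
qed auto

lemma Ck_on_linear: "open S \<Longrightarrow> bounded_linear L \<Longrightarrow> Ck_on k S L"
  using Ck_on_bounded_linear Ck_on_ident by blast

lemma Ck_on_add:
  assumes "open S" "Ck_on k S f" "Ck_on k S g"
  shows "Ck_on k S (\<lambda>x. f x + g x)"
  using assms(2,3)
proof (induction k arbitrary: f g)
  case 0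
  then show ?case by (auto intro: continuous_intros)
next
  case (Suc k)
  have "((\<lambda>x. f x + g x) has_derivative (\<lambda>v. frechet_derivative f (at x) v + frechet_derivative g (at x) v)) (at x)"
    if "x \<in> S" for x
    using Ck_on_Suc_derivative[OF _ that] Suc.prems by (auto intro: has_derivative_add simp del: Ck_on.simps)
  then show ?case using Suc by (intro Ck_on_SucI[OF assms(1)]) auto
qed

lemma Ck_on_bounded_bilinear:
  assumes "open S" "bounded_bilinear pr" "Ck_on k S f" "Ck_on k S g"
  shows "Ck_on k S (\<lambda>x. pr (f x) (g x))"
  using assms(3,4)
proof (induction k arbitrary: f g)
  case 0
  then show ?case using assms(2) by (auto intro: bounded_bilinear.continuous_on)
next
  case (Suc k)
  have "((\<lambda>x. pr (f x) (g x)) has_derivative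
      (\<lambda>v. pr (f x) (frechet_derivative g (at x) v) + pr (frechet_derivative f (at x) v) (g x))) (at x)"
    if "x \<in> S" for x
    by (rule bounded_bilinear.FDERIV[OF assms(2) Ck_on_Suc_derivative[OF Suc.prems(1) that]
          Ck_on_Suc_derivative[OF Suc.prems(2) that]])
  moreover have "Ck_on k S f" "Ck_on k S g"
    using Suc.prems Ck_on_SucE by blast+
  then have "Ck_on k S (\<lambda>x. pr (f x) (frechet_derivative g (at x) v) + pr (frechet_derivative f (at x) v) (g x))" for v
    using Suc.prems by (intro Ck_on_add[OF assms(1)] Suc.IH) auto
  ultimately show ?case by (intro Ck_on_SucI[OF assms(1)])
qed

lemmas Ck_on_scaleR = Ck_on_bounded_bilinear[OF _ bounded_bilinear_scaleR]
lemmas Ck_on_mult = Ck_on_bounded_bilinear[OF _ bounded_bilinear_mult]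
lemmas Ck_on_inner = Ck_on_bounded_bilinear[OF _ bounded_bilinear_inner]
lemmas Ck_on_minus = Ck_on_bounded_linear[OF _ bounded_linear_minus[OF bounded_linear_ident]]
lemmas Ck_on_vec_nth = Ck_on_bounded_linear[OF _ bounded_linear_vec_nth]

lemma Ck_on_diff:
  "open S \<Longrightarrow> Ck_on k S f \<Longrightarrow> Ck_on k S g \<Longrightarrow> Ck_on k S (\<lambda>x. f x - g x)"
  using Ck_on_add[of S k f "\<lambda>x. - g x"] Ck_on_minus[of S k g] by simp

lemma Ck_on_sum:
  "open S \<Longrightarrow> (\<And>i. i \<in> A \<Longrightarrow> Ck_on k S (f i)) \<Longrightarrow> Ck_on k S (\<lambda>x. \<Sum>i\<in>A. f i x)"
  by (induction A rule: infinite_finite_induct) (auto intro!: Ck_on_const Ck_on_add)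

lemma Ck_on_prod:
  fixes f :: "'i \<Rightarrow> 'a::real_normed_vector \<Rightarrow> real"
  shows "open S \<Longrightarrow> (\<And>i. i \<in> A \<Longrightarrow> Ck_on k S (f i)) \<Longrightarrow> Ck_on k S (\<lambda>x. \<Prod>i\<in>A. f i x)"
  by (induction A rule: infinite_finite_induct) (auto intro!: Ck_on_const Ck_on_mult)

lemma Ck_on_Pair:
  assumes "open S" "Ck_on k S f" "Ck_on k S g"
  shows "Ck_on k S (\<lambda>x. (f x, g x))"
proof -
  have "bounded_linear (\<lambda>x::'b. (x, 0::'c))" "bounded_linear (\<lambda>x::'c. (0::'b, x))"
    by (auto intro!: bounded_linear_Pair bounded_linear_ident bounded_linear_zero)
  then have "Ck_on k S (\<lambda>x. (f x, 0) + (0, g x))"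
    using assms by (intro Ck_on_add Ck_on_bounded_linear[of S "\<lambda>x::'b. (x, 0::'c)"]
        Ck_on_bounded_linear[of S "\<lambda>x::'c. (0::'b, x)"]) auto
  then show ?thesis by simp
qed

lemma Ck_on_vec:
  fixes f :: "'a::real_normed_vector \<Rightarrow> real ^ 'n"
  assumes "open S" "\<And>i. Ck_on k S (\<lambda>x. f x $ i)"
  shows "Ck_on k S f"
proof -
  have "Ck_on k S (\<lambda>x. \<Sum>i\<in>UNIV. (f x $ i) *\<^sub>R (axis i 1 :: real ^ 'n))"
    using assms by (intro Ck_on_sum Ck_on_scaleR Ck_on_const) auto
  moreover have "(\<Sum>i\<in>UNIV. (f x $ i) *\<^sub>R (axis i 1 :: real ^ 'n)) = f x" for x
    using basis_expansion[of "f x"] by (simp add: scalar_mult_eq_scaleR)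
  ultimately show ?thesis by simp
qed

lemma linear_euclidean_representation:
  fixes L :: "'a::euclidean_space \<Rightarrow> 'b::real_vector"
  assumes "linear L"
  shows "L v = (\<Sum>b\<in>Basis. (v \<bullet> b) *\<^sub>R L b)"
proof -
  interpret linear L by fact
  have "L v = L (\<Sum>b\<in>Basis. (v \<bullet> b) *\<^sub>R b)" by (simp only: euclidean_representation)
  then show ?thesis by (simp add: sum scale)
qed

text \<open>The direction \<open>frechet_derivative f (at x) v\<close> in which \<open>g\<close> is
  differentiated moves with \<open>x\<close>. Expanding it in a basis of the middle space leaves
  sums of products of C^k functions; the induction hypothesis covers the derivatives of
  \<open>g\<close> in the fixed basis directions.\<close>

lemma Ck_on_compose:
  fixes f :: "'a::real_normed_vector \<Rightarrow> 'b::euclidean_space" and g :: "'b \<Rightarrow> 'c::real_normed_vector"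
  assumes "open S" "open T" "f ` S \<subseteq> T" "Ck_on k S f" "Ck_on k T g"
  shows "Ck_on k S (\<lambda>x. g (f x))"
  using assms(4,5)
proof (induction k arbitrary: g)
  case 0
  then show ?case using assms(3) by (auto intro: continuous_on_compose2)
next
  case (Suc k)
  let ?D = "\<lambda>x v. \<Sum>b\<in>Basis. (frechet_derivative f (at x) v \<bullet> b) *\<^sub>R frechet_derivative g (at (f x)) b"
  have "((\<lambda>x. g (f x)) has_derivative ?D x) (at x)" if x: "x \<in> S" for x
  proof -
    have "(f has_derivative frechet_derivative f (at x)) (at x)"
      using Ck_on_Suc_derivative[OF Suc.prems(1) x] .
    moreover have g: "(g has_derivative frechet_derivative g (at (f x))) (at (f x))"
      using Ck_on_Suc_derivative[OF Suc.prems(2), of "f x"] x assms(3) by auto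
    ultimately have "((\<lambda>x. g (f x)) has_derivative
        (\<lambda>v. frechet_derivative g (at (f x)) (frechet_derivative f (at x) v))) (at x)"
      by (rule has_derivative_compose)
    moreover have "(\<lambda>v. frechet_derivative g (at (f x)) (frechet_derivative f (at x) v)) = ?D x"
      by (rule ext) (rule linear_euclidean_representation[OF has_derivative_linear[OF g]])
    ultimately show ?thesis by simp
  qed
  moreover have "Ck_on k S (\<lambda>x. ?D x v)" for v
  proof -
    have "Ck_on k S (\<lambda>x. frechet_derivative g (at (f x)) b)" for b
      using Suc.prems(2) by (intro Suc.IH[OF Ck_on_SucE[OF Suc.prems(1)]]) simp
    then show ?thesis
      using assms(1) Suc.prems(1) by (intro Ck_on_sum Ck_on_scaleR Ck_on_inner Ck_on_const) auto
  qed
  ultimately show ?case by (intro Ck_on_SucI[OF assms(1)])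
qed

text \<open>The derivative is a polynomial in \<open>inverse\<close> itself, so regularity
  bootstraps.\<close>

lemma Ck_on_inverse_real: "Ck_on k (- {0}) (inverse :: real \<Rightarrow> real)"
proof (induction k)
  case 0
  then show ?case by (auto intro: continuous_intros)
next
  case (Suc k)
  have "open (- {0::real})" by auto
  then have "Ck_on k (- {0}) (\<lambda>x::real. - (inverse x * v * inverse x))" for v
    using Suc by (intro Ck_on_minus Ck_on_mult[of _ k "\<lambda>x. inverse x * v"]
        Ck_on_mult[of _ k inverse] Ck_on_const)
  then show ?case using \<open>open (- {0::real})\<close>
    by (intro Ck_on_SucI[where f' = "\<lambda>x v. - (inverse x * v * inverse x)"] has_derivative_inverse') auto
qed

lemma Ck_on_divide:
  fixes f g :: "'a::real_normed_vector \<Rightarrow> real"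
  assumes "open S" "Ck_on k S f" "Ck_on k S g" "\<And>x. x \<in> S \<Longrightarrow> g x \<noteq> 0"
  shows "Ck_on k S (\<lambda>x. f x / g x)"
proof -
  have "Ck_on k S (\<lambda>x. inverse (g x))"
    by (rule Ck_on_compose[of S "- {0}"]) (use assms Ck_on_inverse_real in auto)
  then show ?thesis unfolding divide_inverse using assms by (intro Ck_on_mult)
qed

section \<open>Operator-valued derivatives and parametric integrals\<close>

text \<open>In finite dimension, continuity in each fixed direction is already continuity in the
  operator norm. This is the form in which the Leibniz rule and the inverse function theorem take
  the derivative.\<close>

lemma continuous_on_frechet_derivative_blinfun:
  fixes f :: "'a::euclidean_space \<Rightarrow> 'b::real_normed_vector"
  assumes "Ck_on 1 S f"
  shows "continuous_on S (\<lambda>x. Blinfun (frechet_derivative f (at x)))"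
    and "x \<in> S \<Longrightarrow> blinfun_apply (Blinfun (frechet_derivative f (at x))) = frechet_derivative f (at x)"
proof -
  show *: "blinfun_apply (Blinfun (frechet_derivative f (at x))) = frechet_derivative f (at x)" if "x \<in> S" for x
    using assms that
    by (auto intro!: bounded_linear_Blinfun_apply has_derivative_bounded_linear
        simp: frechet_derivative_works)
  show "continuous_on S (\<lambda>x. Blinfun (frechet_derivative f (at x)))"
  proof (rule continuous_on_blinfun_componentwise)
    fix i
    have "continuous_on S (\<lambda>x. frechet_derivative f (at x) i)" using assms by simp
    then show "continuous_on S (\<lambda>x. blinfun_apply (Blinfun (frechet_derivative f (at x))) i)"
      by (rule continuous_on_eq) (simp add: *)
  qed
qed

lemma has_vector_derivative_along_line:
  assumes "(f has_derivative f') (at (x + s *\<^sub>R v))"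
  shows "((\<lambda>s. f (x + s *\<^sub>R v)) has_vector_derivative f' v) (at s)"
proof -
  have "((\<lambda>s. x + s *\<^sub>R v) has_derivative (\<lambda>h. h *\<^sub>R v)) (at s)"
    by (auto intro!: derivative_eq_intros)
  from has_derivative_compose[OF this assms] show ?thesis
    by (simp add: has_vector_derivative_def linear_cmul[OF has_derivative_linear[OF assms]])
qed

lemma derivative_along_line_eq:
  assumes "(f has_derivative f') (at x)"
    and "((\<lambda>s. f (x + s *\<^sub>R v)) has_vector_derivative d) (at 0)"
  shows "f' v = d"
  using has_vector_derivative_along_line[of f f' x 0 v] assms
  by (simp add: vector_derivative_unique_at)

text \<open>The integrand lives on an open \<open>W\<close> around \<open>S \<times> {0..1}\<close>
  because its full-space derivative is wanted at the end points of the interval too.\<close>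

lemma has_derivative_parametric_integral:
  fixes f :: "'a::euclidean_space \<times> real \<Rightarrow> 'b::euclidean_space"
  assumes "open S" "open W" "S \<times> {0..1} \<subseteq> W" "Ck_on 1 W f" "x \<in> S"
  shows "((\<lambda>x. integral {0..1} (\<lambda>t. f (x, t))) has_derivative
      (\<lambda>v. integral {0..1} (\<lambda>t. frechet_derivative f (at (x, t)) (v, 0)))) (at x)"
proof -
  \<comment> \<open>\<open>L\<close> embeds the parameter directions; composing with it discards the
    derivative in the integration variable.\<close>
  define L where "L = Blinfun (\<lambda>v::'a. (v, 0::real))"
  have L: "blinfun_apply L v = (v, 0)" for v
    unfolding L_def by (subst bounded_linear_Blinfun_apply) (auto intro: bounded_linear_intros)
  define f' where "f' x t = Blinfun (frechet_derivative f (at (x, t))) o\<^sub>L L" for x t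
  have f': "blinfun_apply (f' x t) v = frechet_derivative f (at (x, t)) (v, 0)" if "(x, t) \<in> W" for x t v
    using continuous_on_frechet_derivative_blinfun(2)[OF assms(4) that] by (simp add: f'_def L)
  \<comment> \<open>The Leibniz rule wants a convex parameter set, hence a ball.\<close>
  obtain e where e: "e > 0" "ball x e \<subseteq> S" using assms(1,5) open_contains_ball by blast
  let ?U = "ball x e"
  have sub: "?U \<times> cbox 0 1 \<subseteq> W" using e assms(3) by (auto simp: subset_iff simp del: mem_ball)
  have cont: "continuous_on (?U \<times> cbox 0 1) (\<lambda>(x, t). f' x t)"
  proof -
    have "continuous_on W (\<lambda>z. Blinfun (frechet_derivative f (at z)) o\<^sub>L L)"
      by (intro continuous_intros continuous_on_frechet_derivative_blinfun(1)[OF assms(4)])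
    then show ?thesis using sub by (auto simp: f'_def split_beta elim: continuous_on_subset)
  qed
  have "((\<lambda>x. integral (cbox 0 1) (\<lambda>t. f (x, t))) has_derivative integral (cbox 0 1) (f' x)) (at x within ?U)"
  proof (rule leibniz_rule[OF _ _ cont])
    fix y and t :: real assume yt: "y \<in> ?U" "t \<in> cbox 0 1"
    then have "(y, t) \<in> W" using sub by blast
    have "((\<lambda>y. (y, t)) has_derivative (\<lambda>v. (v, 0))) (at y within ?U)"
      by (auto intro!: derivative_eq_intros)
    moreover have "(f has_derivative frechet_derivative f (at (y, t))) (at (y, t))"
      using Ck_on_Suc_derivative[of 0 W f] assms(4) \<open>(y, t) \<in> W\<close> by simp
    ultimately have "((\<lambda>y. f (y, t)) has_derivative (\<lambda>v. frechet_derivative f (at (y, t)) (v, 0))) (at y within ?U)"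
      by (rule has_derivative_compose)
    then show "((\<lambda>y. f (y, t)) has_derivative blinfun_apply (f' y t)) (at y within ?U)"
      using f'[OF \<open>(y, t) \<in> W\<close>] by presburger
  next
    fix y assume "y \<in> ?U"
    then have "continuous_on (cbox 0 1) (\<lambda>t. f (y, t))"
      using sub Ck_on_continuous[OF assms(4)]
      by (auto intro!: continuous_on_compose2[of W f] continuous_intros)
    then show "(\<lambda>t. f (y, t)) integrable_on cbox 0 1" by (rule integrable_continuous)
  qed (use e in auto)
  moreover have eq: "blinfun_apply (integral (cbox 0 1) (f' x)) v =
      integral {0..1} (\<lambda>t. frechet_derivative f (at (x, t)) (v, 0))" for v
  proof -
    have "x \<in> ?U" using e by simp
    then have "continuous_on (cbox 0 1) (f' x)"
      by (intro continuous_on_compose2[OF cont, of _ "\<lambda>t. (x, t)", simplified] continuous_intros) auto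
    then have "f' x integrable_on cbox 0 1" by (rule integrable_continuous)
    then have "blinfun_apply (integral (cbox 0 1) (f' x)) v = integral (cbox 0 1) (\<lambda>t. blinfun_apply (f' x t) v)"
      by (rule blinfun_apply_integral)
    also have "\<dots> = integral (cbox 0 1) (\<lambda>t. frechet_derivative f (at (x, t)) (v, 0))"
      using sub \<open>x \<in> ?U\<close> by (intro integral_cong f') auto
    finally show ?thesis by simp
  qed
  ultimately have "((\<lambda>x. integral {0..1} (\<lambda>t. f (x, t))) has_derivative
      blinfun_apply (integral (cbox 0 1) (f' x))) (at x)"
    using e at_within_open[of x ?U] by simp
  then show ?thesis by (rule has_derivative_eq_rhs[OF _ ext[OF eq]])
qed

lemma Ck_on_parametric_integral:
  fixes f :: "'a::euclidean_space \<times> real \<Rightarrow> 'b::euclidean_space"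
  assumes "open S" "open W" "S \<times> {0..1} \<subseteq> W" "Ck_on k W f"
  shows "Ck_on k S (\<lambda>x. integral {0..1} (\<lambda>t. f (x, t)))"
  using assms(4)
proof (induction k arbitrary: f)
  case 0
  then have "continuous_on (S \<times> cbox 0 1) (\<lambda>(x, t). f (x, t))"
    using assms(3) by (auto elim: continuous_on_subset)
  from integral_continuous_on_param[OF this] show ?case by simp
next
  case (Suc k)
  have "Ck_on 1 W f" using Suc.prems by (rule Ck_on_le) simp
  moreover have "Ck_on k S (\<lambda>x. integral {0..1} (\<lambda>t. frechet_derivative f (at (x, t)) (v, 0)))" for v
    using Suc by (intro Suc.IH[of "\<lambda>z. frechet_derivative f (at z) (v, 0)"]) simp
  ultimately show ?case
    using has_derivative_parametric_integral[OF assms(1-3)] by (intro Ck_on_SucI[OF assms(1)])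
qed

section \<open>Symmetry of second derivatives\<close>

text \<open>Two uses of the mean value theorem: along \<open>v\<close> for the increment of
  \<open>f\<close> by \<open>h *\<^sub>R w\<close>, then along \<open>w\<close> for the derivative
  in direction \<open>v\<close>. The second difference is thus exactly \<open>h\<^sup>2\<close>
  times a mixed derivative at a nearby point.\<close>

lemma second_difference_limit:
  fixes f :: "'a::real_normed_vector \<Rightarrow> real"
  assumes "open S" "Ck_on 2 S f" "x \<in> S" "e > 0"
  shows "\<exists>d>0. \<forall>h. 0 < h \<and> h < d \<longrightarrow>
    \<bar>(f (x + h *\<^sub>R v + h *\<^sub>R w) - f (x + h *\<^sub>R v) - f (x + h *\<^sub>R w) + f x) / h\<^sup>2
      - frechet_derivative (\<lambda>y. frechet_derivative f (at y) v) (at x) w\<bar> < e"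
proof -
  let ?f = "\<lambda>y. frechet_derivative f (at y) v"
  let ?g = "\<lambda>y. frechet_derivative ?f (at y) w"
  have f: "(f has_derivative frechet_derivative f (at y)) (at y)"
    and g: "(?f has_derivative frechet_derivative ?f (at y)) (at y)" if "y \<in> S" for y
    using assms(2) that by (auto simp: numeral_2_eq_2 frechet_derivative_works)
  have "continuous_on S ?g" using assms(2) by (auto simp: numeral_2_eq_2)
  then obtain r where r: "r > 0" "\<And>y. y \<in> S \<Longrightarrow> dist y x < r \<Longrightarrow> dist (?g y) (?g x) < e"
    using assms(3,4) unfolding continuous_on_iff by metis
  obtain r' where r': "r' > 0" "ball x r' \<subseteq> S" using assms(1,3) open_contains_ball by blast
  \<comment> \<open>For parameters bounded by \<open>h < d\<close> the point
    \<open>x + s *\<^sub>R v + t *\<^sub>R w\<close> is closer to \<open>x\<close> than both radii;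
    the summand 1 keeps the denominator positive when \<open>v\<close> and \<open>w\<close>
    vanish.\<close>
  define d where "d = min r r' / (norm v + norm w + 1)"
  have pos: "norm v + norm w + 1 > 0" by (smt (verit) norm_ge_zero)
  then have "d > 0" using r r' by (simp add: d_def)
  have near: "x + s *\<^sub>R v + t *\<^sub>R w \<in> S \<and> dist (x + s *\<^sub>R v + t *\<^sub>R w) x < r"
    if "\<bar>s\<bar> \<le> h" "\<bar>t\<bar> \<le> h" "h < d" for s t h
  proof -
    have "norm (s *\<^sub>R v + t *\<^sub>R w) \<le> h * norm v + h * norm w"
      using that by (intro norm_triangle_le add_mono) (auto intro: mult_right_mono)
    also have "\<dots> \<le> h * (norm v + norm w + 1)" using that by (simp add: algebra_simps)
    also have "\<dots> < min r r'" using that pos by (simp add: d_def pos_less_divide_eq)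
    finally show ?thesis using r' by (auto simp: dist_norm subset_iff add.assoc norm_minus_commute[of x] norm_minus_cancel[of "s *\<^sub>R v + t *\<^sub>R w"] simp del: norm_minus_cancel)
  qed
  show ?thesis
  proof (intro exI[of _ d] conjI allI impI \<open>d > 0\<close>)
    fix h assume h: "0 < h \<and> h < d"
    let ?F = "\<lambda>s. f ((x + h *\<^sub>R w) + s *\<^sub>R v) - f (x + s *\<^sub>R v)"
    have "\<exists>z>0. z < h \<and> ?F h - ?F 0 = (h - 0) * (?f ((x + h *\<^sub>R w) + z *\<^sub>R v) - ?f (x + z *\<^sub>R v))"
    proof (rule MVT2)
      fix s assume s: "0 \<le> s" "s \<le> h"
      have "(x + h *\<^sub>R w) + s *\<^sub>R v \<in> S" "x + s *\<^sub>R v \<in> S"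
        using near[of s h h] near[of s h 0] s h by (auto simp: algebra_simps)
      then show "DERIV ?F s :> ?f ((x + h *\<^sub>R w) + s *\<^sub>R v) - ?f (x + s *\<^sub>R v)"
        unfolding has_real_derivative_iff_has_vector_derivative
        by (intro has_vector_derivative_diff has_vector_derivative_along_line f)
    qed (use h in auto)
    then obtain s where s: "0 < s" "s < h"
      "?F h - ?F 0 = h * (?f ((x + h *\<^sub>R w) + s *\<^sub>R v) - ?f (x + s *\<^sub>R v))" by auto
    have "\<exists>z>0. z < h \<and> ?f ((x + s *\<^sub>R v) + h *\<^sub>R w) - ?f ((x + s *\<^sub>R v) + 0 *\<^sub>R w)
        = (h - 0) * ?g ((x + s *\<^sub>R v) + z *\<^sub>R w)"
    proof (rule MVT2)
      fix t assume t: "0 \<le> t" "t \<le> h"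
      have "x + s *\<^sub>R v + t *\<^sub>R w \<in> S" using near[of s h t] s t h by auto
      then show "DERIV (\<lambda>t. ?f ((x + s *\<^sub>R v) + t *\<^sub>R w)) t :> ?g ((x + s *\<^sub>R v) + t *\<^sub>R w)"
        unfolding has_real_derivative_iff_has_vector_derivative
        by (intro has_vector_derivative_along_line g)
    qed (use h in auto)
    then obtain t where t: "0 < t" "t < h"
      "?f ((x + s *\<^sub>R v) + h *\<^sub>R w) - ?f (x + s *\<^sub>R v) = h * ?g ((x + s *\<^sub>R v) + t *\<^sub>R w)" by auto
    let ?y = "x + s *\<^sub>R v + t *\<^sub>R w"
    have "f (x + h *\<^sub>R v + h *\<^sub>R w) - f (x + h *\<^sub>R v) - f (x + h *\<^sub>R w) + f x = ?F h - ?F 0"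
      by (simp add: algebra_simps)
    also have "\<dots> = h\<^sup>2 * ?g ?y"
      using s(3) t(3) by (simp add: power2_eq_square add_ac)
    finally have "(f (x + h *\<^sub>R v + h *\<^sub>R w) - f (x + h *\<^sub>R v) - f (x + h *\<^sub>R w) + f x) / h\<^sup>2 = ?g ?y"
      using h by simp
    moreover have "\<bar>?g ?y - ?g x\<bar> < e"
      using near[of s h t] s t h r(2)[of ?y] by (auto simp: dist_real_def)
    ultimately show "\<bar>(f (x + h *\<^sub>R v + h *\<^sub>R w) - f (x + h *\<^sub>R v) - f (x + h *\<^sub>R w) + f x) / h\<^sup>2
      - ?g x\<bar> < e" by simp
  qed
qed

text \<open>The second difference quotient is symmetric in \<open>v\<close> and \<open>w\<close>, so
  both mixed derivatives are its limit.\<close>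

lemma second_derivative_commute_real:
  fixes f :: "'a::real_normed_vector \<Rightarrow> real"
  assumes "open S" "Ck_on 2 S f" "x \<in> S"
  shows "frechet_derivative (\<lambda>y. frechet_derivative f (at y) v) (at x) w
    = frechet_derivative (\<lambda>y. frechet_derivative f (at y) w) (at x) v" (is "?a = ?b")
proof (rule ccontr)
  assume "?a \<noteq> ?b"
  define e where "e = \<bar>?a - ?b\<bar> / 2"
  have "e > 0" using \<open>?a \<noteq> ?b\<close> by (simp add: e_def)
  let ?q = "\<lambda>v w h. (f (x + h *\<^sub>R v + h *\<^sub>R w) - f (x + h *\<^sub>R v) - f (x + h *\<^sub>R w) + f x) / h\<^sup>2"
  obtain d1 where d1: "d1 > 0" "\<And>h. 0 < h \<and> h < d1 \<Longrightarrow> \<bar>?q v w h - ?a\<bar> < e"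
    using second_difference_limit[OF assms \<open>e > 0\<close>, of v w] by blast
  obtain d2 where d2: "d2 > 0" "\<And>h. 0 < h \<and> h < d2 \<Longrightarrow> \<bar>?q w v h - ?b\<bar> < e"
    using second_difference_limit[OF assms \<open>e > 0\<close>, of w v] by blast
  define h where "h = min d1 d2 / 2"
  have h: "0 < h" "h < d1" "h < d2" using d1(1) d2(1) by (auto simp: h_def min_def)
  have swap: "x + h *\<^sub>R v + h *\<^sub>R w = x + h *\<^sub>R w + h *\<^sub>R v" by (simp add: add.assoc add.commute)
  have "?q v w h = ?q w v h" unfolding swap by (rule arg_cong[of _ _ "\<lambda>y. y / h\<^sup>2"]) linarith
  moreover have "\<bar>?q v w h - ?a\<bar> < e" "\<bar>?q w v h - ?b\<bar> < e" using d1(2)[of h] d2(2)[of h] h by auto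
  ultimately have "\<bar>?a - ?b\<bar> < 2 * e" by linarith
  then show False by (simp add: e_def)
qed

lemma frechet_derivative_bounded_linear:
  assumes "bounded_linear L" "f differentiable (at x)"
  shows "frechet_derivative (\<lambda>y. L (f y)) (at x) = (\<lambda>v. L (frechet_derivative f (at x) v))"
  using bounded_linear.has_derivative[OF assms(1)] assms(2)
  by (metis frechet_derivative_at frechet_derivative_works)

lemma second_derivative_commute:
  fixes f :: "'a::real_normed_vector \<Rightarrow> 'b::euclidean_space"
  assumes "open S" "Ck_on 2 S f" "x \<in> S"
  shows "frechet_derivative (\<lambda>y. frechet_derivative f (at y) v) (at x) w
    = frechet_derivative (\<lambda>y. frechet_derivative f (at y) w) (at x) v"
proof (rule euclidean_eqI)
  fix b :: 'b
  have L: "bounded_linear (\<lambda>z::'b. z \<bullet> b)" by (rule bounded_linear_inner_left)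
  have d: "f differentiable (at y)" "(\<lambda>y. frechet_derivative f (at y) v) differentiable (at y)" if "y \<in> S" for y v
    using assms(2) that by (auto simp: numeral_2_eq_2)
  have *: "frechet_derivative (\<lambda>y. frechet_derivative f (at y) v) (at x) w \<bullet> b =
    frechet_derivative (\<lambda>y. frechet_derivative (\<lambda>y. f y \<bullet> b) (at y) v) (at x) w" for v w
  proof -
    have "frechet_derivative (\<lambda>y. frechet_derivative f (at y) v \<bullet> b) (at x) =
       frechet_derivative (\<lambda>y. frechet_derivative (\<lambda>y. f y \<bullet> b) (at y) v) (at x)"
    proof (rule frechet_derivative_transform_within_open[OF _ assms(1,3)])
      show "(\<lambda>y. frechet_derivative f (at y) v \<bullet> b) differentiable at x"
        using d(2)[OF assms(3)] by simp
    qed (simp add: frechet_derivative_bounded_linear[OF L d(1)])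
    then show ?thesis
      using frechet_derivative_bounded_linear[OF L d(2)[OF assms(3)]] by metis
  qed
  show "frechet_derivative (\<lambda>y. frechet_derivative f (at y) v) (at x) w \<bullet> b
    = frechet_derivative (\<lambda>y. frechet_derivative f (at y) w) (at x) v \<bullet> b"
    unfolding *
    by (rule second_derivative_commute_real[OF assms(1) Ck_on_bounded_linear[OF assms(1) L assms(2)] assms(3)])
qed

section \<open>Smooth functions, the Poincare lemma and the inverse function theorem\<close>

lemma smooth_onD: "smooth_on S f \<Longrightarrow> Ck_on k S f"
  by (simp add: smooth_on_def)

lemma smooth_on_derivative: "smooth_on S f \<Longrightarrow> smooth_on S (\<lambda>x. frechet_derivative f (at x) v)"
  unfolding smooth_on_def using Ck_on.simps(2) by metis

lemma smooth_on_has_derivative: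
  "smooth_on S f \<Longrightarrow> x \<in> S \<Longrightarrow> (f has_derivative frechet_derivative f (at x)) (at x)"
  using Ck_on_Suc_derivative smooth_onD by blast

lemma smooth_on_differentiable: "smooth_on S f \<Longrightarrow> x \<in> S \<Longrightarrow> f differentiable (at x)"
  using smooth_on_has_derivative by (auto simp: differentiable_def)

lemma smooth_on_cong: "open S \<Longrightarrow> (\<And>x. x \<in> S \<Longrightarrow> f x = g x) \<Longrightarrow> smooth_on S f \<longleftrightarrow> smooth_on S g"
  using Ck_on_cong unfolding smooth_on_def by metis

lemma smooth_on_subset: "smooth_on S f \<Longrightarrow> T \<subseteq> S \<Longrightarrow> smooth_on T f"
  unfolding smooth_on_def using Ck_on_subset by blast

lemma smooth_onI_derivative:
  assumes "open S" "\<And>x. x \<in> S \<Longrightarrow> (f has_derivative f' x) (at x)" "\<And>v. smooth_on S (\<lambda>x. f' x v)"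
  shows "smooth_on S f"
  unfolding smooth_on_def
proof
  fix k
  have "Ck_on (Suc k) S f" using assms by (intro Ck_on_SucI) (auto intro: smooth_onD)
  then show "Ck_on k S f" by (rule Ck_on_SucE)
qed

lemma smooth_on_const: "open S \<Longrightarrow> smooth_on S (\<lambda>x. c)"
  by (simp add: smooth_on_def Ck_on_const)

lemma smooth_on_ident: "open S \<Longrightarrow> smooth_on S (\<lambda>x. x)"
  by (simp add: smooth_on_def Ck_on_ident)

lemma smooth_on_bounded_linear:
  "open S \<Longrightarrow> bounded_linear L \<Longrightarrow> smooth_on S f \<Longrightarrow> smooth_on S (\<lambda>x. L (f x))"
  by (simp add: smooth_on_def Ck_on_bounded_linear)

lemma smooth_on_linear: "open S \<Longrightarrow> bounded_linear L \<Longrightarrow> smooth_on S L"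
  by (simp add: smooth_on_def Ck_on_linear)

lemma smooth_on_bounded_bilinear:
  "open S \<Longrightarrow> bounded_bilinear pr \<Longrightarrow> smooth_on S f \<Longrightarrow> smooth_on S g \<Longrightarrow> smooth_on S (\<lambda>x. pr (f x) (g x))"
  by (simp add: smooth_on_def Ck_on_bounded_bilinear)

lemma smooth_on_add: "open S \<Longrightarrow> smooth_on S f \<Longrightarrow> smooth_on S g \<Longrightarrow> smooth_on S (\<lambda>x. f x + g x)"
  by (simp add: smooth_on_def Ck_on_add)

lemma smooth_on_diff: "open S \<Longrightarrow> smooth_on S f \<Longrightarrow> smooth_on S g \<Longrightarrow> smooth_on S (\<lambda>x. f x - g x)"
  by (simp add: smooth_on_def Ck_on_diff)

lemma smooth_on_sum: "open S \<Longrightarrow> (\<And>i. i \<in> A \<Longrightarrow> smooth_on S (f i)) \<Longrightarrow> smooth_on S (\<lambda>x. \<Sum>i\<in>A. f i x)"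
  by (simp add: smooth_on_def Ck_on_sum)

lemma smooth_on_Pair: "open S \<Longrightarrow> smooth_on S f \<Longrightarrow> smooth_on S g \<Longrightarrow> smooth_on S (\<lambda>x. (f x, g x))"
  by (simp add: smooth_on_def Ck_on_Pair)

lemma smooth_on_vec:
  fixes f :: "'a::real_normed_vector \<Rightarrow> real ^ 'n"
  shows "open S \<Longrightarrow> (\<And>i. smooth_on S (\<lambda>x. f x $ i)) \<Longrightarrow> smooth_on S f"
  by (simp add: smooth_on_def Ck_on_vec)

lemma smooth_on_compose:
  fixes f :: "'a::real_normed_vector \<Rightarrow> 'b::euclidean_space" and g :: "'b \<Rightarrow> 'c::real_normed_vector"
  shows "open S \<Longrightarrow> open T \<Longrightarrow> f ` S \<subseteq> T \<Longrightarrow> smooth_on S f \<Longrightarrow> smooth_on T g \<Longrightarrow> smooth_on S (\<lambda>x. g (f x))"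
  unfolding smooth_on_def using Ck_on_compose by blast

lemmas smooth_on_scaleR = smooth_on_bounded_bilinear[OF _ bounded_bilinear_scaleR]
lemmas smooth_on_mult = smooth_on_bounded_bilinear[OF _ bounded_bilinear_mult]
lemmas smooth_on_inner = smooth_on_bounded_bilinear[OF _ bounded_bilinear_inner]
lemmas smooth_on_minus = smooth_on_bounded_linear[OF _ bounded_linear_minus[OF bounded_linear_ident]]
lemmas smooth_on_vec_nth = smooth_on_bounded_linear[OF _ bounded_linear_vec_nth]
lemmas smooth_on_snd = smooth_on_bounded_linear[OF _ bounded_linear_snd]

lemma derivative_compose:
  assumes "g differentiable (at (f x))" "f differentiable (at x)"
  shows "frechet_derivative (\<lambda>y. g (f y)) (at x) v = frechet_derivative g (at (f x)) (frechet_derivative f (at x) v)"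
  using has_derivative_compose[of f "frechet_derivative f (at x)" x UNIV g "frechet_derivative g (at (f x))"] assms
  by (metis frechet_derivative_at frechet_derivative_works)

text \<open>
  The relative version serves potentials in all directions (\<open>P = 0\<close>) as well as potentials in
  the spatial directions only, with the time as a parameter.
\<close>

lemma relative_Poincare:
  fixes \<omega> :: "'a::euclidean_space \<Rightarrow> 'a \<Rightarrow> real"
  assumes "open V" and P: "bounded_linear P" "\<And>z. P (P z) = P z" "P c = 0"
    and star: "\<And>z t. z \<in> V \<Longrightarrow> t \<in> {0..1} \<Longrightarrow> c + P z + t *\<^sub>R (z - (c + P z)) \<in> V"
    and smooth: "\<And>v. smooth_on V (\<lambda>z. \<omega> z v)" and lin: "\<And>z. z \<in> V \<Longrightarrow> linear (\<omega> z)"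
    and closed: "\<And>z v w. z \<in> V \<Longrightarrow> P v = 0 \<Longrightarrow> P w = 0 \<Longrightarrow>
      frechet_derivative (\<lambda>y. \<omega> y v) (at z) w = frechet_derivative (\<lambda>y. \<omega> y w) (at z) v"
  defines "F \<equiv> \<lambda>z. integral {0..1} (\<lambda>t. \<omega> (c + P z + t *\<^sub>R (z - (c + P z))) (z - (c + P z)))"
  shows "smooth_on V F" and "\<And>z w. z \<in> V \<Longrightarrow> P w = 0 \<Longrightarrow> frechet_derivative F (at z) w = \<omega> z w"
proof -
  interpret P: bounded_linear P by fact
  \<comment> \<open>\<open>c + P z\<close> is the base point of the fibre of \<open>P\<close>
    through \<open>z\<close>, \<open>u z\<close> the displacement from it, and
    \<open>\<zeta>\<close> runs along the segment from the base point to \<open>z\<close>.\<close>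
  define u where "u z = z - (c + P z)" for z
  define \<zeta> where "\<zeta> y = c + P (fst y) + snd y *\<^sub>R u (fst y)" for y :: "'a \<times> real"
  \<comment> \<open>Smoothness is known for \<open>\<omega> z v\<close> with \<open>v\<close> fixed,
    hence the expansion of the moving argument \<open>u z\<close>.\<close>
  define f where "f y = (\<Sum>b\<in>Basis. (u (fst y) \<bullet> b) * \<omega> (\<zeta> y) b)" for y
  define W where "W = \<zeta> -` V"
  have su: "smooth_on UNIV u"
    unfolding u_def by (intro smooth_on_diff smooth_on_add smooth_on_const smooth_on_ident smooth_on_linear P(1)) auto
  have sf: "smooth_on UNIV (\<lambda>y::'a \<times> real. u (fst y))"
    by (rule smooth_on_compose[of _ UNIV fst u]) (auto intro!: su smooth_on_linear bounded_linear_fst)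
  have sz: "smooth_on UNIV \<zeta>"
    unfolding \<zeta>_def
    by (intro smooth_on_add smooth_on_const smooth_on_scaleR sf smooth_on_linear[OF _ bounded_linear_snd]
        smooth_on_bounded_linear[OF _ P(1)] smooth_on_linear[OF _ bounded_linear_fst]) auto
  have "continuous_on UNIV \<zeta>" using Ck_on_continuous smooth_onD[OF sz] by blast
  then have "open W" unfolding W_def using \<open>open V\<close> by (rule open_vimage[rotated])
  have VW: "V \<times> {0..1} \<subseteq> W" using star by (auto simp: W_def \<zeta>_def u_def)
  have \<zeta>V: "\<zeta> (z, t) \<in> V" if "z \<in> V" "t \<in> {0..1}" for z t
    using star[OF that] by (simp add: \<zeta>_def u_def)
  have sW: "smooth_on W f"
    unfolding f_def
  proof (intro smooth_on_sum smooth_on_mult smooth_on_inner smooth_on_const \<open>open W\<close>)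
    show "smooth_on W (\<lambda>x. u (fst x))" using sf smooth_on_subset by blast
    show "smooth_on W (\<lambda>x. \<omega> (\<zeta> x) b)" for b
      using smooth_on_subset[OF sz, of W]
      by (intro smooth_on_compose[OF \<open>open W\<close> \<open>open V\<close> _ _ smooth]) (auto simp: W_def)
  qed
  have fw: "f y = \<omega> (\<zeta> y) (u (fst y))" if "y \<in> W" for y
    unfolding f_def using linear_euclidean_representation[OF lin, of "\<zeta> y" "u (fst y)"] that
    by (simp add: W_def)
  have F: "F z = integral {0..1} (\<lambda>t. f (z, t))" if "z \<in> V" for z
    unfolding F_def
  proof (rule integral_cong)
    fix t :: real assume "t \<in> {0..1}"
    then have "(z, t) \<in> W" using VW that by blast
    from fw[OF this] show "\<omega> (c + P z + t *\<^sub>R (z - (c + P z))) (z - (c + P z)) = f (z, t)"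
      by (simp add: \<zeta>_def u_def)
  qed
  have "Ck_on k V F" for k
    using Ck_on_parametric_integral[OF \<open>open V\<close> \<open>open W\<close> VW smooth_onD[OF sW], of k]
    by (subst Ck_on_cong[OF \<open>open V\<close> F])
  then show "smooth_on V F" by (simp add: smooth_on_def)
  fix z w assume z: "z \<in> V" and w: "P w = 0"
  have Pu: "P (u z) = 0" by (simp add: u_def P.diff P.add P(2,3))
  \<comment> \<open>Along \<open>w\<close> in the kernel of \<open>P\<close> the base point stays
    put, so only the displacement changes.\<close>
  have uw: "u (z + s *\<^sub>R w) = u z + s *\<^sub>R w" for s by (simp add: u_def P.add P.scaleR w)
  have \<zeta>w: "\<zeta> (z + s *\<^sub>R w, t) = \<zeta> (z, t) + s *\<^sub>R (t *\<^sub>R w)" for s t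
    by (simp add: \<zeta>_def uw P.add P.scaleR w algebra_simps)
  let ?D = "\<lambda>v t. frechet_derivative (\<lambda>y. \<omega> y v) (at (\<zeta> (z, t)))"
  have D: "((\<lambda>y. \<omega> y v) has_derivative ?D v t) (at (\<zeta> (z, t)))" if "t \<in> {0..1}" for v t
    by (rule smooth_on_has_derivative[OF smooth \<zeta>V[OF z that]])
  have Df: "frechet_derivative f (at (z, t)) (w, 0) = ?D (u z) t (t *\<^sub>R w) + \<omega> (\<zeta> (z, t)) w"
    if t: "t \<in> {0..1}" for t
  proof (rule derivative_along_line_eq[where f = f and x = "(z, t)" and v = "(w, 0)"])
    have "(z, t) \<in> W" using VW z t by blast
    then show "(f has_derivative frechet_derivative f (at (z, t))) (at (z, t))"
      by (rule smooth_on_has_derivative[OF sW])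
    let ?h = "\<lambda>s. \<omega> (\<zeta> (z, t) + s *\<^sub>R (t *\<^sub>R w)) (u z) + s * \<omega> (\<zeta> (z, t) + s *\<^sub>R (t *\<^sub>R w)) w"
    have "((\<lambda>s. \<omega> (\<zeta> (z, t) + s *\<^sub>R (t *\<^sub>R w)) v) has_vector_derivative ?D v t (t *\<^sub>R w)) (at 0)" for v
      by (rule has_vector_derivative_along_line) (use D[OF t] in simp)
    then have "((\<lambda>s. \<omega> (\<zeta> (z, t) + s *\<^sub>R (t *\<^sub>R w)) v) has_real_derivative ?D v t (t *\<^sub>R w)) (at 0)" for v
      by (simp add: has_real_derivative_iff_has_vector_derivative)
    from DERIV_add[OF this DERIV_mult[OF DERIV_ident this]]
    have h: "(?h has_vector_derivative (?D (u z) t (t *\<^sub>R w) + \<omega> (\<zeta> (z, t)) w)) (at 0)"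
      by (simp add: has_real_derivative_iff_has_vector_derivative add.commute)
    have "open ((\<lambda>s. (z, t) + s *\<^sub>R (w, 0)) -` W)"
      by (intro open_vimage[OF \<open>open W\<close>] continuous_intros)
    moreover have "f ((z, t) + s *\<^sub>R (w, 0)) = ?h s" if "s \<in> (\<lambda>s. (z, t) + s *\<^sub>R (w, 0)) -` W" for s
    proof -
      have "(z + s *\<^sub>R w, t) \<in> W" using that by simp
      moreover then have "linear (\<omega> (\<zeta> (z + s *\<^sub>R w, t)))" using lin by (simp add: W_def)
      ultimately show ?thesis using fw[of "(z + s *\<^sub>R w, t)"]
        by (simp add: \<zeta>w uw linear_add linear_cmul)
    qed
    ultimately show "((\<lambda>s. f ((z, t) + s *\<^sub>R (w, 0))) has_vector_derivative
        ?D (u z) t (t *\<^sub>R w) + \<omega> (\<zeta> (z, t)) w) (at 0)"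
      using \<open>(z, t) \<in> W\<close> by (intro has_vector_derivative_transform_within_open[OF h]) auto
  qed
  \<comment> \<open>Closedness exchanges the two arguments, which makes the differentiated integrand
    the \<open>t\<close>-derivative of \<open>t * \<omega> (\<zeta> (z, t)) w\<close>. Its integral
    is the value at \<open>t = 1\<close>, where \<open>\<zeta> (z, 1) = z\<close>.\<close>
  have "((\<lambda>t. t * \<omega> (\<zeta> (z, t)) w) has_vector_derivative
      ?D (u z) t (t *\<^sub>R w) + \<omega> (\<zeta> (z, t)) w) (at t within {0..1})" if t: "t \<in> {0..1}" for t
  proof -
    have \<zeta>t: "\<zeta> (z, t) = c + P z + t *\<^sub>R u z" for t by (simp add: \<zeta>_def)
    have "((\<lambda>t. \<omega> (c + P z + t *\<^sub>R u z) w) has_vector_derivative ?D w t (u z)) (at t)"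
      by (rule has_vector_derivative_along_line) (use D[OF t] in \<open>simp add: \<zeta>t\<close>)
    then have "((\<lambda>t. \<omega> (\<zeta> (z, t)) w) has_real_derivative ?D w t (u z)) (at t)"
      by (simp add: has_real_derivative_iff_has_vector_derivative \<zeta>t)
    from DERIV_mult[OF DERIV_ident this]
    have "((\<lambda>t. t * \<omega> (\<zeta> (z, t)) w) has_vector_derivative t * ?D w t (u z) + \<omega> (\<zeta> (z, t)) w) (at t)"
      by (simp add: has_real_derivative_iff_has_vector_derivative mult.commute add.commute)
    moreover have "t * ?D w t (u z) = ?D (u z) t (t *\<^sub>R w)"
    proof -
      have "?D w t (u z) = ?D (u z) t w" using closed[OF \<zeta>V[OF z t] w Pu] .
      then show ?thesis using linear_cmul[OF has_derivative_linear[OF D[OF t]]] by simp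
    qed
    ultimately show ?thesis by (metis has_vector_derivative_at_within)
  qed
  from fundamental_theorem_of_calculus[OF zero_le_one this]
  have "((\<lambda>t. ?D (u z) t (t *\<^sub>R w) + \<omega> (\<zeta> (z, t)) w) has_integral \<omega> (\<zeta> (z, 1)) w) {0..1}"
    by simp
  moreover have "\<zeta> (z, 1) = z" by (simp add: \<zeta>_def u_def)
  ultimately have I: "integral {0..1} (\<lambda>t. ?D (u z) t (t *\<^sub>R w) + \<omega> (\<zeta> (z, t)) w) = \<omega> z w"
    by (simp add: integral_unique)
  have "((\<lambda>z. integral {0..1} (\<lambda>t. f (z, t))) has_derivative
      (\<lambda>v. integral {0..1} (\<lambda>t. frechet_derivative f (at (z, t)) (v, 0)))) (at z)"
    by (rule has_derivative_parametric_integral[OF \<open>open V\<close> \<open>open W\<close> VW smooth_onD[OF sW] z])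
  then have "(F has_derivative (\<lambda>v. integral {0..1} (\<lambda>t. frechet_derivative f (at (z, t)) (v, 0)))) (at z)"
    by (rule has_derivative_transform_within_open[OF _ \<open>open V\<close> z]) (rule F[symmetric])
  then have "frechet_derivative F (at z) w = integral {0..1} (\<lambda>t. frechet_derivative f (at (z, t)) (w, 0))"
    by (metis frechet_derivative_at)
  also have "\<dots> = \<omega> z w"
    unfolding I[symmetric] by (intro integral_cong Df)
  finally show "frechet_derivative F (at z) w = \<omega> z w" .
qed

section \<open>Smooth inverse maps\<close>

lemma Ck_on_det:
  fixes A :: "'a::real_normed_vector \<Rightarrow> real ^ 'n ^ 'n"
  assumes "open S" "\<And>i j. Ck_on k S (\<lambda>x. A x $ i $ j)"
  shows "Ck_on k S (\<lambda>x. det (A x))"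
  unfolding det_def using assms by (intro Ck_on_sum Ck_on_mult Ck_on_const Ck_on_prod) auto

text \<open>By Cramer's rule the derivative of \<open>g\<close> at \<open>y\<close> is a quotient of
  determinants in the entries of the derivative of \<open>f\<close> at \<open>g y\<close>. So if
  \<open>g\<close> is C^k, its derivative is C^k as well, and \<open>g\<close> gains one
  order.\<close>

lemma smooth_on_inverse_map:
  fixes f g :: "real ^ 'n \<Rightarrow> real ^ 'n"
  assumes "open U" "open V" "smooth_on U f" "homeomorphism U V f g"
    and g: "\<And>y. y \<in> V \<Longrightarrow> (g has_derivative inv (frechet_derivative f (at (g y)))) (at y)"
    and bij: "\<And>y. y \<in> V \<Longrightarrow> bij (frechet_derivative f (at (g y)))"
  shows "smooth_on V g"
proof -
  let ?M = "\<lambda>x. matrix (frechet_derivative f (at x))"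
  let ?R = "\<lambda>x w. (\<chi> l. det (\<chi> i j. if j = l then w $ i else ?M x $ i $ j) / det (?M x)) :: real ^ 'n"
  have gV: "g y \<in> U" if "y \<in> V" for y using assms(4) that by (auto simp: homeomorphism_def)
  define T where "T = {x \<in> U. det (?M x) \<noteq> 0}"
  have lin: "linear (frechet_derivative f (at x))" if "x \<in> U" for x
    using smooth_on_has_derivative[OF assms(3) that] has_derivative_linear by blast
  have M: "Ck_on k U (\<lambda>x. ?M x $ i $ j)" for k i j
    unfolding matrix_def using smooth_onD[OF smooth_on_derivative[OF assms(3)]] assms(1)
    by (simp add: Ck_on_vec_nth)
  have "open T"
  proof -
    have "continuous_on U (\<lambda>x. det (?M x))" using Ck_on_det[OF assms(1) M] Ck_on_continuous by blast
    then have "open (U \<inter> (\<lambda>x. det (?M x)) -` (- {0}))"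
      using assms(1) by (intro continuous_open_preimage) auto
    moreover have "U \<inter> (\<lambda>x. det (?M x)) -` (- {0}) = T" by (auto simp: T_def)
    ultimately show ?thesis by simp
  qed
  have gT: "g ` V \<subseteq> T" using gV det_nz_iff_inj[OF lin[OF gV]] bij_is_inj[OF bij] by (auto simp: T_def)
  have inv_eq: "inv (frechet_derivative f (at (g y))) w = ?R (g y) w" if "y \<in> V" for y w
  proof -
    have "det (?M (g y)) \<noteq> 0" using gT that by (auto simp: T_def)
    from cramer[OF this, of "?R (g y) w" w] have eq: "?M (g y) *v ?R (g y) w = w" by (rule iffD2) (rule refl)
    have "frechet_derivative f (at (g y)) (?R (g y) w) = ?M (g y) *v ?R (g y) w"
      using fun_cong[OF matrix_vector_mul(2)[OF lin[OF gV[OF that]]], of "?R (g y) w"] by (rule sym)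
    from inv_f_eq[OF bij_is_inj[OF bij[OF that]] trans[OF this eq]] show ?thesis .
  qed
  have R: "Ck_on k T (\<lambda>x. ?R x w)" for k w
  proof (rule Ck_on_vec[OF \<open>open T\<close>])
    fix l
    have MT: "Ck_on k T (\<lambda>x. ?M x $ i $ j)" for i j using M by (rule Ck_on_subset) (auto simp: T_def)
    have "Ck_on k T (\<lambda>x. (\<chi> i j. if j = l then w $ i else ?M x $ i $ j) $ i $ j)" for i j
      using MT Ck_on_const[OF \<open>open T\<close>] by (cases "j = l") auto
    then have "Ck_on k T (\<lambda>x. det (\<chi> i j. if j = l then w $ i else ?M x $ i $ j) / det (?M x))"
      using MT by (intro Ck_on_divide Ck_on_det \<open>open T\<close>) (auto simp: T_def)
    then show "Ck_on k T (\<lambda>x. ?R x w $ l)" by simp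
  qed
  have "Ck_on k V g" for k
  proof (induction k)
    case 0
    then show ?case using assms(4) by (auto simp: homeomorphism_def)
  next
    case (Suc k)
    have "(g has_derivative (\<lambda>w. ?R (g y) w)) (at y)" if "y \<in> V" for y
      by (rule has_derivative_eq_rhs[OF g[OF that]]) (use inv_eq[OF that] in blast)
    moreover have "Ck_on k V (\<lambda>y. ?R (g y) w)" for w
      by (rule Ck_on_compose[OF assms(2) \<open>open T\<close> gT Suc R])
    ultimately show ?case by (intro Ck_on_SucI[OF assms(2)])
  qed
  then show ?thesis by (simp add: smooth_on_def)
qed

text \<open>The inverse function theorem concerns maps of a space into itself. It is therefore
  applied to \<open>f \<circ> \<kappa>\<close> with a linear isomorphism \<open>\<kappa>\<close>
  from \<open>real ^ 'n\<close>, and the result is carried back by \<open>\<iota>\<close>.\<close>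

lemma local_coordinates_if_injective_derivative:
  fixes f :: "'a::euclidean_space \<Rightarrow> real ^ 'n"
  assumes dim: "DIM('a) = CARD('n)" and "open S" "smooth_on S f" "z \<in> S"
    and inj: "\<And>v. frechet_derivative f (at z) v = 0 \<Longrightarrow> v = 0"
  shows "\<exists>U\<subseteq>S. z \<in> U \<and> local_coordinates U f"
proof -
  have "DIM(real ^ 'n) = DIM('a)" using dim by simp
  from isomorphisms_UNIV_UNIV[OF this]
  obtain \<kappa> :: "real ^ 'n \<Rightarrow> 'a" and \<iota>
    where \<kappa>: "linear \<kappa>" "linear \<iota>" "\<And>x. \<iota> (\<kappa> x) = x" "\<And>y. \<kappa> (\<iota> y) = y"
    by metis
  have bl: "bounded_linear \<kappa>" "bounded_linear \<iota>" using \<kappa> by (auto simp: linear_conv_bounded_linear)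
  define F where "F x = f (\<kappa> x)" for x
  let ?T = "\<kappa> -` S"
  have "open ?T" using assms(2) bl by (intro open_vimage) (auto intro: linear_continuous_on)
  have sF: "smooth_on ?T F" unfolding F_def
    using assms bl \<open>open ?T\<close> by (intro smooth_on_compose[of _ S \<kappa> f]) (auto intro: smooth_on_linear)
  define F' where "F' x = Blinfun (frechet_derivative F (at x))" for x
  have F': "blinfun_apply (F' x) = frechet_derivative F (at x)" if "x \<in> ?T" for x
    unfolding F'_def using continuous_on_frechet_derivative_blinfun(2)[OF smooth_onD[OF sF] that] .
  have zT: "\<iota> z \<in> ?T" using \<kappa> assms by simp
  have DF: "frechet_derivative F (at (\<iota> z)) v = frechet_derivative f (at z) (\<kappa> v)" for v
  proof -
    have "frechet_derivative \<kappa> (at x) = \<kappa>" for x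
      using bl(1) by (metis bounded_linear_imp_has_derivative frechet_derivative_at)
    then show ?thesis unfolding F_def
      using derivative_compose[of f \<kappa> "\<iota> z" v] smooth_on_differentiable[OF assms(3,4)] \<kappa> bl
      by (simp add: bounded_linear_imp_differentiable)
  qed
  have "inj (blinfun_apply (F' (\<iota> z)))"
    unfolding linear_injective_0[OF bounded_linear.linear[OF blinfun.bounded_linear_right]]
    using inj DF F'[OF zT] \<kappa> by (metis linear_0)
  then obtain L where L: "linear L" "L \<circ> blinfun_apply (F' (\<iota> z)) = id"
    using linear_injective_left_inverse[OF bounded_linear.linear[OF blinfun.bounded_linear_right]] by blast
  have "Blinfun L o\<^sub>L F' (\<iota> z) = id_blinfun"
    using L by (intro blinfun_eqI) (simp add: bounded_linear_Blinfun_apply linear_conv_bounded_linear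
        fun_eq_iff)
  then obtain U' V g g' where U': "open U'" "U' \<subseteq> ?T" "\<iota> z \<in> U'" "open V" "homeomorphism U' V F g"
    and g': "\<And>y. y \<in> V \<Longrightarrow> (g has_derivative (g' y)) (at y)"
      "\<And>y. y \<in> V \<Longrightarrow> g' y = inv (blinfun_apply (F' (g y)))"
      "\<And>y. y \<in> V \<Longrightarrow> bij (blinfun_apply (F' (g y)))"
    using inverse_function_theorem[OF \<open>open ?T\<close> _ _ zT, of F F'] F'
      smooth_on_has_derivative[OF sF] continuous_on_frechet_derivative_blinfun(1)[OF smooth_onD[OF sF]]
    unfolding F'_def by metis
  have gV: "g y \<in> ?T" if "y \<in> V" for y using U' that by (auto simp: homeomorphism_def)
  have sg: "smooth_on V g"
    using U' g' F'[OF gV] smooth_on_subset[OF sF U'(2)]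
    by (intro smooth_on_inverse_map[of U' V F g]) auto
  define U where "U = \<iota> -` U'"
  have "open U" unfolding U_def using U' bl by (intro open_vimage) (auto intro: linear_continuous_on)
  moreover have "U \<subseteq> S" using U' \<kappa> by (auto simp: U_def)
  moreover have "z \<in> U" using U' by (simp add: U_def)
  moreover have fF: "f x = F (\<iota> x)" for x by (simp add: F_def \<kappa>)
  moreover have im: "f ` U = V"
  proof -
    have "f ` U = F ` (\<iota> ` U)" by (simp add: fF image_image)
    also have "\<iota> ` U = U'" using \<kappa>(3) image_vimage_eq[of \<iota> U'] surjI[of \<iota> \<kappa>] by (simp add: U_def)
    finally show ?thesis using U' by (simp add: homeomorphism_def)
  qed
  moreover have injU: "inj_on f U"
    by (rule inj_onI) (use U' \<kappa> in \<open>metis U_def fF homeomorphism_def vimageE\<close>)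
  moreover have "inv_into U f y = \<kappa> (g y)" if "y \<in> V" for y
    using that U' \<kappa> by (intro inv_into_f_eq[OF injU]) (auto simp: U_def F_def homeomorphism_def)
  then have "smooth_on V (inv_into U f)"
    using sg smooth_on_bounded_linear[OF \<open>open V\<close> bl(1) sg] smooth_on_cong[OF \<open>open V\<close>] by metis
  ultimately show ?thesis
    using smooth_on_subset[OF assms(3)] \<open>open V\<close> unfolding local_coordinates_def by metis
qed

section \<open>Integral equations with parameters\<close>

text \<open>The integral of \<open>g\<close> from \<open>0\<close> to \<open>s\<close>, scaled so that \<open>s\<close> may have either sign.\<close>

definition int_from_0 :: "(real \<Rightarrow> 'e::euclidean_space) \<Rightarrow> real \<Rightarrow> 'e" where
  "int_from_0 g s = s *\<^sub>R integral {0..1} (\<lambda>\<sigma>. g (s * \<sigma>))"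

lemma scaled_mem:
  fixes s \<sigma> b :: real
  assumes "s \<in> {-b..b}" "\<sigma> \<in> {0..1}"
  shows "s * \<sigma> \<in> {-b..b}"
proof -
  have "\<bar>s * \<sigma>\<bar> \<le> b * 1"
    unfolding abs_mult using assms by (intro mult_mono) auto
  then show ?thesis by auto
qed

lemma int_from_0_continuous_integrand:
  fixes g :: "real \<Rightarrow> 'e::topological_space"
  assumes "continuous_on {-b..b} g" "s \<in> {-b..b}"
  shows "continuous_on {0..1} (\<lambda>\<sigma>. g (s * \<sigma>))"
  using scaled_mem[OF assms(2)]
  by (intro continuous_on_compose2[OF assms(1)] continuous_intros) auto

lemma int_from_0_diff:
  assumes "continuous_on {-b..b} f" "continuous_on {-b..b} g" "s \<in> {-b..b}"
  shows "int_from_0 (\<lambda>t. f t - g t) s = int_from_0 f s - int_from_0 g s"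
  unfolding int_from_0_def
  by (simp add: integral_diff integrable_continuous_real int_from_0_continuous_integrand[OF _ assms(3)] assms scaleR_diff_right)

lemma int_from_0_scaleR: "int_from_0 (\<lambda>t. c *\<^sub>R g t) s = c *\<^sub>R int_from_0 g s"
  unfolding int_from_0_def by simp

lemma int_from_0_sum:
  assumes "finite A" "\<And>i. i \<in> A \<Longrightarrow> continuous_on {-b..b} (f i)" "s \<in> {-b..b}"
  shows "int_from_0 (\<lambda>t. \<Sum>i\<in>A. f i t) s = (\<Sum>i\<in>A. int_from_0 (f i) s)"
  unfolding int_from_0_def
  by (simp add: assms integral_sum integrable_continuous_real int_from_0_continuous_integrand[OF _ assms(3)] scaleR_sum_right)

lemma int_from_0_cong:
  assumes "\<And>t. t \<in> {-b..b} \<Longrightarrow> f t = g t" "s \<in> {-b..b}"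
  shows "int_from_0 f s = int_from_0 g s"
proof -
  have "integral {0..1} (\<lambda>\<sigma>. f (s * \<sigma>)) = integral {0..1} (\<lambda>\<sigma>. g (s * \<sigma>))"
    by (rule integral_cong) (rule assms(1)[OF scaled_mem[OF assms(2)]])
  then show ?thesis by (simp add: int_from_0_def)
qed

lemma int_from_0_bound:
  assumes "continuous_on {-b..b} g" "\<And>t. t \<in> {-b..b} \<Longrightarrow> norm (g t) \<le> C" "s \<in> {-b..b}"
  shows "norm (int_from_0 g s) \<le> b * C"
proof -
  have "norm (integral {0..1} (\<lambda>\<sigma>. g (s * \<sigma>))) \<le> C * (1 - 0)"
    using scaled_mem[OF assms(3)] assms(2)
    by (intro integral_bound int_from_0_continuous_integrand[OF assms(1,3)]) auto
  then have "\<bar>s\<bar> * norm (integral {0..1} (\<lambda>\<sigma>. g (s * \<sigma>))) \<le> b * C"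
    using assms(3) by (intro mult_mono) auto
  then show ?thesis by (simp add: int_from_0_def)
qed

lemma continuous_on_int_from_0:
  fixes g :: "real \<times> 'p::topological_space \<Rightarrow> 'e::euclidean_space"
  assumes "continuous_on ({-b..b} \<times> N) g"
  shows "continuous_on ({-b..b} \<times> N) (\<lambda>q. int_from_0 (\<lambda>t. g (t, snd q)) (fst q))"
proof -
  have "continuous_on (({-b..b} \<times> N) \<times> cbox 0 1) (\<lambda>(q, \<sigma>). g (fst q * \<sigma>, snd q))"
    unfolding split_beta using scaled_mem
    by (intro continuous_on_compose2[OF assms] continuous_intros) fastforce+
  from integral_continuous_on_param[OF this] show ?thesis
    unfolding int_from_0_def by (auto intro!: continuous_intros)
qed

lemma int_from_0_has_vector_derivative:
  assumes "continuous_on {-a<..<a} g" "s \<in> {-a<..<a}"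
  shows "(int_from_0 g has_vector_derivative g s) (at s)"
proof -
  have "\<bar>s\<bar> < a" using assms(2) by auto
  then obtain b where b: "\<bar>s\<bar> < b" "b < a" using dense by blast
  define P where "P r = integral {-b..r} g" for r
  have cont: "continuous_on {-b..b} g"
    using assms(1) by (rule continuous_on_subset) (use b in auto)
  have P: "(P has_vector_derivative g r) (at r within {-b..b})" if "r \<in> {-b..b}" for r
    unfolding P_def using that by (rule integral_has_vector_derivative[OF cont])
  \<comment> \<open>Differentiating \<open>P (r * \<sigma>)\<close> in \<open>\<sigma>\<close>
    handles both signs of \<open>r\<close> at once.\<close>
  have eq: "int_from_0 g r = P r - P 0" if r: "r \<in> {-b..b}" for r
  proof -
    have "((\<lambda>\<sigma>. P (r * \<sigma>)) has_vector_derivative r *\<^sub>R g (r * \<sigma>)) (at \<sigma> within {0..1})" if "\<sigma> \<in> {0..1}" for \<sigma>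
    proof -
      have "((\<lambda>\<sigma>. r * \<sigma>) has_vector_derivative r) (at \<sigma> within {0..1})"
        by (auto intro!: derivative_eq_intros simp: has_real_derivative_iff_has_vector_derivative[symmetric])
      moreover have "(P has_vector_derivative g (r * \<sigma>)) (at (r * \<sigma>) within (\<lambda>\<sigma>. r * \<sigma>) ` {0..1})"
        using scaled_mem[OF r] that
        by (intro has_vector_derivative_within_subset[OF P]) auto
      ultimately show ?thesis using vector_diff_chain_within[of "\<lambda>\<sigma>. r * \<sigma>"] by (auto simp: o_def)
    qed
    from fundamental_theorem_of_calculus[OF zero_le_one this]
    have "((\<lambda>\<sigma>. r *\<^sub>R g (r * \<sigma>)) has_integral P r - P 0) {0..1}" by simp
    then show ?thesis unfolding int_from_0_def by (metis integral_cmul integral_unique)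
  qed
  have s: "s \<in> {-b<..<b}" using b by auto
  have "(P has_vector_derivative g s) (at s within {-b<..<b})"
    using s by (intro has_vector_derivative_within_subset[OF P]) auto
  then have "(P has_vector_derivative g s) (at s)"
    using at_within_open[OF s] by simp
  then have "((\<lambda>r. P r - P 0) has_vector_derivative g s) (at s)"
    by (auto intro!: derivative_eq_intros)
  then show ?thesis
    by (rule has_vector_derivative_transform_within_open[OF _ _ s]) (auto simp: eq)
qed

text \<open>On a short time interval this replaces Gronwall's inequality.\<close>

lemma bound_by_contraction:
  fixes R :: "real \<Rightarrow> 'e::real_normed_vector"
  assumes "continuous_on {-b..b} R" "\<kappa> < 1"
    and step: "\<And>s m. s \<in> {-b..b} \<Longrightarrow> (\<And>t. t \<in> {-b..b} \<Longrightarrow> norm (R t) \<le> m) \<Longrightarrow> norm (R s) \<le> \<alpha> + \<kappa> * m"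
    and "s \<in> {-b..b}"
  shows "norm (R s) \<le> \<alpha> / (1 - \<kappa>)"
proof -
  have "continuous_on {-b..b} (\<lambda>t. norm (R t))" using assms(1) by (intro continuous_intros)
  then obtain t where t: "t \<in> {-b..b}" "\<And>t'. t' \<in> {-b..b} \<Longrightarrow> norm (R t') \<le> norm (R t)"
    using continuous_attains_sup[of "{-b..b}" "\<lambda>t. norm (R t)"] assms(4) by auto
  \<comment> \<open>At a point where the norm is maximal, \<open>step\<close> bounds the maximum by
    itself.\<close>
  have "norm (R t) \<le> \<alpha> + \<kappa> * norm (R t)" by (rule step) (use t in auto)
  then have "norm (R t) \<le> \<alpha> / (1 - \<kappa>)" using assms(2) by (simp add: field_simps)
  then show ?thesis using t(2)[OF assms(4)] by simp
qed

text \<open>Uniformity in the base point comes from uniform continuity of the derivative on a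
  compact neighbourhood \<open>K\<close> of \<open>C\<close>, together with the mean value
  inequality on the segment from \<open>x\<close> to \<open>x + h\<close>, which stays in
  \<open>K\<close>.\<close>

lemma uniformly_differentiable_on_compact:
  fixes f :: "'a::euclidean_space \<Rightarrow> 'b::real_normed_vector"
  assumes "open S" "Ck_on 1 S f" "compact C" "C \<subseteq> S" "e > 0"
  obtains d where "d > 0" "\<And>x h. x \<in> C \<Longrightarrow> norm h < d \<Longrightarrow>
    norm (f (x + h) - f x - frechet_derivative f (at x) h) \<le> e * norm h"
proof -
  obtain r where r: "r > 0" "(\<Union>x\<in>C. cball x r) \<subseteq> S"
    using compact_subset_open_imp_cball_epsilon_subset[OF assms(3,1,4)] by blast
  define K where "K = (\<Union>x\<in>C. cball x r)"
  define f' where "f' x = Blinfun (frechet_derivative f (at x))" for x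
  have f': "blinfun_apply (f' x) = frechet_derivative f (at x)" if "x \<in> S" for x
    unfolding f'_def using continuous_on_frechet_derivative_blinfun(2)[OF assms(2) that] .
  have "K = (\<lambda>(x, y). x + y) ` (C \<times> cball 0 r)"
  proof -
    have "x \<in> cball y r \<longleftrightarrow> (\<exists>h\<in>cball 0 r. x = y + h)" for x y :: 'a
      by (auto simp: dist_norm norm_minus_commute intro!: bexI[of _ "x - y"])
    then show ?thesis by (auto simp: K_def image_def)
  qed
  then have "compact K"
    using compact_continuous_image[OF _ compact_Times[OF assms(3) compact_cball], of 0 r "\<lambda>(x, y). x + y"]
    by (simp add: split_beta continuous_intros)
  moreover have "continuous_on K f'"
    unfolding f'_def using continuous_on_frechet_derivative_blinfun(1)[OF assms(2)] r
    by (auto simp: K_def intro: continuous_on_subset)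
  ultimately have "uniformly_continuous_on K f'" by (rule compact_uniformly_continuous[rotated])
  then obtain d where d: "d > 0" "\<And>x y. x \<in> K \<Longrightarrow> y \<in> K \<Longrightarrow> dist y x < d \<Longrightarrow> dist (f' y) (f' x) < e"
    using assms(5) unfolding uniformly_continuous_on_def by metis
  show thesis
  proof (rule that[of "min d r"])
    show "min d r > 0" using d r by simp
    fix x h :: 'a assume x: "x \<in> C" and h: "norm h < min d r"
    have sub: "closed_segment x (x + h) \<subseteq> K \<inter> ball x d"
    proof -
      have "x \<in> ball x (min d r)" "x + h \<in> ball x (min d r)" using d r h by (auto simp: dist_norm)
      then have "closed_segment x (x + h) \<subseteq> ball x (min d r)" by (intro closed_segment_subset) auto
      then show ?thesis using x by (force simp: K_def)
    qed
    have "norm (f (x + h) - f x - blinfun_apply (f' x) h) \<le> norm h * e"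
    proof -
      let ?S = "closed_segment x (x + h)"
      have "norm (f (x + h) - f x - blinfun_apply (f' x) ((x + h) - x)) \<le> norm ((x + h) - x) * e"
      proof (rule differentiable_bound_linearization)
        show "x + t *\<^sub>R (x + h - x) \<in> ?S" if "t \<in> {0..1}" for t
          using that by (auto simp: in_segment algebra_simps intro!: exI[of _ t])
      next
        fix y assume y: "y \<in> ?S"
        then have "y \<in> K" "y \<in> S" using sub r(2) unfolding K_def by blast+
        then show "(f has_derivative blinfun_apply (f' y)) (at y within ?S)"
          using f' Ck_on_Suc_derivative[of 0 S f y] assms(2) by (auto intro: has_derivative_at_withinI)
        have "dist y x < d" using sub y by (auto simp: dist_commute)
        moreover have "x \<in> K" using x r by (force simp: K_def)
        ultimately have "norm (f' y - f' x) < e" using d(2) \<open>y \<in> K\<close> by (simp add: dist_norm)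
        moreover have "blinfun_apply (f' y) - blinfun_apply (f' x) = blinfun_apply (f' y - f' x)"
          by (simp add: fun_eq_iff blinfun.diff_left)
        ultimately show "onorm (blinfun_apply (f' y) - blinfun_apply (f' x)) \<le> e"
          by (simp add: norm_blinfun.rep_eq)
      qed simp
      then show ?thesis by simp
    qed
    then show "norm (f (x + h) - f x - frechet_derivative f (at x) h) \<le> e * norm h"
      using f'[of x] x assms(4) by (auto simp: mult.commute)
  qed
qed

section \<open>Existence by contraction\<close>

text \<open>Banach's fixed point theorem is applied to functions of \<open>(s, p)\<close> jointly,
  so that continuity in the parameter comes with the solution. The condition on \<open>b * L\<close>
  gives the contraction factor 1/2.\<close>

lemma integral_equation_solvable:
  fixes H :: "real \<times> 'p::euclidean_space \<Rightarrow> 'e::euclidean_space" and G :: "(real \<times> 'p) \<times> 'e \<Rightarrow> 'e"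
  defines "K \<equiv> \<lambda>b p r. {-b..b} \<times> cball p r"
  assumes "b > 0" "r > 0" and H: "continuous_on (K b p\<^sub>0 r) H"
    and G: "continuous_on (K b p\<^sub>0 r \<times> UNIV) G"
    and lip: "\<And>q v w. q \<in> K b p\<^sub>0 r \<Longrightarrow> norm (G (q, v) - G (q, w)) \<le> L * norm (v - w)" and "b * L \<le> 1/2"
  obtains Y where "continuous_on (K b p\<^sub>0 r) Y"
    "\<And>s p. (s, p) \<in> K b p\<^sub>0 r \<Longrightarrow> Y (s, p) = H (s, p) + int_from_0 (\<lambda>t. G ((t, p), Y (t, p))) s"
proof -
  let ?K = "K b p\<^sub>0 r"
  have K: "compact ?K" "convex ?K" "closed ?K" "?K \<noteq> {}"
    using assms(2,3) by (auto simp: K_def compact_Times convex_Times closed_Times)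
  \<comment> \<open>The complete space of bounded continuous functions consists of functions on the
    whole type. Composing with the nearest-point map onto the convex set \<open>?K\<close> extends
    functions from \<open>?K\<close> without changing them there.\<close>
  define \<rho> where "\<rho> q = closest_point ?K q" for q
  have \<rho>: "continuous_on UNIV \<rho>" "\<rho> q \<in> ?K" "q \<in> ?K \<Longrightarrow> \<rho> q = q" for q
    unfolding \<rho>_def using K
    by (auto intro: continuous_on_closest_point closest_point_in_set closest_point_self)
  define h where "h \<eta> q = H q + int_from_0 (\<lambda>t. G ((t, snd q), \<eta> (t, snd q))) (fst q)" for \<eta> q
  have cG: "continuous_on ?K (\<lambda>q. G (q, \<eta> q))" if "continuous_on UNIV \<eta>" for \<eta>
    using that by (intro continuous_on_compose2[OF G] continuous_intros) (auto elim: continuous_on_subset)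
  have ch: "continuous_on ?K (h \<eta>)" if "continuous_on UNIV \<eta>" for \<eta>
    unfolding h_def using continuous_on_int_from_0[OF cG[OF that, unfolded K_def]]
    by (intro continuous_intros H) (simp add: K_def)
  have cT: "h \<eta> \<circ> \<rho> \<in> bcontfun" if "continuous_on UNIV \<eta>" for \<eta>
  proof -
    have "continuous_on UNIV (h \<eta> \<circ> \<rho>)"
      using \<rho> ch[OF that] by (intro continuous_on_compose) (auto elim: continuous_on_subset)
    moreover have "bounded (range (h \<eta> \<circ> \<rho>))"
      using \<rho>(2) by (intro bounded_subset[OF compact_imp_bounded[OF compact_continuous_image[OF ch[OF that] K(1)]]]) auto
    ultimately show ?thesis by (simp add: bcontfun_def)
  qed
  define T where "T \<eta> = Bcontfun (h (apply_bcontfun \<eta>) \<circ> \<rho>)" for \<eta> :: "(real \<times> 'p) \<Rightarrow>\<^sub>C 'e"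
  have T: "apply_bcontfun (T \<eta>) q = h (apply_bcontfun \<eta>) (\<rho> q)" for \<eta> q
    unfolding T_def using cT[of "apply_bcontfun \<eta>"] by (simp add: Bcontfun_inverse continuous_on_apply_bcontfun)
  have "dist (T \<eta>) (T \<eta>') \<le> 1/2 * dist \<eta> \<eta>'" for \<eta> \<eta>'
  proof (rule dist_bound)
    fix q
    obtain s p where sp: "\<rho> q = (s, p)" by fastforce
    then have s: "s \<in> {-b..b}" and p: "p \<in> cball p\<^sub>0 r" using \<rho>(2)[of q] by (auto simp: K_def)
    have c: "continuous_on {-b..b} (\<lambda>t. G ((t, p), apply_bcontfun \<eta> (t, p)))" for \<eta>
      using p by (intro continuous_on_compose2[OF cG[OF continuous_on_apply_bcontfun[of UNIV \<eta>]], of _ "\<lambda>t. (t, p)"] continuous_intros)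
        (auto simp: K_def)
    have "norm (G ((t, p), apply_bcontfun \<eta> (t, p)) - G ((t, p), apply_bcontfun \<eta>' (t, p))) \<le> \<bar>L\<bar> * dist \<eta> \<eta>'"
      if "t \<in> {-b..b}" for t
    proof -
      have "norm (G ((t, p), apply_bcontfun \<eta> (t, p)) - G ((t, p), apply_bcontfun \<eta>' (t, p)))
        \<le> L * norm (apply_bcontfun \<eta> (t, p) - apply_bcontfun \<eta>' (t, p))"
        using that p by (intro lip) (auto simp: K_def)
      also have "\<dots> \<le> \<bar>L\<bar> * norm (apply_bcontfun \<eta> (t, p) - apply_bcontfun \<eta>' (t, p))"
        by (intro mult_right_mono) auto
      also have "\<dots> \<le> \<bar>L\<bar> * dist \<eta> \<eta>'"
        using dist_bounded[of \<eta> "(t, p)" \<eta>'] by (intro mult_left_mono) (auto simp: dist_norm)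
      finally show ?thesis .
    qed
    note int_from_0_bound[OF continuous_on_diff[OF c c] this s]
    moreover have "L \<ge> 0"
    proof -
      obtain i :: 'e where "i \<in> Basis" using nonempty_Basis by blast
      then have "0 \<le> L * norm (i - 0)"
        using lip[OF \<rho>(2), of q i 0] norm_ge_zero order_trans by blast
      then show ?thesis using \<open>i \<in> Basis\<close> by simp
    qed
    ultimately have "norm (int_from_0 (\<lambda>t. G ((t, p), apply_bcontfun \<eta> (t, p)) - G ((t, p), apply_bcontfun \<eta>' (t, p))) s)
       \<le> (b * L) * dist \<eta> \<eta>'" by simp
    also have "\<dots> \<le> 1/2 * dist \<eta> \<eta>'" by (intro mult_right_mono assms) auto
    finally have "norm (int_from_0 (\<lambda>t. G ((t, p), apply_bcontfun \<eta> (t, p)) - G ((t, p), apply_bcontfun \<eta>' (t, p))) s)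
       \<le> 1/2 * dist \<eta> \<eta>'" .
    then show "dist (apply_bcontfun (T \<eta>) q) (apply_bcontfun (T \<eta>') q) \<le> 1/2 * dist \<eta> \<eta>'"
      by (simp add: T sp h_def dist_norm int_from_0_diff[OF c c s])
  qed
  then obtain \<eta> where \<eta>: "T \<eta> = \<eta>"
    using banach_fix_type[of "1/2" T] by auto
  show thesis
  proof (rule that[of "apply_bcontfun \<eta>"])
    show "continuous_on ?K (apply_bcontfun \<eta>)" by (rule continuous_on_apply_bcontfun)
    fix s p assume "(s, p) \<in> ?K"
    then show "apply_bcontfun \<eta> (s, p) = H (s, p) + int_from_0 (\<lambda>t. G ((t, p), apply_bcontfun \<eta> (t, p))) s"
      using T[of \<eta> "(s, p)"] \<rho>(3) by (simp add: \<eta> h_def)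
  qed
qed

section \<open>Differentiability in the parameters\<close>

lemma Ck_on_1_linear_derivative:
  assumes "Ck_on 1 S f" "x \<in> S"
  shows "linear (frechet_derivative f (at x))"
proof -
  have "(f has_derivative frechet_derivative f (at x)) (at x)"
    using Ck_on_Suc_derivative[of 0] assms by simp
  then show ?thesis by (rule has_derivative_linear)
qed

lemma Ck_on_1_continuous_derivative: "Ck_on 1 S f \<Longrightarrow> continuous_on S (\<lambda>x. frechet_derivative f (at x) v)"
  unfolding One_nat_def Ck_on.simps by blast

lemma bounded_linear_family_on_compact:
  fixes A :: "'q::topological_space \<Rightarrow> 'a::euclidean_space \<Rightarrow> 'b::real_normed_vector"
  assumes "compact C" "\<And>q. q \<in> C \<Longrightarrow> linear (A q)" "\<And>i. i \<in> Basis \<Longrightarrow> continuous_on C (\<lambda>q. A q i)"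
  obtains B where "B \<ge> 0" "\<And>q w. q \<in> C \<Longrightarrow> norm (A q w) \<le> B * norm w"
proof -
  have "\<exists>B\<ge>0. \<forall>q\<in>C. norm (A q i) \<le> B" if "i \<in> Basis" for i
  proof -
    have "bounded ((\<lambda>q. A q i) ` C)"
      using compact_continuous_image[OF assms(3)[OF that] assms(1)] by (rule compact_imp_bounded)
    then obtain B where "\<forall>q\<in>C. norm (A q i) \<le> B" by (auto simp: bounded_iff)
    then show ?thesis by (intro exI[of _ "max B 0"]) auto
  qed
  then obtain B where B: "\<And>i. i \<in> Basis \<Longrightarrow> B i \<ge> 0" "\<And>i q. i \<in> Basis \<Longrightarrow> q \<in> C \<Longrightarrow> norm (A q i) \<le> B i"
    by metis
  show thesis
  proof (rule that[of "sum B Basis"])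
    show "sum B Basis \<ge> 0" using B by (intro sum_nonneg)
    fix q w assume q: "q \<in> C"
    have "norm (A q w) = norm (\<Sum>i\<in>Basis. (w \<bullet> i) *\<^sub>R A q i)"
      using linear_euclidean_representation[OF assms(2)[OF q], of w] by simp
    also have "\<dots> \<le> (\<Sum>i\<in>Basis. norm ((w \<bullet> i) *\<^sub>R A q i))" by (rule norm_sum)
    also have "\<dots> \<le> (\<Sum>i\<in>Basis. norm w * B i)"
      using B q by (intro sum_mono) (auto intro!: mult_mono simp: Basis_le_norm)
    finally show "norm (A q w) \<le> sum B Basis * norm w"
      by (simp add: sum_distrib_left mult.commute)
  qed
qed

text \<open>\<open>V w\<close> solves the linearised equation. First the increment of
  \<open>Y\<close> is shown to be Lipschitz in \<open>w\<close>, then its difference from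
  \<open>V w\<close> to be small compared with \<open>w\<close>. In both estimates the shortness of
  the time interval lets \<open>bound_by_contraction\<close> absorb the integral term.\<close>

lemma integral_equation_differentiable_param:
  fixes Y H :: "real \<times> 'p::euclidean_space \<Rightarrow> 'e::euclidean_space" and G :: "(real \<times> 'p) \<times> 'e \<Rightarrow> 'e"
    and V :: "'p \<Rightarrow> real \<Rightarrow> 'e"
  assumes D: "open D" "{-b..b} \<times> cball p\<^sub>0 r \<subseteq> D" and p: "p \<in> ball p\<^sub>0 r" and "b > 0"
    and Y: "continuous_on D Y" and \<Omega>: "open \<Omega>" "\<And>q. q \<in> D \<Longrightarrow> (q, Y q) \<in> \<Omega>"
    and H: "Ck_on 1 D H" and G: "Ck_on 1 \<Omega> G"
    and eq: "\<And>s p. (s, p) \<in> {-b..b} \<times> cball p\<^sub>0 r \<Longrightarrow>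
      Y (s, p) = H (s, p) + int_from_0 (\<lambda>t. G ((t, p), Y (t, p))) s"
    and L: "\<And>q e. q \<in> D \<Longrightarrow> norm (frechet_derivative G (at (q, Y q)) (0, e)) \<le> L * norm e"
    and bL: "b * L \<le> 1/2" "L \<ge> 0"
    and V: "\<And>w. continuous_on {-b..b} (V w)"
      "\<And>w s. s \<in> {-b..b} \<Longrightarrow> V w s = frechet_derivative H (at (s, p)) (0, w)
        + int_from_0 (\<lambda>t. frechet_derivative G (at ((t, p), Y (t, p))) ((0, w), V w t)) s"
    and e: "e > 0"
  shows "\<exists>d>0. \<forall>w. norm w < d \<longrightarrow> (\<forall>s\<in>{-b..b}. norm (Y (s, p + w) - Y (s, p) - V w s) \<le> e * norm w)"
proof -
  let ?DG = "\<lambda>t. frechet_derivative G (at ((t, p), Y (t, p)))"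
  let ?DH = "\<lambda>t. frechet_derivative H (at (t, p))"
  let ?I = "{-b..b}"
  have pD: "(t, p) \<in> D" if "t \<in> ?I" for t using D(2) p that by auto
  have cY: "continuous_on ?I (\<lambda>t. Y (t, p'))" if "p' \<in> cball p\<^sub>0 r" for p'
    using D(2) that by (intro continuous_on_compose2[OF Y] continuous_intros) auto
  have linG: "linear (?DG t)" if "t \<in> ?I" for t
    using Ck_on_1_linear_derivative[OF G \<Omega>(2)[OF pD[OF that]]] .
  have linH: "linear (?DH t)" if "t \<in> ?I" for t
    using Ck_on_1_linear_derivative[OF H pD[OF that]] .
  have cgraph: "continuous_on ?I (\<lambda>t. ((t, p'), Y (t, p')))" if "p' \<in> cball p\<^sub>0 r" for p'
    using cY[OF that] by (intro continuous_intros)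
  have graph: "(\<lambda>t. ((t, p'), Y (t, p'))) ` ?I \<subseteq> \<Omega>" if "p' \<in> cball p\<^sub>0 r" for p'
    using D(2) \<Omega>(2) that by blast
  have p': "p \<in> cball p\<^sub>0 r" using p by simp
  have cDG: "continuous_on ?I (\<lambda>t. ?DG t x)" for x
  proof -
    have "continuous_on \<Omega> (\<lambda>z. frechet_derivative G (at z) x)"
      using G by (rule Ck_on_1_continuous_derivative)
    from continuous_on_compose2[OF this cgraph[OF p'] graph[OF p']] show ?thesis .
  qed
  have cDH: "continuous_on ?I (\<lambda>t. ?DH t x)" for x
  proof -
    have "continuous_on D (\<lambda>z. frechet_derivative H (at z) x)"
      using H by (rule Ck_on_1_continuous_derivative)
    moreover have "continuous_on ?I (\<lambda>t. (t, p))" by (intro continuous_intros)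
    moreover have "(\<lambda>t. (t, p)) ` ?I \<subseteq> D" using pD by blast
    ultimately show ?thesis by (rule continuous_on_compose2)
  qed
  have cG: "continuous_on ?I (\<lambda>t. G ((t, p'), Y (t, p')))" if "p' \<in> cball p\<^sub>0 r" for p'
    by (rule continuous_on_compose2[OF Ck_on_continuous[OF G] cgraph[OF that] graph[OF that]])
  obtain A where A: "A \<ge> 0" "\<And>t x. t \<in> ?I \<Longrightarrow> norm (?DG t x) \<le> A * norm x"
    using bounded_linear_family_on_compact[of ?I ?DG] linG cDG by blast
  obtain B where B: "B \<ge> 0" "\<And>t x. t \<in> ?I \<Longrightarrow> norm (?DH t x) \<le> B * norm x"
    using bounded_linear_family_on_compact[of ?I ?DH] linH cDH by blast
  \<comment> \<open>The factor 4 is \<open>1 / (1 - 3/4)\<close>: of the contraction constant 3/4,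
    at most 1/2 comes from \<open>b * L\<close> and at most 1/4 from the linearisation error
    \<open>b * \<epsilon>\<close>.\<close>
  define C where "C = 4 * (B + 1 + b * (A + 1))"
  have "C \<ge> 0" using A B \<open>b > 0\<close> by (simp add: C_def)
  \<comment> \<open>The last bound is what the final estimate needs; its factor 2 is
    \<open>1 / (1 - 1/2)\<close>, because there \<open>b * L\<close> alone is the contraction
    constant.\<close>
  define \<epsilon> where "\<epsilon> = min (min 1 (1 / (4 * b))) (e / (2 * (1 + b * (1 + C))))"
  have "1 + b * (1 + C) > 0" using \<open>C \<ge> 0\<close> \<open>b > 0\<close> by (simp add: add_pos_nonneg)
  then have \<epsilon>: "\<epsilon> > 0" "\<epsilon> \<le> 1" "b * \<epsilon> \<le> 1/4" "2 * (\<epsilon> * (1 + b * (1 + C))) \<le> e"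
  proof -
    assume pos: "1 + b * (1 + C) > 0"
    show "\<epsilon> > 0" "\<epsilon> \<le> 1" using e \<open>b > 0\<close> pos by (auto simp: \<epsilon>_def)
    have "b * \<epsilon> \<le> b * (1 / (4 * b))" using \<open>b > 0\<close> by (intro mult_left_mono) (auto simp: \<epsilon>_def)
    then show "b * \<epsilon> \<le> 1/4" using \<open>b > 0\<close> by simp
    have "\<epsilon> * (1 + b * (1 + C)) \<le> (e / (2 * (1 + b * (1 + C)))) * (1 + b * (1 + C))"
      using pos by (intro mult_right_mono) (auto simp: \<epsilon>_def)
    moreover have half: "(e / (2 * X)) * X = e / 2" if "X > 0" for X using that by simp
    ultimately show "2 * (\<epsilon> * (1 + b * (1 + C))) \<le> e" unfolding half[OF pos] by linarith
  qed
  have C: "compact ((\<lambda>t. ((t, p), Y (t, p))) ` ?I)"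
    by (rule compact_continuous_image[OF cgraph[OF p']]) simp
  obtain dG where "dG > 0" and dG': "\<And>z h. z \<in> (\<lambda>t. ((t, p), Y (t, p))) ` ?I \<Longrightarrow> norm h < dG \<Longrightarrow>
      norm (G (z + h) - G z - frechet_derivative G (at z) h) \<le> \<epsilon> * norm h"
    by (rule uniformly_differentiable_on_compact[OF \<Omega>(1) G C graph[OF p'] \<epsilon>(1)]) (rule that)
  have dG: "norm (G (((t, p), Y (t, p)) + h) - G ((t, p), Y (t, p)) - ?DG t h) \<le> \<epsilon> * norm h"
    if "t \<in> ?I" "norm h < dG" for t h
    by (rule dG'[OF imageI[OF that(1)] that(2)])
  have C: "compact ((\<lambda>t. (t, p)) ` ?I)" by (intro compact_continuous_image continuous_intros) simp
  have sub: "(\<lambda>t. (t, p)) ` ?I \<subseteq> D" using pD by blast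
  obtain dH where "dH > 0" and dH': "\<And>z h. z \<in> (\<lambda>t. (t, p)) ` ?I \<Longrightarrow> norm h < dH \<Longrightarrow>
      norm (H (z + h) - H z - frechet_derivative H (at z) h) \<le> \<epsilon> * norm h"
    by (rule uniformly_differentiable_on_compact[OF D(1) H C sub \<epsilon>(1)]) (rule that)
  have dH: "norm (H ((t, p) + h) - H (t, p) - ?DH t h) \<le> \<epsilon> * norm h"
    if "t \<in> ?I" "norm h < dH" for t h
    by (rule dH'[OF imageI[OF that(1)] that(2)])
  have "uniformly_continuous_on (?I \<times> cball p\<^sub>0 r) Y"
    using continuous_on_subset[OF Y D(2)] by (intro compact_uniformly_continuous) (auto simp: compact_Times)
  then obtain dY where dY: "dY > 0" "\<And>x y. x \<in> ?I \<times> cball p\<^sub>0 r \<Longrightarrow> y \<in> ?I \<times> cball p\<^sub>0 r \<Longrightarrow>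
      dist y x < dY \<Longrightarrow> dist (Y y) (Y x) < dG / 2"
    using \<open>dG > 0\<close> unfolding uniformly_continuous_on_def by (metis half_gt_zero)
  obtain dp where dp: "dp > 0" "ball p dp \<subseteq> cball p\<^sub>0 r"
    using p by (meson ball_subset_cball open_ball open_contains_ball order_trans)
  \<comment> \<open>\<open>dp\<close> keeps \<open>p + w\<close> in the ball, \<open>dY\<close> and
    \<open>dG / 2\<close> bring the joint increment of parameter and solution below
    \<open>dG\<close>, and \<open>dH\<close> serves the expansion of \<open>H\<close>.\<close>
  define d where "d = min (min dp dY) (min dH (dG / 2))"
  have "d > 0" using dp dY \<open>dH > 0\<close> \<open>dG > 0\<close> by (simp add: d_def)
  moreover have "norm (Y (s, p + w) - Y (s, p) - V w s) \<le> e * norm w"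
    if w: "norm w < d" and s: "s \<in> ?I" for w s
  proof -
    have pw: "p + w \<in> cball p\<^sub>0 r"
      using w dp by (auto simp: d_def dist_norm subset_iff)
    define \<delta> where "\<delta> t = Y (t, p + w) - Y (t, p)" for t
    have \<delta>: "norm (\<delta> t) < dG / 2" if "t \<in> ?I" for t
      using dY(2)[of "(t, p)" "(t, p + w)"] that pw p' w by (simp add: \<delta>_def dist_norm d_def norm_Pair)
    have c\<delta>: "continuous_on ?I \<delta>" unfolding \<delta>_def by (intro continuous_intros cY pw p')
    define h where "h t = ((0::real, w), \<delta> t)" for t
    have h: "norm (h t) \<le> norm w + norm (\<delta> t)" "norm (h t) < dG" if "t \<in> ?I" for t
    proof -
      show "norm (h t) \<le> norm w + norm (\<delta> t)"
        using norm_Pair_le[of "(0::real, w)" "\<delta> t"] by (simp add: h_def norm_Pair)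
      also have "\<dots> < dG" using \<delta>[OF that] w by (simp add: d_def)
      finally show "norm (h t) < dG" .
    qed
    define rem where "rem t = G ((t, p + w), Y (t, p + w)) - G ((t, p), Y (t, p)) - ?DG t (h t)" for t
    have rem: "norm (rem t) \<le> \<epsilon> * (norm w + norm (\<delta> t))" if "t \<in> ?I" for t
    proof -
      have "norm (rem t) \<le> \<epsilon> * norm (h t)"
        using dG[OF that h(2)[OF that]] by (simp add: rem_def h_def \<delta>_def)
      also have "\<dots> \<le> \<epsilon> * (norm w + norm (\<delta> t))" using h(1)[OF that] \<epsilon> by (intro mult_left_mono) auto
      finally show ?thesis .
    qed
    define remH where "remH t = H (t, p + w) - H (t, p) - ?DH t (0, w)" for t
    have remH: "norm (remH t) \<le> \<epsilon> * norm w" if "t \<in> ?I" for t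
      using dH[OF that, of "(0, w)"] w by (simp add: remH_def d_def norm_Pair)
    \<comment> \<open>In the direction of the unknown the derivative is bounded by \<open>L\<close>,
      which enters the contraction constant; the possibly large bound \<open>A\<close> for the
      parameter direction affects \<open>C\<close> alone.\<close>
    have split: "?DG t (h t) = ?DG t ((0, w), 0) + ?DG t (0, \<delta> t)" if "t \<in> ?I" for t
      using linear_add[OF linG[OF that], of "((0, w), 0)" "(0, \<delta> t)"] by (simp add: h_def zero_prod_def)
    have eq\<delta>: "\<delta> t = (remH t + ?DH t (0, w)) + int_from_0 (\<lambda>t. G ((t, p + w), Y (t, p + w)) - G ((t, p), Y (t, p))) t"
      if "t \<in> ?I" for t
      using eq[of t p] eq[of t "p + w"] that pw p' int_from_0_diff[OF cG[OF pw] cG[OF p'] that]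
      by (simp add: \<delta>_def remH_def)
    have bound\<delta>: "norm (\<delta> t) \<le> C * norm w" if "t \<in> ?I" for t
    proof -
      have "norm (\<delta> t) \<le> ((B + 1 + b * (A + 1)) * norm w) / (1 - 3/4)"
      proof (rule bound_by_contraction[OF c\<delta> _ _ that])
        fix t m assume t: "t \<in> ?I" and m: "\<And>t. t \<in> ?I \<Longrightarrow> norm (\<delta> t) \<le> m"
        have "m \<ge> 0" using m[OF t] norm_ge_zero order_trans by blast
        have "norm (G ((t, p + w), Y (t, p + w)) - G ((t, p), Y (t, p))) \<le> (A + 1) * norm w + (L + \<epsilon>) * m"
          if "t \<in> ?I" for t
        proof -
          have "norm (?DG t ((0, w), 0)) \<le> A * norm w" using A(2)[OF that, of "((0, w), 0)"] by (simp add: norm_Pair)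
          moreover have "norm (?DG t (0, \<delta> t)) \<le> L * m"
            using L[OF pD[OF that], of "\<delta> t"] mult_left_mono[OF m[OF that] bL(2)] by linarith
          moreover have "norm (rem t) \<le> norm w + \<epsilon> * m"
          proof -
            have "\<epsilon> * norm w \<le> norm w" using \<epsilon> mult_right_mono[of \<epsilon> 1 "norm w"] by simp
            moreover have "\<epsilon> * norm (\<delta> t) \<le> \<epsilon> * m" using m[OF that] \<epsilon> by (intro mult_left_mono) auto
            ultimately show ?thesis using rem[OF that] by (simp add: distrib_left)
          qed
          moreover have "G ((t, p + w), Y (t, p + w)) - G ((t, p), Y (t, p)) = rem t + (?DG t ((0, w), 0) + ?DG t (0, \<delta> t))"
            by (simp add: rem_def split[OF that])
          moreover have "norm (rem t + (?DG t ((0, w), 0) + ?DG t (0, \<delta> t))) \<le> norm (rem t) + (norm (?DG t ((0, w), 0)) + norm (?DG t (0, \<delta> t)))"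
            using norm_triangle_le[OF add_left_mono[OF norm_triangle_ineq]] by blast
          ultimately show ?thesis by (simp add: algebra_simps)
        qed
        from int_from_0_bound[OF continuous_on_diff[OF cG[OF pw] cG[OF p']] this t]
        have "norm (int_from_0 (\<lambda>t. G ((t, p + w), Y (t, p + w)) - G ((t, p), Y (t, p))) t)
          \<le> b * (A + 1) * norm w + (b * L + b * \<epsilon>) * m"
          by (simp add: algebra_simps)
        moreover have "(b * L + b * \<epsilon>) * m \<le> 3/4 * m" using bL \<epsilon> \<open>m \<ge> 0\<close> by (intro mult_right_mono) auto
        moreover have "norm (remH t + ?DH t (0, w)) \<le> (B + 1) * norm w"
        proof -
          have "\<epsilon> * norm w \<le> norm w" using \<epsilon> mult_right_mono[of \<epsilon> 1 "norm w"] by simp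
          moreover have "norm (?DH t (0, w)) \<le> B * norm w" using B(2)[OF t, of "(0, w)"] by (simp add: norm_Pair)
          ultimately show ?thesis
            using remH[OF t] norm_triangle_ineq[of "remH t" "?DH t (0, w)"] by (simp add: distrib_right)
        qed
        ultimately have "norm ((remH t + ?DH t (0, w)) + int_from_0 (\<lambda>t. G ((t, p + w), Y (t, p + w)) - G ((t, p), Y (t, p))) t)
          \<le> (B + 1) * norm w + (b * (A + 1) * norm w + 3/4 * m)"
          using norm_triangle_ineq[of "remH t + ?DH t (0, w)"
              "int_from_0 (\<lambda>t. G ((t, p + w), Y (t, p + w)) - G ((t, p), Y (t, p))) t"] by linarith
        then show "norm (\<delta> t) \<le> (B + 1 + b * (A + 1)) * norm w + 3/4 * m"
          unfolding eq\<delta>[OF t] by (simp add: algebra_simps)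
      qed simp
      then show ?thesis by (simp add: C_def algebra_simps)
    qed
    define R where "R t = \<delta> t - V w t" for t
    have cR: "continuous_on ?I R" unfolding R_def by (intro continuous_intros c\<delta> V)
    have cA: "continuous_on ?I (\<lambda>t. ?DG t ((0, w), V w t))"
    proof -
      have "continuous_on ?I (\<lambda>t. \<Sum>i\<in>Basis. (((0, w), V w t) \<bullet> i) *\<^sub>R ?DG t i)"
        by (intro continuous_intros cDG V)
      then show ?thesis
        by (rule continuous_on_eq) (rule linear_euclidean_representation[OF linG, symmetric])
    qed
    have "norm (R s) \<le> (\<epsilon> * (1 + b * (1 + C)) * norm w) / (1 - 1/2)"
    proof (rule bound_by_contraction[OF cR _ _ s])
      fix t m assume t: "t \<in> ?I" and m: "\<And>t. t \<in> ?I \<Longrightarrow> norm (R t) \<le> m"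
      have "m \<ge> 0" using m[OF t] norm_ge_zero order_trans by blast
      have "norm (G ((t, p + w), Y (t, p + w)) - G ((t, p), Y (t, p)) - ?DG t ((0, w), V w t))
          \<le> \<epsilon> * (1 + C) * norm w + L * m" if "t \<in> ?I" for t
      proof -
        have "?DG t ((0, w), V w t) = ?DG t (h t) - ?DG t (0, R t)"
          using linear_diff[OF linG[OF that], of "h t" "(0, R t)"] by (simp add: h_def R_def)
        then have "G ((t, p + w), Y (t, p + w)) - G ((t, p), Y (t, p)) - ?DG t ((0, w), V w t) = rem t + ?DG t (0, R t)"
          by (simp add: rem_def)
        moreover have "norm (?DG t (0, R t)) \<le> L * m"
          using L[OF pD[OF that], of "R t"] mult_left_mono[OF m[OF that] bL(2)] by linarith
        moreover have "norm (rem t) \<le> \<epsilon> * (norm w + C * norm w)"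
          using rem[OF that] mult_left_mono[OF add_left_mono[OF bound\<delta>[OF that], of "norm w"], of \<epsilon>] \<epsilon>(1) by linarith
        ultimately show ?thesis
          using norm_triangle_ineq[of "rem t" "?DG t (0, R t)"] by (simp add: algebra_simps)
      qed
      from int_from_0_bound[OF continuous_on_diff[OF continuous_on_diff[OF cG[OF pw] cG[OF p']] cA] this t]
      have "norm (int_from_0 (\<lambda>t. G ((t, p + w), Y (t, p + w)) - G ((t, p), Y (t, p)) - ?DG t ((0, w), V w t)) t)
        \<le> b * (\<epsilon> * (1 + C)) * norm w + (b * L) * m" by (simp add: algebra_simps)
      moreover have "(b * L) * m \<le> 1/2 * m" using bL \<open>m \<ge> 0\<close> by (intro mult_right_mono) auto
      moreover have "R t = remH t + int_from_0 (\<lambda>t. G ((t, p + w), Y (t, p + w)) - G ((t, p), Y (t, p)) - ?DG t ((0, w), V w t)) t"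
        using int_from_0_diff[OF continuous_on_diff[OF cG[OF pw] cG[OF p']] cA t] eq\<delta>[OF t] V(2)[OF t, of w]
        by (simp add: R_def)
      ultimately have "norm (R t) \<le> \<epsilon> * norm w + (b * (\<epsilon> * (1 + C)) * norm w + 1/2 * m)"
        using remH[OF t] norm_triangle_ineq[of "remH t"
            "int_from_0 (\<lambda>t. G ((t, p + w), Y (t, p + w)) - G ((t, p), Y (t, p)) - ?DG t ((0, w), V w t)) t"]
        by (smt (verit))
      then show "norm (R t) \<le> \<epsilon> * (1 + b * (1 + C)) * norm w + 1/2 * m" by (simp add: algebra_simps)
    qed simp
    also have "\<dots> = (2 * (\<epsilon> * (1 + b * (1 + C)))) * norm w" by simp
    also have "\<dots> \<le> e * norm w" using \<epsilon>(4) by (intro mult_right_mono) auto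
    finally show ?thesis by (simp add: R_def \<delta>_def)
  qed
  ultimately show ?thesis by blast
qed

text \<open>Solving the linearised equation yields the candidate \<open>V\<close> for the parameter
  derivative together with its continuity in \<open>(s, p)\<close>. The smaller \<open>b\<close> and
  the ball around \<open>p\<^sub>0\<close> make room for a compact box on which this equation can be
  solved.\<close>

lemma integral_equation_C1_local:
  fixes Y H :: "real \<times> 'p::euclidean_space \<Rightarrow> 'e::euclidean_space" and G :: "(real \<times> 'p) \<times> 'e \<Rightarrow> 'e"
  defines "D \<equiv> \<lambda>a N. {-a<..<a} \<times> N"
  assumes N: "open N" "p\<^sub>0 \<in> N" and b: "0 < b" "b < a" and Y: "continuous_on (D a N) Y"
    and \<Omega>: "open \<Omega>" "\<And>q. q \<in> D a N \<Longrightarrow> (q, Y q) \<in> \<Omega>"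
    and H: "Ck_on 1 (D a N) H" and G: "Ck_on 1 \<Omega> G"
    and eq: "\<And>s p. (s, p) \<in> D a N \<Longrightarrow> Y (s, p) = H (s, p) + int_from_0 (\<lambda>t. G ((t, p), Y (t, p))) s"
    and L: "\<And>q e. q \<in> D a N \<Longrightarrow> norm (frechet_derivative G (at (q, Y q)) (0, e)) \<le> L * norm e"
    and aL: "a * L \<le> 1/2" "L \<ge> 0"
  obtains V r where "r > 0" "ball p\<^sub>0 r \<subseteq> N" "\<And>w. continuous_on ({-b<..<b} \<times> ball p\<^sub>0 r) (V w)"
    "\<And>w s. s \<in> {-b..b} \<Longrightarrow> V w (s, p\<^sub>0) = frechet_derivative H (at (s, p\<^sub>0)) (0, w)
        + int_from_0 (\<lambda>t. frechet_derivative G (at ((t, p\<^sub>0), Y (t, p\<^sub>0))) ((0, w), V w (t, p\<^sub>0))) s"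
    "\<And>q. q \<in> {-b<..<b} \<times> ball p\<^sub>0 r \<Longrightarrow> (Y has_derivative (\<lambda>v.
        fst v *\<^sub>R (frechet_derivative H (at q) (1, 0) + G (q, Y q)) + V (snd v) q)) (at q)"
proof -
  have "open (D a N)" using N by (simp add: D_def open_Times)
  let ?DG = "\<lambda>q. frechet_derivative G (at (q, Y q))"
  let ?DH = "\<lambda>q. frechet_derivative H (at q)"
  obtain r where r: "r > 0" "cball p\<^sub>0 r \<subseteq> N" using N open_contains_cball by blast
  let ?K = "{-b..b} \<times> cball p\<^sub>0 r"
  have KD: "?K \<subseteq> D a N" using b r by (auto simp: D_def)
  have bL: "b * L \<le> 1/2" using aL b mult_right_mono[of b a L] by linarith
  have linG: "linear (?DG q)" if "q \<in> ?K" for q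
    using Ck_on_1_linear_derivative[OF G \<Omega>(2)] that KD by blast
  have linH: "linear (?DH q)" if "q \<in> ?K" for q
    using Ck_on_1_linear_derivative[OF H] that KD by blast
  have cgraph: "continuous_on ?K (\<lambda>q. (q, Y q))" "(\<lambda>q. (q, Y q)) ` ?K \<subseteq> \<Omega>"
    using \<Omega>(2) KD continuous_on_subset[OF Y KD] by (auto intro!: continuous_intros)
  have cDG: "continuous_on ?K (\<lambda>q. ?DG q x)" for x
    by (rule continuous_on_compose2[OF Ck_on_1_continuous_derivative[OF G] cgraph])
  have cDH: "continuous_on ?K (\<lambda>q. ?DH q x)" for x
    using Ck_on_1_continuous_derivative[OF H] KD by (rule continuous_on_subset)
  have "\<exists>Z. continuous_on ?K Z \<and> (\<forall>s p. (s, p) \<in> ?K \<longrightarrow>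
      Z (s, p) = ?DH (s, p) (0, i) + int_from_0 (\<lambda>t. ?DG (t, p) ((0, i), Z (t, p))) s)" for i
  proof -
    define Gi where "Gi z = ?DG (fst z) ((0, i), snd z)" for z
    have Gi: "Gi z = ?DG (fst z) ((0, i), 0) + (\<Sum>b\<in>Basis. (snd z \<bullet> b) *\<^sub>R ?DG (fst z) (0, b))" if "z \<in> ?K \<times> UNIV" for z
    proof -
      have lin: "linear (?DG (fst z))" using that by (intro linG) auto
      have "linear (\<lambda>v. ?DG (fst z) (0, v))"
        using linear_compose[OF _ lin, of "\<lambda>v. (0, v)"] by (simp add: o_def linear_iff)
      note linear_euclidean_representation[OF this, of "snd z"]
      moreover have "Gi z = ?DG (fst z) ((0, i), 0) + ?DG (fst z) (0, snd z)"
        using linear_add[OF lin, of "((0, i), 0)" "(0, snd z)"] by (simp add: Gi_def zero_prod_def)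
      ultimately show ?thesis by simp
    qed
    have "fst ` (?K \<times> (UNIV :: 'e set)) \<subseteq> ?K" by (simp only: fst_image_times) simp
    note cfst = continuous_on_compose2[OF cDG continuous_on_fst[OF continuous_on_id] this]
    have "continuous_on (?K \<times> UNIV) (\<lambda>z. ?DG (fst z) ((0, i), 0) + (\<Sum>b\<in>Basis. (snd z \<bullet> b) *\<^sub>R ?DG (fst z) (0, b)))"
      by (intro continuous_on_add continuous_on_sum continuous_on_scaleR continuous_on_inner cfst
          continuous_on_snd[OF continuous_on_id] continuous_on_const)
    then have cGi: "continuous_on (?K \<times> UNIV) Gi" by (rule continuous_on_eq) (rule Gi[symmetric])
    have lip: "norm (Gi (q, v) - Gi (q, w)) \<le> L * norm (v - w)" if "q \<in> ?K" for q v w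
    proof -
      have "Gi (q, v) - Gi (q, w) = ?DG q (0, v - w)"
        using linear_diff[OF linG[OF that], of "((0, i), v)" "((0, i), w)"] by (simp add: Gi_def zero_prod_def)
      moreover have "q \<in> D a N" using that KD by blast
      ultimately show ?thesis using L by simp
    qed
    show ?thesis
    proof (rule integral_equation_solvable[OF b(1) r(1) cDH[of "(0, i)"] cGi lip bL])
      fix Z assume "continuous_on ?K Z"
        "\<And>s p. (s, p) \<in> ?K \<Longrightarrow> Z (s, p) = ?DH (s, p) (0, i) + int_from_0 (\<lambda>t. Gi ((t, p), Z (t, p))) s"
      then show ?thesis
        by (intro exI[of _ Z] conjI allI impI) (simp_all only: Gi_def fst_conv snd_conv)
    qed
  qed
  then have ex: "\<forall>i. \<exists>Z. continuous_on ?K Z \<and> (\<forall>s p. (s, p) \<in> ?K \<longrightarrow>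
      Z (s, p) = ?DH (s, p) (0, i) + int_from_0 (\<lambda>t. ?DG (t, p) ((0, i), Z (t, p))) s)"
    by (rule allI)
  obtain Z where Z': "\<forall>i. continuous_on ?K (Z i) \<and> (\<forall>s p. (s, p) \<in> ?K \<longrightarrow>
      Z i (s, p) = ?DH (s, p) (0, i) + int_from_0 (\<lambda>t. ?DG (t, p) ((0, i), Z i (t, p))) s)"
    using choice[OF ex] by (rule exE)
  have Z: "continuous_on ?K (Z i)" "(s, p) \<in> ?K \<Longrightarrow>
      Z i (s, p) = ?DH (s, p) (0, i) + int_from_0 (\<lambda>t. ?DG (t, p) ((0, i), Z i (t, p))) s" for i s p
    using Z' by blast+
  \<comment> \<open>Solving for the basis directions and combining the solutions makes
    \<open>V\<close> linear in \<open>w\<close> by construction, without an appeal to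
    uniqueness.\<close>
  define V where "V w q = (\<Sum>i\<in>Basis. (w \<bullet> i) *\<^sub>R Z i q)" for w q
  have cV: "continuous_on ?K (V w)" for w
    unfolding V_def by (intro continuous_intros Z)
  have lin_Pair: "(0, w) = (\<Sum>i\<in>Basis. (w \<bullet> i) *\<^sub>R (0::real, i))" for w :: 'p
    by (subst euclidean_representation[symmetric, of w]) (simp add: sum_prod)
  have Veq: "V w (s, p) = ?DH (s, p) (0, w) + int_from_0 (\<lambda>t. ?DG (t, p) ((0, w), V w (t, p))) s"
    if sp: "(s, p) \<in> ?K" for w s p
  proof -
    have c: "continuous_on {-b..b} (\<lambda>t. ?DG (t, p) ((0, i), Z i (t, p)))" for i
    proof -
      have line: "continuous_on {-b..b} (\<lambda>t. (t, p))" "(\<lambda>t. (t, p)) ` {-b..b} \<subseteq> ?K"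
        using sp by (auto intro!: continuous_intros)
      have "continuous_on {-b..b} (\<lambda>t. \<Sum>j\<in>Basis. (((0, i), Z i (t, p)) \<bullet> j) *\<^sub>R ?DG (t, p) j)"
        by (intro continuous_on_sum continuous_on_scaleR continuous_on_inner continuous_on_Pair continuous_on_const
            continuous_on_compose2[OF cDG line] continuous_on_compose2[OF Z(1) line])
      moreover have "(\<Sum>j\<in>Basis. (((0, i), Z i (t, p)) \<bullet> j) *\<^sub>R ?DG (t, p) j) = ?DG (t, p) ((0, i), Z i (t, p))"
        if "t \<in> {-b..b}" for t
        by (rule linear_euclidean_representation[OF linG, symmetric]) (use line that in blast)
      ultimately show ?thesis by (rule continuous_on_eq)
    qed
    have "V w (s, p) = (\<Sum>i\<in>Basis. (w \<bullet> i) *\<^sub>R ?DH (s, p) (0, i))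
        + (\<Sum>i\<in>Basis. (w \<bullet> i) *\<^sub>R int_from_0 (\<lambda>t. ?DG (t, p) ((0, i), Z i (t, p))) s)"
      unfolding V_def by (subst Z(2)[OF sp]) (simp add: scaleR_add_right sum.distrib)
    also have "(\<Sum>i\<in>Basis. (w \<bullet> i) *\<^sub>R ?DH (s, p) (0, i)) = ?DH (s, p) (0, w)"
      by (subst (2) lin_Pair) (simp only: linear_sum[OF linH[OF sp]] linear_cmul[OF linH[OF sp]])
    also have "(\<Sum>i\<in>Basis. (w \<bullet> i) *\<^sub>R int_from_0 (\<lambda>t. ?DG (t, p) ((0, i), Z i (t, p))) s)
        = int_from_0 (\<lambda>t. \<Sum>i\<in>Basis. (w \<bullet> i) *\<^sub>R ?DG (t, p) ((0, i), Z i (t, p))) s"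
      using sp by (subst int_from_0_sum[where b = b]) (auto intro!: continuous_intros c simp: int_from_0_scaleR)
    also have "\<dots> = int_from_0 (\<lambda>t. ?DG (t, p) ((0, w), V w (t, p))) s"
    proof (rule int_from_0_cong[where b = b])
      fix t assume "t \<in> {-b..b}"
      then have "(t, p) \<in> ?K" using sp by auto
      note lin = linG[OF this]
      have "((0, w), V w (t, p)) = (\<Sum>i\<in>Basis. (w \<bullet> i) *\<^sub>R ((0::real, i), Z i (t, p)))"
        by (simp add: V_def sum_prod lin_Pair[of w])
      then show "(\<Sum>i\<in>Basis. (w \<bullet> i) *\<^sub>R ?DG (t, p) ((0, i), Z i (t, p))) = ?DG (t, p) ((0, w), V w (t, p))"
        by (simp only: linear_sum[OF lin] linear_cmul[OF lin])
    qed (use sp in auto)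
    finally show ?thesis .
  qed
  let ?X = "{-b<..<b}" and ?B = "ball p\<^sub>0 r"
  have linV: "bounded_linear (\<lambda>w. V w q)" for q
    unfolding V_def by (intro bounded_linear_sum bounded_linear_scaleR_const bounded_linear_inner_left)
  have dp: "((\<lambda>p. Y (s, p)) has_derivative (\<lambda>w. V w (s, p))) (at p)" if s: "s \<in> ?X" and p: "p \<in> ?B" for s p
    unfolding has_derivative_at_alt
  proof (intro conjI allI impI linV)
    fix e :: real assume "e > 0"
    have "\<exists>d>0. \<forall>w. norm w < d \<longrightarrow> (\<forall>s\<in>{-b..b}. norm (Y (s, p + w) - Y (s, p) - V w (s, p)) \<le> e * norm w)"
    proof (rule integral_equation_differentiable_param[OF \<open>open (D a N)\<close> KD p b(1) Y \<Omega> H G _ L bL aL(2) _ _ \<open>e > 0\<close>])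
      show "Y (s, p) = H (s, p) + int_from_0 (\<lambda>t. G ((t, p), Y (t, p))) s" if "(s, p) \<in> ?K" for s p
        using eq that KD by blast
      have "continuous_on {-b..b} (\<lambda>t. (t, p))" "(\<lambda>t. (t, p)) ` {-b..b} \<subseteq> ?K"
        using p by (auto intro!: continuous_intros)
      then show "continuous_on {-b..b} (\<lambda>s. V w (s, p))" for w
        by (rule continuous_on_compose2[OF cV])
      show "V w (s, p) = ?DH (s, p) (0, w) + int_from_0 (\<lambda>t. ?DG (t, p) ((0, w), V w (t, p))) s" if "s \<in> {-b..b}" for w s
        using that p by (intro Veq) auto
    qed
    then obtain d where d: "d > 0" "\<And>w s. norm w < d \<Longrightarrow> s \<in> {-b..b} \<Longrightarrow>
        norm (Y (s, p + w) - Y (s, p) - V w (s, p)) \<le> e * norm w" by blast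
    show "\<exists>d>0. \<forall>y. norm (y - p) < d \<longrightarrow> norm (Y (s, y) - Y (s, p) - V (y - p) (s, p)) \<le> e * norm (y - p)"
    proof (intro exI[of _ d] conjI allI impI d(1))
      fix y assume "norm (y - p) < d"
      from d(2)[OF this, of s] s show "norm (Y (s, y) - Y (s, p) - V (y - p) (s, p)) \<le> e * norm (y - p)" by simp
    qed
  qed
  have ds: "((\<lambda>s. Y (s, p)) has_derivative (\<lambda>h. h *\<^sub>R (?DH (s, p) (1, 0) + G ((s, p), Y (s, p))))) (at s)"
    if s: "s \<in> ?X" and p: "p \<in> ?B" for s p
  proof -
    have pN: "p \<in> N" using p r by auto
    have sD: "(s, p) \<in> D a N" using s b pN by (auto simp: D_def)
    have "(H has_derivative ?DH (s, p)) (at ((0, p) + s *\<^sub>R (1, 0)))"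
      using Ck_on_Suc_derivative[of 0 _ H "(s, p)"] H sD by simp
    from has_vector_derivative_along_line[OF this]
    have "((\<lambda>s. H (s, p)) has_vector_derivative ?DH (s, p) (1, 0)) (at s)" by simp
    moreover
    have line: "continuous_on {-a<..<a} (\<lambda>t. (t, p))" "(\<lambda>t. (t, p)) ` {-a<..<a} \<subseteq> D a N"
      using pN by (auto intro!: continuous_intros simp: D_def)
    have "(\<lambda>t. ((t, p), Y (t, p))) ` {-a<..<a} \<subseteq> \<Omega>" using line(2) \<Omega>(2) by blast
    then have "continuous_on {-a<..<a} (\<lambda>t. G ((t, p), Y (t, p)))"
      by (rule continuous_on_compose2[OF Ck_on_continuous[OF G] continuous_on_Pair[OF line(1) continuous_on_compose2[OF Y line]]])
    then have "(int_from_0 (\<lambda>t. G ((t, p), Y (t, p))) has_vector_derivative G ((s, p), Y (s, p))) (at s)"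
      by (rule int_from_0_has_vector_derivative) (use sD in \<open>auto simp: D_def\<close>)
    ultimately have "((\<lambda>s. H (s, p) + int_from_0 (\<lambda>t. G ((t, p), Y (t, p))) s) has_vector_derivative
        ?DH (s, p) (1, 0) + G ((s, p), Y (s, p))) (at s)"
      by (rule has_vector_derivative_add)
    then have "((\<lambda>s. Y (s, p)) has_vector_derivative ?DH (s, p) (1, 0) + G ((s, p), Y (s, p))) (at s)"
      by (rule has_vector_derivative_transform_within_open[where S = "{-a<..<a}"])
        (use sD pN eq in \<open>auto simp: D_def\<close>)
    then show ?thesis by (simp add: has_vector_derivative_def)
  qed
  have dY: "(Y has_derivative (\<lambda>v. fst v *\<^sub>R (?DH (s, p) (1, 0) + G ((s, p), Y (s, p))) + V (snd v) (s, p))) (at (s, p))"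
    if s: "s \<in> ?X" and p: "p \<in> ?B" for s p
  proof -
    \<comment> \<open>Joint differentiability follows from one partial derivative at the point and
      continuity, in the operator norm, of the other.\<close>
    define F where "F s p = Blinfun (\<lambda>w. V w (s, p))" for s p
    have F: "blinfun_apply (F s p) = (\<lambda>w. V w (s, p))" for s p
      unfolding F_def by (rule bounded_linear_Blinfun_apply[OF linV])
    have "continuous_on (?X \<times> ?B) (\<lambda>(s, p). F s p)"
    proof (rule continuous_on_blinfun_componentwise)
      fix i
      have "continuous_on (?X \<times> ?B) (V i)" using cV by (rule continuous_on_subset) auto
      then show "continuous_on (?X \<times> ?B) (\<lambda>q. blinfun_apply (case q of (s, p) \<Rightarrow> F s p) i)"
        by (simp add: split_beta F)
    qed
    then have cF: "continuous (at (s, p) within ?X \<times> ?B) (\<lambda>(s, p). F s p)"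
      using s p by (auto simp: continuous_on_eq_continuous_within)
    have "((\<lambda>(s, p). Y (s, p)) has_derivative (\<lambda>(h, w). h *\<^sub>R (?DH (s, p) (1, 0) + G ((s, p), Y (s, p))) + blinfun_apply (F s p) w))
        (at (s, p) within ?X \<times> ?B)"
    proof (rule has_derivative_partialsI)
      show "((\<lambda>s. Y (s, p)) has_derivative (\<lambda>h. h *\<^sub>R (?DH (s, p) (1, 0) + G ((s, p), Y (s, p))))) (at s within ?X)"
        by (rule has_derivative_at_withinI[OF ds[OF s p]])
      show "((\<lambda>p. Y (s, p)) has_derivative blinfun_apply (F s p)) (at p within ?B)" if "s \<in> ?X" "p \<in> ?B" for s p
        unfolding F by (rule has_derivative_at_withinI[OF dp[OF that]])
    qed (rule cF p convex_ball)+
    moreover have "at (s, p) within ?X \<times> ?B = at (s, p)"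
      by (rule at_within_open) (use s p in \<open>auto intro!: open_Times\<close>)
    ultimately show ?thesis by (simp only: F case_prod_unfold prod.collapse)
  qed
  show thesis
  proof (rule that[of r V])
    show "continuous_on (?X \<times> ?B) (V w)" for w using cV by (rule continuous_on_subset) auto
    show "(Y has_derivative (\<lambda>v. fst v *\<^sub>R (?DH q (1, 0) + G (q, Y q)) + V (snd v) q)) (at q)"
      if "q \<in> ?X \<times> ?B" for q
    proof -
      obtain s p where q: "q = (s, p)" by (rule prod.exhaust)
      show ?thesis unfolding q by (rule dY) (use that q in auto)
    qed
    show "V w (s, p\<^sub>0) = ?DH (s, p\<^sub>0) (0, w) + int_from_0 (\<lambda>t. ?DG (t, p\<^sub>0) ((0, w), V w (t, p\<^sub>0))) s"
      if "s \<in> {-b..b}" for w s by (rule Veq) (use that r in auto)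
  qed (use r in auto)
qed

text \<open>Once \<open>Y\<close> is differentiable, each local \<open>V\<close> is its parameter
  derivative, so the linearised equation becomes a statement about
  \<open>frechet_derivative Y\<close> itself. In this form it is again an integral equation on the
  whole domain, ready for the induction on the order.\<close>

lemma integral_equation_C1:
  fixes Y H :: "real \<times> 'p::euclidean_space \<Rightarrow> 'e::euclidean_space" and G :: "(real \<times> 'p) \<times> 'e \<Rightarrow> 'e"
  defines "D \<equiv> \<lambda>a N. {-a<..<a} \<times> N"
  assumes N: "open N" and Y: "continuous_on (D a N) Y"
    and \<Omega>: "open \<Omega>" "\<And>q. q \<in> D a N \<Longrightarrow> (q, Y q) \<in> \<Omega>"
    and H: "Ck_on 1 (D a N) H" and G: "Ck_on 1 \<Omega> G"
    and eq: "\<And>s p. (s, p) \<in> D a N \<Longrightarrow> Y (s, p) = H (s, p) + int_from_0 (\<lambda>t. G ((t, p), Y (t, p))) s"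
    and L: "\<And>q e. q \<in> D a N \<Longrightarrow> norm (frechet_derivative G (at (q, Y q)) (0, e)) \<le> L * norm e"
    and aL: "a * L \<le> 1/2" "L \<ge> 0"
  shows "Ck_on 1 (D a N) Y"
    and "\<And>q \<sigma> w. q \<in> D a N \<Longrightarrow> frechet_derivative Y (at q) (\<sigma>, w) =
      \<sigma> *\<^sub>R (frechet_derivative H (at q) (1, 0) + G (q, Y q)) + frechet_derivative Y (at q) (0, w)"
    and "\<And>s p w. (s, p) \<in> D a N \<Longrightarrow> frechet_derivative Y (at (s, p)) (0, w) =
      frechet_derivative H (at (s, p)) (0, w) +
      int_from_0 (\<lambda>t. frechet_derivative G (at ((t, p), Y (t, p))) ((0, w), frechet_derivative Y (at (t, p)) (0, w))) s"
proof -
  have oD: "open (D a N)" using N by (simp add: D_def open_Times)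
  let ?dt = "\<lambda>q. frechet_derivative H (at q) (1, 0) + G (q, Y q)"
  \<comment> \<open>The equation at \<open>(s, p)\<close> involves all times between 0 and
    \<open>s\<close>, so the neighbourhood \<open>T\<close> has to contain them too.\<close>
  have local: "\<exists>T V. open T \<and> (s, p) \<in> T \<and> T \<subseteq> D a N \<and> (\<forall>t\<in>{-\<bar>s\<bar>..\<bar>s\<bar>}. (t, p) \<in> T) \<and>
      (\<forall>w. continuous_on T (V w)) \<and>
      (\<forall>w. V w (s, p) = frechet_derivative H (at (s, p)) (0, w)
        + int_from_0 (\<lambda>t. frechet_derivative G (at ((t, p), Y (t, p))) ((0, w), V w (t, p))) s) \<and>
      (\<forall>q\<in>T. (Y has_derivative (\<lambda>v. fst v *\<^sub>R ?dt q + V (snd v) q)) (at q))"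
    if "(s, p) \<in> D a N" for s p
  proof -
    have p: "p \<in> N" and "\<bar>s\<bar> < a" using that by (auto simp: D_def)
    then obtain b where b: "\<bar>s\<bar> < b" "b < a" using dense by blast
    then have "0 < b" by linarith
    show ?thesis
    proof (rule integral_equation_C1_local[OF N p \<open>0 < b\<close> b(2) Y[unfolded D_def] \<Omega>[unfolded D_def]
          H[unfolded D_def] G eq[unfolded D_def] L[unfolded D_def] aL])
      fix V :: "'p \<Rightarrow> real \<times> 'p \<Rightarrow> 'e" and r
      let ?T = "{-b<..<b} \<times> ball p r"
      assume r: "r > 0" "ball p r \<subseteq> N" and V: "\<And>w. continuous_on ?T (V w)"
        "\<And>w s. s \<in> {-b..b} \<Longrightarrow> V w (s, p) = frechet_derivative H (at (s, p)) (0, w)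
        + int_from_0 (\<lambda>t. frechet_derivative G (at ((t, p), Y (t, p))) ((0, w), V w (t, p))) s"
        "\<And>q. q \<in> ?T \<Longrightarrow> (Y has_derivative (\<lambda>v. fst v *\<^sub>R ?dt q + V (snd v) q)) (at q)"
      have "(t, p) \<in> ?T" if "t \<in> {-\<bar>s\<bar>..\<bar>s\<bar>}" for t using that b r by auto
      moreover have "?T \<subseteq> D a N" using b r by (auto simp: D_def)
      moreover have "s \<in> {-b..b}" "(s, p) \<in> ?T" using b r by auto
      ultimately show ?thesis
        using V by (intro exI[of _ ?T] exI[of _ V] conjI allI ballI open_Times open_ball open_greaterThanLessThan) blast+
    qed
  qed
  have der: "frechet_derivative Y (at q) = (\<lambda>v. fst v *\<^sub>R ?dt q + V (snd v) q)"
    if "(Y has_derivative (\<lambda>v. fst v *\<^sub>R ?dt q + V (snd v) q)) (at q)" for V q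
    using frechet_derivative_at[OF that] by (rule sym)
  have cdt: "continuous_on (D a N) ?dt"
  proof -
    have "(\<lambda>q. (q, Y q)) ` D a N \<subseteq> \<Omega>" using \<Omega>(2) by blast
    from continuous_on_compose2[OF Ck_on_continuous[OF G] continuous_on_Pair[OF continuous_on_id Y] this]
    show ?thesis by (intro continuous_on_add Ck_on_1_continuous_derivative[OF H])
  qed
  have "\<exists>T. open T \<and> q \<in> T \<and> Ck_on 1 T Y" if q: "q \<in> D a N" for q
  proof -
    obtain s p where sp: "q = (s, p)" by (rule prod.exhaust)
    obtain T V where T: "open T" "q \<in> T" "T \<subseteq> D a N" "\<And>w. continuous_on T (V w)"
      "\<And>q. q \<in> T \<Longrightarrow> (Y has_derivative (\<lambda>v. fst v *\<^sub>R ?dt q + V (snd v) q)) (at q)"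
      using local[OF q[unfolded sp]] unfolding sp by blast
    have "Ck_on (Suc 0) T Y"
    proof (rule Ck_on_SucI[OF T(1) T(5)])
      show "Ck_on 0 T (\<lambda>q. fst v *\<^sub>R ?dt q + V (snd v) q)" for v
        unfolding Ck_on.simps(1)
        by (intro continuous_on_add continuous_on_scaleR continuous_on_const T(4) continuous_on_subset[OF cdt T(3)])
    qed
    then show ?thesis using T(1,2) by auto
  qed
  then show "Ck_on 1 (D a N) Y" by (rule Ck_on_if_locally[OF oD])
  show "frechet_derivative Y (at q) (\<sigma>, w) = \<sigma> *\<^sub>R ?dt q + frechet_derivative Y (at q) (0, w)" if q: "q \<in> D a N" for q \<sigma> w
  proof -
    obtain s p where sp: "q = (s, p)" by (rule prod.exhaust)
    obtain V where "(Y has_derivative (\<lambda>v. fst v *\<^sub>R ?dt q + V (snd v) q)) (at q)"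
      using local[OF q[unfolded sp]] unfolding sp by blast
    from der[where V = V and q = q, OF this] show ?thesis by simp
  qed
  show "frechet_derivative Y (at (s, p)) (0, w) =
      frechet_derivative H (at (s, p)) (0, w) +
      int_from_0 (\<lambda>t. frechet_derivative G (at ((t, p), Y (t, p))) ((0, w), frechet_derivative Y (at (t, p)) (0, w))) s"
    if sp: "(s, p) \<in> D a N" for s p w
  proof -
    obtain T V where T: "(s, p) \<in> T" "\<And>t. t \<in> {-\<bar>s\<bar>..\<bar>s\<bar>} \<Longrightarrow> (t, p) \<in> T"
      "V w (s, p) = frechet_derivative H (at (s, p)) (0, w)
        + int_from_0 (\<lambda>t. frechet_derivative G (at ((t, p), Y (t, p))) ((0, w), V w (t, p))) s"
      "\<And>q. q \<in> T \<Longrightarrow> (Y has_derivative (\<lambda>v. fst v *\<^sub>R ?dt q + V (snd v) q)) (at q)"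
      using local[OF sp] by blast
    have V: "frechet_derivative Y (at q) (0, w) = V w q" if "q \<in> T" for q
      using der[where V = V and q = q, OF T(4)[OF that]] by simp
    show ?thesis unfolding V[OF T(1)] T(3)
      by (intro arg_cong[of _ _ "\<lambda>x. _ + x"] int_from_0_cong[where b = "\<bar>s\<bar>"]) (auto simp: V[OF T(2)])
  qed
qed

text \<open>
  The derivative of a solution in a parameter direction solves an equation of the same shape, with data
  that are one order less smooth. No new types arise, so the induction on the order goes through.
\<close>

lemma integral_equation_Ck:
  fixes Y H :: "real \<times> 'p::euclidean_space \<Rightarrow> 'e::euclidean_space" and G :: "(real \<times> 'p) \<times> 'e \<Rightarrow> 'e"
  defines "D \<equiv> \<lambda>a N. {-a<..<a} \<times> N"
  assumes N: "open N" and Y: "continuous_on (D a N) Y"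
    and \<Omega>: "open \<Omega>" "\<And>q. q \<in> D a N \<Longrightarrow> (q, Y q) \<in> \<Omega>"
    and H: "Ck_on k (D a N) H" and G: "Ck_on k \<Omega> G"
    and eq: "\<And>s p. (s, p) \<in> D a N \<Longrightarrow> Y (s, p) = H (s, p) + int_from_0 (\<lambda>t. G ((t, p), Y (t, p))) s"
    and L: "\<And>q e. k > 0 \<Longrightarrow> q \<in> D a N \<Longrightarrow> norm (frechet_derivative G (at (q, Y q)) (0, e)) \<le> L * norm e"
    and aL: "a * L \<le> 1/2" "L \<ge> 0"
  shows "Ck_on k (D a N) Y"
  using Y \<Omega> H G eq L
proof (induction k arbitrary: Y H G \<Omega>)
  case 0
  then show ?case by simp
next
  case (Suc k)
  have oD: "open (D a N)" using N by (simp add: D_def open_Times)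
  have Dfold: "{-a<..<a} \<times> N = D a N" by (simp add: D_def)
  note L = Suc.prems(7)[OF zero_less_Suc]
  then have Lk: "norm (frechet_derivative G (at (q, Y q)) (0, e)) \<le> L * norm e" if "k > 0" "q \<in> D a N" for q e
    using that(2) .
  have "Ck_on 1 (D a N) H" "Ck_on 1 \<Omega> G" using Suc.prems(4,5) Ck_on_le by fastforce+
  note C1' = integral_equation_C1[OF N Suc.prems(1)[unfolded D_def] Suc.prems(2,3)[unfolded D_def]
      this[unfolded D_def] Suc.prems(6)[unfolded D_def] L[unfolded D_def] aL, unfolded Dfold]
  have C1: "Ck_on 1 (D a N) Y"
    "frechet_derivative Y (at q) (\<sigma>, w) =
      \<sigma> *\<^sub>R (frechet_derivative H (at q) (1, 0) + G (q, Y q)) + frechet_derivative Y (at q) (0, w)"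
    "frechet_derivative Y (at (s, p)) (0, w) =
      frechet_derivative H (at (s, p)) (0, w) +
      int_from_0 (\<lambda>t. frechet_derivative G (at ((t, p), Y (t, p))) ((0, w), frechet_derivative Y (at (t, p)) (0, w))) s"
    if "q \<in> D a N" "(s, p) \<in> D a N" for q \<sigma> w s p
  proof -
    show "Ck_on 1 (D a N) Y" by (rule C1'(1))
    show "frechet_derivative Y (at q) (\<sigma>, w) =
      \<sigma> *\<^sub>R (frechet_derivative H (at q) (1, 0) + G (q, Y q)) + frechet_derivative Y (at q) (0, w)"
      by (rule C1'(2)[OF _ _ _ that(1)])
    show "frechet_derivative Y (at (s, p)) (0, w) =
      frechet_derivative H (at (s, p)) (0, w) +
      int_from_0 (\<lambda>t. frechet_derivative G (at ((t, p), Y (t, p))) ((0, w), frechet_derivative Y (at (t, p)) (0, w))) s"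
      by (rule C1'(3)[OF _ _ _ that(2)])
  qed
  let ?DY = "\<lambda>q. frechet_derivative Y (at q)" and ?DH = "\<lambda>q. frechet_derivative H (at q)"
  let ?DG = "\<lambda>q. frechet_derivative G (at (q, Y q))"
  \<comment> \<open>With \<open>Y\<close> of class C^k, the coefficients of its linearised equation
    are C^k as well.\<close>
  have Yk: "Ck_on k (D a N) Y"
    by (rule Suc.IH[OF Suc.prems(1-3) Ck_on_SucE[OF Suc.prems(4)] Ck_on_SucE[OF Suc.prems(5)] Suc.prems(6) Lk])
  have graph: "Ck_on k (D a N) (\<lambda>q. (q, Y q))" by (rule Ck_on_Pair[OF oD Ck_on_ident[OF oD] Yk])
  have sub: "(\<lambda>q. (q, Y q)) ` D a N \<subseteq> \<Omega>" using Suc.prems(3) by blast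
  have DGk: "Ck_on k (D a N) (\<lambda>q. ?DG q x)" for x
  proof -
    have "Ck_on k \<Omega> (\<lambda>z. frechet_derivative G (at z) x)" using Suc.prems(5) Ck_on.simps(2) by metis
    from Ck_on_compose[OF oD Suc.prems(2) sub graph this] show ?thesis .
  qed
  have DHk: "Ck_on k (D a N) (\<lambda>q. ?DH q x)" for x using Suc.prems(4) Ck_on.simps(2) by metis
  have linG: "linear (?DG q)" if "q \<in> D a N" for q
    using Ck_on_Suc_derivative[OF Suc.prems(5) Suc.prems(3)[OF that]] has_derivative_linear by blast
  have Gk: "Ck_on k (D a N) (\<lambda>q. G (q, Y q))"
    by (rule Ck_on_compose[OF oD Suc.prems(2) sub graph Ck_on_SucE[OF Suc.prems(5)]])
  have Vk: "Ck_on k (D a N) (\<lambda>q. ?DY q (0, w))" for w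
  proof -
    \<comment> \<open>The right-hand side of the linearised equation, expanded in a basis so that
      its regularity on all of \<open>D a N \<times> UNIV\<close> follows from derivatives of
      \<open>G\<close> in fixed directions.\<close>
    define G' where "G' z = ?DG (fst z) ((0, w), 0) + (\<Sum>b\<in>Basis. (snd z \<bullet> b) *\<^sub>R ?DG (fst z) (0, b))" for z
    have G': "G' (q, v) = ?DG q ((0, w), v)" if "q \<in> D a N" for q v
    proof -
      have "linear (\<lambda>v. ?DG q (0, v))"
        using linear_compose[OF _ linG[OF that], of "\<lambda>v. (0, v)"] by (simp add: o_def linear_iff)
      from linear_euclidean_representation[OF this, of v]
      have "G' (q, v) = ?DG q ((0, w), 0) + ?DG q (0, v)" unfolding G'_def fst_conv snd_conv by (rule arg_cong[OF sym])
      then show ?thesis using linear_add[OF linG[OF that], of "((0, w), 0)" "(0, v)"] by (simp add: zero_prod_def)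
    qed
    have oDU: "open (D a N \<times> (UNIV :: 'e set))" using oD by (simp add: open_Times)
    have "fst ` (D a N \<times> (UNIV :: 'e set)) \<subseteq> D a N" by auto
    note cfst = Ck_on_compose[OF oDU oD this Ck_on_linear[OF oDU bounded_linear_fst]]
    have G'k: "Ck_on k (D a N \<times> UNIV) G'"
      unfolding G'_def
      by (intro Ck_on_add[OF oDU] Ck_on_sum[OF oDU] Ck_on_scaleR[OF oDU] Ck_on_inner[OF oDU] Ck_on_const[OF oDU] cfst DGk
          Ck_on_linear[OF oDU bounded_linear_snd])
    show ?thesis
    proof (rule Suc.IH[where G = G' and \<Omega> = "D a N \<times> UNIV", OF _ oDU _ DHk[of "(0, w)"] G'k])
      show "continuous_on (D a N) (\<lambda>q. ?DY q (0, w))" by (rule Ck_on_1_continuous_derivative[OF C1'(1)])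
      show "?DY (s, p) (0, w) = ?DH (s, p) (0, w) + int_from_0 (\<lambda>t. G' ((t, p), ?DY (t, p) (0, w))) s"
        if sp: "(s, p) \<in> D a N" for s p
        unfolding C1(3)[OF sp sp, of w]
      proof (intro arg_cong[of _ _ "\<lambda>x. _ + x"] int_from_0_cong[where b = "\<bar>s\<bar>"])
        fix t assume "t \<in> {-\<bar>s\<bar>..\<bar>s\<bar>}"
        then have "(t, p) \<in> D a N" using sp by (auto simp: D_def)
        from G'[OF this] show "?DG (t, p) ((0, w), ?DY (t, p) (0, w)) = G' ((t, p), ?DY (t, p) (0, w))" by simp
      qed auto
      \<comment> \<open>\<open>G'\<close> is affine in the unknown, and its linear part is the
        derivative of \<open>G\<close> in the unknown along \<open>Y\<close>. So the bound
        \<open>L\<close> is inherited unchanged.\<close>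
      show "norm (frechet_derivative G' (at (q, ?DY q (0, w))) (0, e)) \<le> L * norm e" if k: "k > 0" and q: "q \<in> D a N" for q e
      proof -
        have "frechet_derivative G' (at (q, ?DY q (0, w))) (0, e) = ?DG q (0, e)"
        proof (rule derivative_along_line_eq[where f = G' and x = "(q, ?DY q (0, w))" and v = "(0, e)"])
          have "Ck_on (Suc 0) (D a N \<times> UNIV) G'" using G'k k by (intro Ck_on_le[OF G'k]) simp
          then show "(G' has_derivative frechet_derivative G' (at (q, ?DY q (0, w)))) (at (q, ?DY q (0, w)))"
            by (rule Ck_on_Suc_derivative) (use q in auto)
          have "G' ((q, ?DY q (0, w)) + s *\<^sub>R (0, e)) = ?DG q ((0, w), ?DY q (0, w)) + s *\<^sub>R ?DG q (0, e)" for s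
            using G'[OF q] linear_add[OF linG[OF q], of "((0, w), ?DY q (0, w))" "s *\<^sub>R (0, e)"]
              linear_cmul[OF linG[OF q], of s "(0, e)"] by simp
          then show "((\<lambda>s. G' ((q, ?DY q (0, w)) + s *\<^sub>R (0, e))) has_vector_derivative ?DG q (0, e)) (at 0)"
            by (auto intro!: derivative_eq_intros)
        qed
        then show ?thesis using L[OF q] by simp
      qed
    qed simp
  qed
  have "Ck_on k (D a N) (\<lambda>q. ?DY q v)" for v
  proof -
    have "Ck_on k (D a N) (\<lambda>q. fst v *\<^sub>R (?DH q (1, 0) + G (q, Y q)) + ?DY q (0, snd v))"
      by (intro Ck_on_add[OF oD] Ck_on_scaleR[OF oD] Ck_on_const[OF oD] DHk Gk Vk)
    then show ?thesis
      by (rule iffD1[OF Ck_on_cong[OF oD], rotated]) (use C1(2)[of _ _ _ "fst v" "snd v"] in force)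
  qed
  moreover have "Y differentiable at q" if "q \<in> D a N" for q
    using C1'(1) that by simp
  ultimately show ?case by simp
qed

section \<open>The local flow of a smooth vector field\<close>

lemma smooth_local_flow:
  fixes W :: "'e::euclidean_space \<Rightarrow> 'e"
  assumes "smooth W"
  obtains a N \<Phi> where "a > 0" "open N" "z\<^sub>0 \<in> N" "smooth_on ({-a<..<a} \<times> N) \<Phi>"
    "\<And>s z. (s, z) \<in> {-a<..<a} \<times> N \<Longrightarrow> \<Phi> (s, z) = z + int_from_0 (\<lambda>t. W (\<Phi> (t, z))) s"
    "\<And>q. q \<in> {-a<..<a} \<times> N \<Longrightarrow> frechet_derivative \<Phi> (at q) (1, 0) = W (\<Phi> q)"
proof -
  let ?DW = "\<lambda>x. frechet_derivative W (at x)"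
  let ?C = "cball z\<^sub>0 1"
  have W1: "Ck_on 1 UNIV W" using assms by (rule smooth_onD)
  obtain L where L: "L \<ge> 0" "\<And>x v. x \<in> ?C \<Longrightarrow> norm (?DW x v) \<le> L * norm v"
    by (rule bounded_linear_family_on_compact[OF compact_cball Ck_on_1_linear_derivative[OF W1 UNIV_I]
          continuous_on_subset[OF Ck_on_1_continuous_derivative[OF W1] subset_UNIV]]) (rule that)
  have cW: "continuous_on UNIV W" by (rule Ck_on_continuous[OF W1])
  have "bounded (W ` ?C)"
    by (rule compact_imp_bounded[OF compact_continuous_image[OF continuous_on_subset[OF cW subset_UNIV] compact_cball]])
  then obtain M where M: "\<And>x. x \<in> ?C \<Longrightarrow> norm (W x) \<le> M" unfolding bounded_iff by blast
  have "norm (W z\<^sub>0) \<le> M" by (rule M) simp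
  then have "M \<ge> 0" using norm_ge_zero order_trans by blast
  have lip: "norm (W x - W y) \<le> L * norm (x - y)" if "x \<in> ?C" "y \<in> ?C" for x y
  proof (rule differentiable_bound[where S = ?C and f' = ?DW])
    show "(W has_derivative ?DW x) (at x within ?C)" for x
      by (rule has_derivative_at_withinI[OF smooth_on_has_derivative[OF assms]]) simp
    show "onorm (?DW x) \<le> L" if "x \<in> ?C" for x
      using L that by (intro onorm_bound) auto
  qed (use that in auto)
  \<comment> \<open>\<open>a * L \<le> 1/2\<close> is for the contraction, while
    \<open>a * M \<le> 1/2\<close> keeps solutions that start within 1/2 of \<open>z\<^sub>0\<close>
    inside the unit ball \<open>?C\<close>. The summand 1 keeps the denominator positive.\<close>
  define a where "a = 1 / (2 * (M + L + 1))"
  have a: "a > 0" "a * L \<le> 1/2" "a * M \<le> 1/2"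
    using L(1) \<open>M \<ge> 0\<close> by (auto simp: a_def field_simps)
  \<comment> \<open>Precomposing with the nearest-point map onto \<open>?C\<close> makes the field
    globally Lipschitz. The solution never leaves \<open>?C\<close>, so it also solves the equation
    with the smooth field \<open>W\<close>, from which its regularity is derived.\<close>
  define G where "G z = W (closest_point ?C (snd z))" for z :: "(real \<times> 'e) \<times> 'e"
  have cp: "closest_point ?C v \<in> ?C" for v by (rule closest_point_in_set) auto
  have "continuous_on ({-a..a} \<times> cball z\<^sub>0 (1/2)) (snd :: real \<times> 'e \<Rightarrow> 'e)"
    by (rule continuous_on_snd[OF continuous_on_id])
  moreover have "continuous_on (({-a..a} \<times> cball z\<^sub>0 (1/2)) \<times> UNIV) G"
  proof -
    have "continuous_on UNIV (closest_point ?C)" by (rule continuous_on_closest_point) auto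
    from continuous_on_compose2[OF this continuous_on_snd[OF continuous_on_id]]
    have "continuous_on (({-a..a} \<times> cball z\<^sub>0 (1/2)) \<times> UNIV) (\<lambda>z::(real \<times> 'e) \<times> 'e. closest_point ?C (snd z))"
      by simp
    from continuous_on_compose2[OF cW this] show ?thesis unfolding G_def by simp
  qed
  moreover have "norm (G (q, v) - G (q, w)) \<le> L * norm (v - w)" for q v w
  proof -
    have "norm (closest_point ?C v - closest_point ?C w) \<le> norm (v - w)"
      using closest_point_lipschitz[of ?C v w] by (simp add: dist_norm)
    then have "L * norm (closest_point ?C v - closest_point ?C w) \<le> L * norm (v - w)"
      using L(1) by (rule mult_left_mono)
    then show ?thesis using lip[OF cp cp, of v w] by (simp add: G_def)
  qed
  ultimately obtain Y where Y: "continuous_on ({-a..a} \<times> cball z\<^sub>0 (1/2)) Y"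
    "\<And>s p. (s, p) \<in> {-a..a} \<times> cball z\<^sub>0 (1/2) \<Longrightarrow> Y (s, p) = snd (s, p) + int_from_0 (\<lambda>t. G ((t, p), Y (t, p))) s"
    by (rule integral_equation_solvable[OF a(1) half_gt_zero[OF zero_less_one] _ _ _ a(2)]) (rule that)
  have Yin: "Y (s, p) \<in> ?C" if sp: "(s, p) \<in> {-a..a} \<times> cball z\<^sub>0 (1/2)" for s p
  proof -
    have s: "s \<in> {-a..a}" using sp by simp
    have cYp: "continuous_on {-a..a} (\<lambda>t. Y (t, p))"
      using sp by (intro continuous_on_compose2[OF Y(1)] continuous_on_Pair continuous_on_id continuous_on_const) auto
    have "continuous_on UNIV (closest_point ?C)" by (rule continuous_on_closest_point) auto
    from continuous_on_compose2[OF this cYp subset_UNIV]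
    have "continuous_on {-a..a} (\<lambda>t. closest_point ?C (Y (t, p)))" .
    then have "continuous_on {-a..a} (\<lambda>t. G ((t, p), Y (t, p)))"
      unfolding G_def snd_conv by (rule continuous_on_compose2[OF cW]) simp
    moreover have "norm (G ((t, p), Y (t, p))) \<le> M" for t
      unfolding G_def snd_conv by (rule M[OF cp])
    ultimately have "norm (int_from_0 (\<lambda>t. G ((t, p), Y (t, p))) s) \<le> a * M"
      using s by (rule int_from_0_bound)
    then have "dist p (Y (s, p)) \<le> 1/2"
      using Y(2)[OF sp] a(3) by (simp add: dist_norm)
    moreover have "dist z\<^sub>0 p \<le> 1/2" using sp by simp
    ultimately show ?thesis using dist_triangle[of z\<^sub>0 "Y (s, p)" p] by simp
  qed
  let ?N = "ball z\<^sub>0 (1/2)"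
  let ?D = "{-a<..<a} \<times> ?N"
  have sub: "?D \<subseteq> {-a..a} \<times> cball z\<^sub>0 (1/2)" by auto
  have oD: "open ?D" by (intro open_Times) auto
  have eq: "Y (s, p) = snd (s, p) + int_from_0 (\<lambda>t. W (snd ((t, p), Y (t, p)))) s" if "(s, p) \<in> ?D" for s p
  proof -
    have "int_from_0 (\<lambda>t. G ((t, p), Y (t, p))) s = int_from_0 (\<lambda>t. W (snd ((t, p), Y (t, p)))) s"
    proof (rule int_from_0_cong[where b = a])
      fix t assume "t \<in> {-a..a}"
      then have "Y (t, p) \<in> ?C" using that by (intro Yin) auto
      then show "G ((t, p), Y (t, p)) = W (snd ((t, p), Y (t, p)))" by (simp add: G_def closest_point_self)
    qed (use that in auto)
    then show ?thesis using Y(2)[of s p] that sub by auto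
  qed
  let ?G = "\<lambda>z::(real \<times> 'e) \<times> 'e. W (snd z)"
  have sG: "smooth ?G"
    by (rule smooth_on_compose[OF open_UNIV open_UNIV _ smooth_on_linear[OF _ bounded_linear_snd] assms]) auto
  have H: "smooth_on ?D snd" by (rule smooth_on_linear[OF oD bounded_linear_snd])
  have LG: "norm (frechet_derivative ?G (at (q, Y q)) (0, e)) \<le> L * norm e" if "q \<in> ?D" for q e
  proof -
    have "frechet_derivative ?G (at (q, Y q)) (0, e) = ?DW (Y q) e"
      using derivative_compose[of W snd "(q, Y q)" "(0, e)"] smooth_on_differentiable[OF assms]
        frechet_derivative_at[OF bounded_linear_imp_has_derivative[OF bounded_linear_snd], of "(q, Y q)", symmetric]
      by (simp add: bounded_linear_imp_differentiable bounded_linear_snd)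
    then show ?thesis using L(2)[OF Yin, of "fst q" "snd q" e] that sub by auto
  qed
  have cY: "continuous_on ?D Y" using Y(1) sub by (rule continuous_on_subset)
  have sY: "smooth_on ?D Y"
    unfolding smooth_on_def
  proof
    show "Ck_on k ?D Y" for k
      by (rule integral_equation_Ck[OF open_ball cY open_UNIV UNIV_I smooth_onD[OF H] smooth_onD[OF sG] eq LG a(2) L(1)])
  qed
  note C1 = integral_equation_C1(2)[OF open_ball cY open_UNIV UNIV_I smooth_onD[OF H] smooth_onD[OF sG] eq LG a(2) L(1)]
  show thesis
  proof (rule that[OF a(1) open_ball _ sY])
    show "Y (s, p) = p + int_from_0 (\<lambda>t. W (Y (t, p))) s" if "(s, p) \<in> ?D" for s p
      using eq[OF that] by simp
    show "frechet_derivative Y (at q) (1, 0) = W (Y q)" if q: "q \<in> ?D" for q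
    proof -
      have "frechet_derivative Y (at q) (1, 0) = 1 *\<^sub>R (frechet_derivative snd (at q) (1, 0) + W (snd (q, Y q)))
          + frechet_derivative Y (at q) (0, 0)"
        by (rule C1[OF _ _ q])
      moreover have "frechet_derivative Y (at q) (0, 0) = 0"
        using linear_0[OF has_derivative_linear[OF smooth_on_has_derivative[OF sY q]]] by (simp add: zero_prod_def)
      moreover have "frechet_derivative snd (at q) (1, 0) = 0"
        using frechet_derivative_at[OF bounded_linear_imp_has_derivative[OF bounded_linear_snd], of q, symmetric] by simp
      ultimately show ?thesis by simp
    qed
  qed simp
qed

section \<open>Closed one-forms on simply connected sets\<close>

lemma closed_form_ball_primitive:
  fixes \<omega> :: "'a::euclidean_space \<Rightarrow> 'a \<Rightarrow> real"
  assumes smooth: "\<And>v. smooth_on (ball c r) (\<lambda>z. \<omega> z v)" and lin: "\<And>z. z \<in> ball c r \<Longrightarrow> linear (\<omega> z)"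
    and closed: "\<And>z v w. z \<in> ball c r \<Longrightarrow>
      frechet_derivative (\<lambda>y. \<omega> y v) (at z) w = frechet_derivative (\<lambda>y. \<omega> y w) (at z) v"
  shows "\<exists>F. \<forall>z\<in>ball c r. (F has_derivative \<omega> z) (at z)"
proof -
  have star: "c + 0 + t *\<^sub>R (z - (c + 0)) \<in> ball c r" if "z \<in> ball c r" "t \<in> {0..1}" for z t
  proof -
    have "t * norm (z - c) \<le> 1 * norm (z - c)" using that by (intro mult_right_mono) auto
    then show ?thesis using that by (simp add: dist_norm norm_minus_commute)
  qed
  obtain F where F: "smooth_on (ball c r) F" "\<And>z w. z \<in> ball c r \<Longrightarrow> frechet_derivative F (at z) w = \<omega> z w"
    using relative_Poincare[of "ball c r" "\<lambda>_. 0" c \<omega>] star smooth lin closed by (auto simp del: mem_ball)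
  have "(F has_derivative \<omega> z) (at z)" if "z \<in> ball c r" for z
    by (rule has_derivative_eq_rhs[OF smooth_on_has_derivative[OF F(1) that]]) (rule ext, rule F(2)[OF that])
  then show ?thesis by blast
qed

definition segment_integral :: "('a::euclidean_space \<Rightarrow> 'a \<Rightarrow> real) \<Rightarrow> 'a \<Rightarrow> 'a \<Rightarrow> real" where
  "segment_integral \<omega> x y = integral {0..1} (\<lambda>t. \<omega> (x + t *\<^sub>R (y - x)) (y - x))"

lemma segment_integral_eq:
  assumes "\<And>z. z \<in> ball c r \<Longrightarrow> (F has_derivative \<omega> z) (at z)" "x \<in> ball c r" "y \<in> ball c r"
  shows "segment_integral \<omega> x y = F y - F x"
proof -
  have "((\<lambda>t. F (x + t *\<^sub>R (y - x))) has_vector_derivative \<omega> (x + t *\<^sub>R (y - x)) (y - x)) (at t within {0..1})"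
    if "t \<in> {0..1}" for t
  proof (rule has_vector_derivative_at_within[OF has_vector_derivative_along_line[OF assms(1)]])
    have "closed_segment x y \<subseteq> ball c r" using assms(2,3) by (intro closed_segment_subset) auto
    moreover have "x + t *\<^sub>R (y - x) \<in> closed_segment x y"
      using that by (auto simp: in_segment algebra_simps intro!: exI[of _ t])
    ultimately show "x + t *\<^sub>R (y - x) \<in> ball c r" by blast
  qed
  from fundamental_theorem_of_calculus[OF zero_le_one this] show ?thesis
    unfolding segment_integral_def by (simp add: integral_unique)
qed

text \<open>A substitute for the line integral: paths are merely continuous, so
  \<open>\<omega>\<close> is integrated over the inscribed polygon with vertices at equidistant
  parameters.\<close>

definition chain_sum :: "('a::euclidean_space \<Rightarrow> 'a \<Rightarrow> real) \<Rightarrow> nat \<Rightarrow> (real \<Rightarrow> 'a) \<Rightarrow> real" where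
  "chain_sum \<omega> n \<gamma> = (\<Sum>i<n. segment_integral \<omega> (\<gamma> (real i / real n)) (\<gamma> (real (Suc i) / real n)))"

text \<open>Inside a ball in \<open>U\<close> a closed form has a primitive; with each piece in such
  a ball the polygonal sum is insensitive to further subdivision.\<close>

definition fine_for :: "'a::metric_space set \<Rightarrow> nat \<Rightarrow> (real \<Rightarrow> 'a) \<Rightarrow> bool" where
  "fine_for U n \<gamma> \<longleftrightarrow> n > 0 \<and>
    (\<forall>i<n. \<exists>c r. ball c r \<subseteq> U \<and> \<gamma> ` {real i / real n..real (Suc i) / real n} \<subseteq> ball c r)"

text \<open>
  Neighbouring rows of a sufficiently fine grid on the homotopy have the same sum, because the sum
  around a single cell vanishes and the vertical edges telescope.
\<close>

lemma homotopy_grid: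
  fixes p q :: "real \<Rightarrow> 'a::euclidean_space"
  assumes "open U" "homotopic_paths U p q"
    and prim: "\<And>c r. ball c r \<subseteq> U \<Longrightarrow> \<exists>F. \<forall>z\<in>ball c r. (F has_derivative \<omega> z) (at z)"
  shows "\<exists>n. fine_for U n p \<and> fine_for U n q \<and> chain_sum \<omega> n p = chain_sum \<omega> n q"
proof -
  let ?I = "{0..1::real}"
  let ?J = "segment_integral \<omega>"
  obtain h where h: "continuous_on (?I \<times> ?I) h" "h ` (?I \<times> ?I) \<subseteq> U"
    "\<And>x. x \<in> ?I \<Longrightarrow> h (0, x) = p x" "\<And>x. x \<in> ?I \<Longrightarrow> h (1, x) = q x"
    and ends: "\<And>t. t \<in> ?I \<Longrightarrow> h (t, 0) = p 0 \<and> h (t, 1) = p 1"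
    using assms(2) unfolding homotopic_paths pathstart_def pathfinish_def o_def
    by (auto simp: image_subset_iff Pi_iff)
  have "compact (h ` (?I \<times> ?I))" using h(1) by (intro compact_continuous_image compact_Times) auto
  then obtain e where e: "e > 0" "(\<Union>x\<in>h ` (?I \<times> ?I). ball x e) \<subseteq> U"
    using compact_subset_open_imp_ball_epsilon_subset[OF _ assms(1) h(2)] by blast
  have "uniformly_continuous_on (?I \<times> ?I) h"
    using h(1) by (intro compact_uniformly_continuous compact_Times) auto
  then obtain d where d: "d > 0" "\<And>x y. x \<in> ?I \<times> ?I \<Longrightarrow> y \<in> ?I \<times> ?I \<Longrightarrow> dist y x < d \<Longrightarrow> dist (h y) (h x) < e"
    using e(1) unfolding uniformly_continuous_on_def by metis
  \<comment> \<open>Inside a grid cell each of the two coordinates varies by at most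
    \<open>1 / n\<close>, whence the 2.\<close>
  obtain n :: nat where "2 / d < real n" using reals_Archimedean2 by blast
  moreover have "2 / d > 0" using d(1) by simp
  ultimately have "n > 0" by (auto intro: gr0I)
  then have n: "n > 0" "2 / real n < d" using \<open>2 / d < real n\<close> d(1) by (auto simp: field_simps)
  let ?a = "\<lambda>i. real i / real n"
  have aI: "?a i \<in> ?I" if "i \<le> n" for i using that n by auto
  have cell: "\<exists>c r. ball c r \<subseteq> U \<and> h ` ({?a j..?a (Suc j)} \<times> {?a i..?a (Suc i)}) \<subseteq> ball c r"
    if "i < n" "j < n" for i j
  proof (intro exI conjI)
    have ij: "(?a j, ?a i) \<in> ?I \<times> ?I" using aI[of i] aI[of j] that by auto
    then show "ball (h (?a j, ?a i)) e \<subseteq> U" using e(2) by blast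
    show "h ` ({?a j..?a (Suc j)} \<times> {?a i..?a (Suc i)}) \<subseteq> ball (h (?a j, ?a i)) e"
    proof safe
      fix s t assume st: "s \<in> {?a j..?a (Suc j)}" "t \<in> {?a i..?a (Suc i)}"
      have "?a (Suc j) \<le> 1" "?a (Suc i) \<le> 1" using that n by auto
      moreover have "0 \<le> s" "0 \<le> t"
        using st order_trans[of 0 "?a j" s] order_trans[of 0 "?a i" t] by simp_all
      ultimately have st': "(s, t) \<in> ?I \<times> ?I" using st by auto
      have "\<bar>s - ?a j\<bar> \<le> 1 / real n" "\<bar>t - ?a i\<bar> \<le> 1 / real n"
        using st by (auto simp: add_divide_distrib)
      then have "dist (s, t) (?a j, ?a i) \<le> 2 / real n"
        using norm_Pair_le[of "s - ?a j" "t - ?a i"] by (simp add: dist_norm)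
      then have "dist (h (s, t)) (h (?a j, ?a i)) < e" using d(2)[OF ij st'] n by simp
      then show "h (s, t) \<in> ball (h (?a j, ?a i)) e" by (simp add: dist_commute)
    qed
  qed
  have an: "?a n = 1" "?a 0 = 0" using n by auto
  have fp: "fine_for U n p"
    unfolding fine_for_def
  proof (intro conjI allI impI n(1))
    fix i assume i: "i < n"
    obtain c r where cr: "ball c r \<subseteq> U" "h ` ({?a 0..?a (Suc 0)} \<times> {?a i..?a (Suc i)}) \<subseteq> ball c r"
      using cell[OF i n(1)] by blast
    have "p t \<in> ball c r" if t: "t \<in> {?a i..?a (Suc i)}" for t
    proof -
      have "?a i \<ge> 0" "?a (Suc i) \<le> 1" using i n by auto
      then have "t \<in> ?I" using t order_trans[of 0 "?a i" t] by simp
      moreover have "h (0, t) \<in> ball c r" using cr(2) t by (force simp: image_subset_iff)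
      ultimately show ?thesis using h(3) by simp
    qed
    then show "\<exists>c r. ball c r \<subseteq> U \<and> p ` {?a i..?a (Suc i)} \<subseteq> ball c r" using cr(1) by blast
  qed
  have fq: "fine_for U n q"
    unfolding fine_for_def
  proof (intro conjI allI impI n(1))
    fix i assume i: "i < n"
    obtain c r where cr: "ball c r \<subseteq> U" "h ` ({?a (n - 1)..?a (Suc (n - 1))} \<times> {?a i..?a (Suc i)}) \<subseteq> ball c r"
      using cell[OF i, of "n - 1"] n(1) by auto
    have "q t \<in> ball c r" if t: "t \<in> {?a i..?a (Suc i)}" for t
    proof -
      have "?a i \<ge> 0" "?a (Suc i) \<le> 1" using i n by auto
      then have "t \<in> ?I" using t order_trans[of 0 "?a i" t] by simp
      moreover have "1 \<in> {?a (n - 1)..?a (Suc (n - 1))}" using n by auto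
      then have "h (1, t) \<in> ball c r" using cr(2) t by blast
      ultimately show ?thesis using h(4) by simp
    qed
    then show "\<exists>c r. ball c r \<subseteq> U \<and> q ` {?a i..?a (Suc i)} \<subseteq> ball c r" using cr(1) by blast
  qed
  let ?x = "\<lambda>j i. h (?a j, ?a i)"
  have step: "chain_sum \<omega> n (\<lambda>t. h (?a (Suc j), t)) = chain_sum \<omega> n (\<lambda>t. h (?a j, t))" if j: "j < n" for j
  proof -
    \<comment> \<open>All four corners lie in one ball, so every edge contributes a difference of
      the same primitive.\<close>
    have sq: "?J (?x (Suc j) i) (?x (Suc j) (Suc i)) - ?J (?x j i) (?x j (Suc i))
        = ?J (?x j (Suc i)) (?x (Suc j) (Suc i)) - ?J (?x j i) (?x (Suc j) i)" if i: "i < n" for i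
    proof -
      obtain c r where cr: "ball c r \<subseteq> U" "h ` ({?a j..?a (Suc j)} \<times> {?a i..?a (Suc i)}) \<subseteq> ball c r"
        using cell[OF i j] by blast
      obtain F where F: "\<And>z. z \<in> ball c r \<Longrightarrow> (F has_derivative \<omega> z) (at z)" using prim[OF cr(1)] by blast
      have le: "?a k \<le> ?a (Suc k)" for k by (simp add: divide_right_mono)
      have "?x j i \<in> ball c r" "?x (Suc j) i \<in> ball c r" "?x j (Suc i) \<in> ball c r" "?x (Suc j) (Suc i) \<in> ball c r"
        using cr(2) le[of i] le[of j] by (auto simp: image_subset_iff simp del: mem_ball of_nat_Suc)
      then show ?thesis using segment_integral_eq[OF F] by simp
    qed
    have "chain_sum \<omega> n (\<lambda>t. h (?a (Suc j), t)) - chain_sum \<omega> n (\<lambda>t. h (?a j, t))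
      = (\<Sum>i<n. ?J (?x j (Suc i)) (?x (Suc j) (Suc i)) - ?J (?x j i) (?x (Suc j) i))"
      unfolding chain_sum_def sum_subtractf[symmetric] by (rule sum.cong) (use sq in auto)
    also have "\<dots> = ?J (?x j n) (?x (Suc j) n) - ?J (?x j 0) (?x (Suc j) 0)"
      by (rule sum_lessThan_telescope)
    \<comment> \<open>The homotopy fixes the end points of the paths, so the outermost vertical
      edges are degenerate.\<close>
    also have "\<dots> = 0"
    proof -
      have "?x j n = ?x (Suc j) n" "?x j 0 = ?x (Suc j) 0"
        using ends[OF aI[of j]] ends[OF aI[of "Suc j"]] j an by auto
      moreover have "?J x x = 0" if "x \<in> U" for x
      proof -
        obtain r where "r > 0" "ball x r \<subseteq> U" using assms(1) \<open>x \<in> U\<close> open_contains_ball by blast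
        moreover then obtain F where "\<And>z. z \<in> ball x r \<Longrightarrow> (F has_derivative \<omega> z) (at z)" using prim by blast
        ultimately show ?thesis using segment_integral_eq[of x r F \<omega> x x] by simp
      qed
      moreover have "?x (Suc j) n \<in> U" "?x (Suc j) 0 \<in> U"
        using h(2) aI[of "Suc j"] j by (auto simp: image_subset_iff an)
      ultimately show ?thesis by simp
    qed
    finally show ?thesis by simp
  qed
  have "chain_sum \<omega> n (\<lambda>t. h (?a j, t)) = chain_sum \<omega> n (\<lambda>t. h (?a 0, t))" if "j \<le> n" for j
    using that by (induction j) (auto simp: step simp del: of_nat_Suc)
  from this[of n] have "chain_sum \<omega> n (\<lambda>t. h (1, t)) = chain_sum \<omega> n (\<lambda>t. h (0, t))" by (simp only: an)
  moreover have "chain_sum \<omega> n (\<lambda>t. h (0, t)) = chain_sum \<omega> n p" "chain_sum \<omega> n (\<lambda>t. h (1, t)) = chain_sum \<omega> n q"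
    unfolding chain_sum_def using h(3,4) aI by (auto intro!: sum.cong simp del: of_nat_Suc)
  ultimately show ?thesis using fp fq by metis
qed

text \<open>Inside each piece the refined sum telescopes in a primitive, so only the end points of
  the piece matter.\<close>

lemma chain_sum_refine:
  fixes \<gamma> :: "real \<Rightarrow> 'a::euclidean_space"
  assumes "fine_for U n \<gamma>" "m > 0"
    and prim: "\<And>c r. ball c r \<subseteq> U \<Longrightarrow> \<exists>F. \<forall>z\<in>ball c r. (F has_derivative \<omega> z) (at z)"
  shows "chain_sum \<omega> (n * m) \<gamma> = chain_sum \<omega> n \<gamma>"
proof -
  have n: "n > 0" using assms(1) by (simp add: fine_for_def)
  let ?J = "segment_integral \<omega>" and ?b = "\<lambda>k. real k / real (n * m)"
  have "chain_sum \<omega> (n * m) \<gamma> = (\<Sum>i<n. \<Sum>k = i * m..<i * m + m. ?J (\<gamma> (?b k)) (\<gamma> (?b (Suc k))))"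
    unfolding chain_sum_def by (rule sum.nat_group[symmetric])
  also have "\<dots> = chain_sum \<omega> n \<gamma>"
    unfolding chain_sum_def
  proof (rule sum.cong[OF refl])
    fix i assume "i \<in> {..<n}"
    then obtain c r where cr: "ball c r \<subseteq> U" "\<gamma> ` {real i / real n..real (Suc i) / real n} \<subseteq> ball c r"
      using assms(1) unfolding fine_for_def by blast
    obtain F where F: "\<And>z. z \<in> ball c r \<Longrightarrow> (F has_derivative \<omega> z) (at z)" using prim[OF cr(1)] by blast
    have ends: "?b (i * m) = real i / real n" "?b (i * m + m) = real (Suc i) / real n"
      using n assms(2) by (auto simp: field_simps)
    have mem: "\<gamma> (?b k) \<in> ball c r" if "i * m \<le> k" "k \<le> i * m + m" for k
    proof -
      have "?b (i * m) \<le> ?b k" "?b k \<le> ?b (i * m + m)"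
        by (intro divide_right_mono of_nat_mono that; simp)+
      then show ?thesis using cr(2) unfolding ends by (auto simp: image_subset_iff simp del: mem_ball)
    qed
    have J: "?J (\<gamma> (?b k)) (\<gamma> (?b l)) = F (\<gamma> (?b l)) - F (\<gamma> (?b k))"
      if "i * m \<le> k" "k \<le> i * m + m" "i * m \<le> l" "l \<le> i * m + m" for k l
      by (rule segment_integral_eq[OF _ mem[OF that(1,2)] mem[OF that(3,4)]]) (rule F)
    have "(\<Sum>k = i * m..<i * m + m. ?J (\<gamma> (?b k)) (\<gamma> (?b (Suc k)))) = (\<Sum>k = i * m..<i * m + m. F (\<gamma> (?b (Suc k))) - F (\<gamma> (?b k)))"
      by (rule sum.cong[OF refl], rule J) auto
    also have "\<dots> = F (\<gamma> (?b (i * m + m))) - F (\<gamma> (?b (i * m)))"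
      by (rule sum_Suc_diff') simp
    also have "\<dots> = ?J (\<gamma> (?b (i * m))) (\<gamma> (?b (i * m + m)))"
      by (rule J[symmetric]) auto
    finally show "(\<Sum>k = i * m..<i * m + m. ?J (\<gamma> (?b k)) (\<gamma> (?b (Suc k))))
        = ?J (\<gamma> (real i / real n)) (\<gamma> (real (Suc i) / real n))"
      unfolding ends .
  qed
  finally show ?thesis .
qed

text \<open>Each path occupies half of the parameter interval of the join, hence the doubled number
  of steps.\<close>

lemma chain_sum_joinpaths:
  assumes "n > 0" "pathfinish p = pathstart q"
  shows "chain_sum \<omega> (n * 2) (p +++ q) = chain_sum \<omega> n p + chain_sum \<omega> n q"
proof -
  let ?J = "segment_integral \<omega>" and ?b = "\<lambda>k. real k / real (n * 2)" and ?a = "\<lambda>k. real k / real n"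
  have split: "(\<Sum>k<n + m. f k) = (\<Sum>k<n. f k) + (\<Sum>k<m. f (n + k))" for m and f :: "nat \<Rightarrow> real"
    by (induction m) auto
  have l: "(p +++ q) (?b k) = p (?a k)" if "k \<le> n" for k
    using that assms(1) by (auto simp: joinpaths_def field_simps)
  have r: "(p +++ q) (?b (n + k)) = q (?a k)" for k
  \<comment> \<open>At the junction \<open>joinpaths\<close> takes the end value of
    \<open>p\<close>, which is the start of \<open>q\<close> by assumption.\<close>
  proof (cases "k = 0")
    case True
    then show ?thesis using assms by (auto simp: joinpaths_def pathstart_def pathfinish_def)
  next
    case False
    then have "\<not> ?b (n + k) \<le> 1/2" "2 * ?b (n + k) - 1 = ?a k" using assms(1) by (auto simp: field_simps)
    then show ?thesis by (simp add: joinpaths_def)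
  qed
  have "chain_sum \<omega> (n * 2) (p +++ q) = (\<Sum>k<n + n. ?J ((p +++ q) (?b k)) ((p +++ q) (?b (Suc k))))"
    by (simp add: chain_sum_def mult_2_right)
  also have "\<dots> = (\<Sum>k<n. ?J ((p +++ q) (?b k)) ((p +++ q) (?b (Suc k))))
      + (\<Sum>k<n. ?J ((p +++ q) (?b (n + k))) ((p +++ q) (?b (n + Suc k))))"
    by (subst split) simp
  also have "\<dots> = chain_sum \<omega> n p + chain_sum \<omega> n q"
    unfolding chain_sum_def r by (intro arg_cong2[of _ _ _ _ "(+)"] sum.cong refl) (simp_all add: l del: of_nat_Suc of_nat_mult)
  finally show ?thesis .
qed

text \<open>The primitive at \<open>x\<close> is the polygonal integral along a chosen path from a
  base point. Simple connectedness makes the choice irrelevant, so within a ball the primitive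
  changes by a segment integral and differs from a local primitive by a constant.\<close>

theorem closed_one_form_exact:
  fixes \<omega> :: "'a::euclidean_space \<Rightarrow> 'a \<Rightarrow> real"
  assumes "open U" "simply_connected U"
    and smooth: "\<And>v. smooth_on U (\<lambda>z. \<omega> z v)" and lin: "\<And>z. z \<in> U \<Longrightarrow> linear (\<omega> z)"
    and closed: "\<And>z v w. z \<in> U \<Longrightarrow>
      frechet_derivative (\<lambda>y. \<omega> y v) (at z) w = frechet_derivative (\<lambda>y. \<omega> y w) (at z) v"
  shows "\<exists>s. smooth_on U s \<and> (\<forall>z\<in>U. (s has_derivative \<omega> z) (at z))"
proof (cases "U = {}")
  case True
  then show ?thesis by (auto simp: smooth_on_def intro!: exI Ck_on_const)
next
  case False
  then obtain a where a: "a \<in> U" by blast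
  have prim: "\<exists>F. \<forall>z\<in>ball c r. (F has_derivative \<omega> z) (at z)" if "ball c r \<subseteq> U" for c r
    using that smooth_on_subset[OF smooth that]
    by (intro closed_form_ball_primitive lin closed) auto
  \<comment> \<open>Any fine number of steps gives the same value: two fine subdivisions have a
    common refinement, whose number of steps is the product.\<close>
  define V where "V \<gamma> = chain_sum \<omega> (SOME n. fine_for U n \<gamma>) \<gamma>" for \<gamma>
  have V: "V \<gamma> = chain_sum \<omega> n \<gamma>" if n: "fine_for U n \<gamma>" for n \<gamma>
  proof -
    define m where "m = (SOME n. fine_for U n \<gamma>)"
    have m: "fine_for U m \<gamma>" unfolding m_def using n by (rule someI)
    have pos: "n > 0" "m > 0" using n m by (auto simp: fine_for_def)
    have "chain_sum \<omega> m \<gamma> = chain_sum \<omega> (m * n) \<gamma>" using chain_sum_refine[OF m pos(1) prim] by simp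
    also have "\<dots> = chain_sum \<omega> n \<gamma>" using chain_sum_refine[OF n pos(2) prim] by (simp add: mult.commute)
    finally show ?thesis by (simp add: V_def m_def)
  qed
  have "path_connected U" using assms(2) by (rule simply_connected_imp_path_connected)
  then have "\<exists>\<gamma>. path \<gamma> \<and> path_image \<gamma> \<subseteq> U \<and> pathstart \<gamma> = a \<and> pathfinish \<gamma> = x" if "x \<in> U" for x
    using a that unfolding path_connected_def by blast
  then obtain g where g: "\<And>x. x \<in> U \<Longrightarrow> path (g x) \<and> path_image (g x) \<subseteq> U \<and> pathstart (g x) = a \<and> pathfinish (g x) = x"
    by metis
  have diff: "V (g y) = V (g x) + segment_integral \<omega> x y" if "ball c r \<subseteq> U" "x \<in> ball c r" "y \<in> ball c r" for x y c r
  proof -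
    have xy: "x \<in> U" "y \<in> U" using that by auto
    let ?l = "linepath x y"
    have seg: "path_image ?l \<subseteq> ball c r" using that by (simp add: closed_segment_subset)
    then have l: "path_image ?l \<subseteq> U" using that by blast
    have "homotopic_paths U (g x +++ ?l) (g y)"
      using assms(2) g[OF xy(1)] g[OF xy(2)] l unfolding simply_connected_eq_homotopic_paths
      by (auto simp: path_image_join)
    then obtain n where n: "fine_for U n (g x +++ ?l)" "fine_for U n (g y)" "chain_sum \<omega> n (g x +++ ?l) = chain_sum \<omega> n (g y)"
      using homotopy_grid[OF assms(1) _ prim] by blast
    \<comment> \<open>The trivial homotopy supplies a fine subdivision of the path
      \<open>g x\<close>.\<close>
    have "homotopic_paths U (g x) (g x)" using g[OF xy(1)] by simp
    then obtain k where k: "fine_for U k (g x)" using homotopy_grid[OF assms(1) _ prim] by blast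
    have pos: "n > 0" "k > 0" using n k by (auto simp: fine_for_def)
    have l1: "fine_for U 1 ?l" 
      unfolding fine_for_def using that(1) seg by (auto simp: path_image_def intro!: exI[of _ c] exI[of _ r])
    have "V (g y) = chain_sum \<omega> n (g x +++ ?l)" using V[OF n(2)] n(3) by simp
    also have "\<dots> = chain_sum \<omega> (n * (k * 2)) (g x +++ ?l)"
      by (rule chain_sum_refine[OF n(1) _ prim, symmetric]) (use pos in auto)
    also have "\<dots> = chain_sum \<omega> (k * n * 2) (g x +++ ?l)" by (simp add: ac_simps)
    also have "\<dots> = chain_sum \<omega> (k * n) (g x) + chain_sum \<omega> (k * n) ?l"
      using pos g[OF xy(1)] by (intro chain_sum_joinpaths) auto
    also have "chain_sum \<omega> (k * n) (g x) = V (g x)"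
      using chain_sum_refine[OF k pos(1) prim] V[OF k] by simp
    also have "chain_sum \<omega> (k * n) ?l = chain_sum \<omega> 1 ?l"
      using chain_sum_refine[OF l1 _ prim, of "k * n"] pos by simp
    also have "\<dots> = segment_integral \<omega> x y" by (simp add: chain_sum_def linepath_def)
    finally show ?thesis .
  qed
  define s where "s x = V (g x)" for x
  have s: "(s has_derivative \<omega> x) (at x)" if x: "x \<in> U" for x
  proof -
    obtain r where r: "r > 0" "ball x r \<subseteq> U" using assms(1) x open_contains_ball by blast
    obtain F where F: "\<And>z. z \<in> ball x r \<Longrightarrow> (F has_derivative \<omega> z) (at z)" using prim[OF r(2)] by blast
    have "((\<lambda>y. s x + (F y - F x)) has_derivative \<omega> x) (at x)"
      using F[of x] r by (auto intro!: derivative_eq_intros)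
    then show ?thesis
    proof (rule has_derivative_transform_within_open[OF _ open_ball])
      show "x \<in> ball x r" using r by simp
      show "s x + (F y - F x) = s y" if "y \<in> ball x r" for y
        using diff[OF r(2) _ that, of x] segment_integral_eq[OF F _ that, of x] r by (simp add: s_def)
    qed
  qed
  then have "smooth_on U s" by (rule smooth_onI_derivative[OF assms(1) _ smooth])
  then show ?thesis using s by blast
qed

section \<open>Forms on space-time\<close>

lemma wedge_1_1:
  assumes "\<And>v. \<alpha> z v = a (v 0)" "\<And>v. \<beta> z v = b (v 0)"
  shows "wedge 1 1 \<alpha> \<beta> z v = a (v 0) * b (v 1) - a (v 1) * b (v 0)"
proof -
  have set: "{..<1 + 1} = {0, 1::nat}" by auto
  have f: "finite {1::nat}" "0 \<notin> {1::nat}" by auto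
  show ?thesis
    unfolding wedge_def assms set sum_over_permutations_insert[OF f] permutes_sing
    by (simp add: sign_swap_id sign_id swap_id_eq)
qed

lemma wedge_2_1:
  assumes "\<And>v. \<alpha> z v = A (v 0) (v 1)" "\<And>v. \<beta> z v = b (v 0)" and anti: "\<And>x y. A y x = - A x y"
  shows "wedge 2 1 \<alpha> \<beta> z v = A (v 0) (v 1) * b (v 2) - A (v 0) (v 2) * b (v 1) + A (v 1) (v 2) * b (v 0)"
proof -
  have set: "{..<2 + 1} = {0, 1, 2::nat}" by auto
  have f: "finite {1, 2::nat}" "0 \<notin> {1, 2::nat}" "finite {2::nat}" "1 \<notin> {2::nat}" by auto
  note swap = anti[of "v 1" "v 0"] anti[of "v 2" "v 0"] anti[of "v 2" "v 1"]
  show ?thesis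
    unfolding wedge_def assms(1,2) set sum_over_permutations_insert[OF f(1,2)]
      sum_over_permutations_insert[OF f(3,4)] permutes_sing
    using swap by (simp add: sign_swap_id permutation_swap_id sign_compose sign_id swap_id_eq fact_numeral)
qed

text \<open>The 24 permutations fall into three pairings of the arguments with eight each; the
  normalisation \<open>fact 2 * fact 2\<close> leaves the factor 2. The bracket is the Pfaffian of
  \<open>A\<close>.\<close>

lemma wedge_2_2:
  assumes "\<And>v. \<alpha> z v = A (v 0) (v 1)" and anti: "\<And>x y. A y x = - A x y"
  shows "wedge 2 2 \<alpha> \<alpha> z v = 2 * (A (v 0) (v 1) * A (v 2) (v 3) - A (v 0) (v 2) * A (v 1) (v 3) + A (v 0) (v 3) * A (v 1) (v 2))"
proof -
  have set: "{..<2 + 2} = {0, 1, 2, 3::nat}" by auto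
  have f: "finite {1, 2, 3::nat}" "0 \<notin> {1, 2, 3::nat}" "finite {2, 3::nat}" "1 \<notin> {2, 3::nat}"
    "finite {3::nat}" "2 \<notin> {3::nat}" by auto
  note swap = anti[of "v 1" "v 0"] anti[of "v 2" "v 0"] anti[of "v 2" "v 1"]
    anti[of "v 3" "v 0"] anti[of "v 3" "v 1"] anti[of "v 3" "v 2"]
  show ?thesis
    unfolding wedge_def assms(1) set sum_over_permutations_insert[OF f(1,2)]
      sum_over_permutations_insert[OF f(3,4)] sum_over_permutations_insert[OF f(5,6)] permutes_sing
    using swap by (simp add: sign_swap_id permutation_swap_id sign_compose permutation_compose sign_id swap_id_eq fact_numeral)
qed

lemma wedge_3_1:
  assumes "\<And>v. \<alpha> z v = A (v 0) (v 1) (v 2)" "\<And>v. \<beta> z v = b (v 0)"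
    and anti: "\<And>x y w. A y x w = - A x y w" "\<And>x y w. A x w y = - A x y w"
  shows "wedge 3 1 \<alpha> \<beta> z v = A (v 0) (v 1) (v 2) * b (v 3) - A (v 0) (v 1) (v 3) * b (v 2)
    + A (v 0) (v 2) (v 3) * b (v 1) - A (v 1) (v 2) (v 3) * b (v 0)"
proof -
  have set: "{..<3 + 1} = {0, 1, 2, 3::nat}" by auto
  have f: "finite {1, 2, 3::nat}" "0 \<notin> {1, 2, 3::nat}" "finite {2, 3::nat}" "1 \<notin> {2, 3::nat}"
    "finite {3::nat}" "2 \<notin> {3::nat}" by auto
  \<comment> \<open>The two adjacent exchanges generate all rearrangements of three
    arguments.\<close>
  have perms: "A y x w = - A x y w" "A x w y = - A x y w" "A y w x = A x y w" "A w x y = A x y w" "A w y x = - A x y w"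
    for x y w
    using anti(1)[of y x w] anti(2)[of x w y] anti(2)[of y w x] anti(1)[of w x y] anti(1)[of w y x] by linarith+
  note p = perms[of "v 0" "v 1" "v 2"] perms[of "v 0" "v 1" "v 3"] perms[of "v 0" "v 2" "v 3"] perms[of "v 1" "v 2" "v 3"]
  show ?thesis
    unfolding wedge_def assms(1,2) set sum_over_permutations_insert[OF f(1,2)]
      sum_over_permutations_insert[OF f(3,4)] sum_over_permutations_insert[OF f(5,6)] permutes_sing
    using p by (simp add: sign_swap_id permutation_swap_id sign_compose permutation_compose sign_id swap_id_eq fact_numeral)
qed

lemma differential_apply: "differential f z v = frechet_derivative f (at z) (v 0)"
  by (simp add: ext_deriv_def form0_def)

lemma frechet_derivative_bounded_linear_self:
  "bounded_linear L \<Longrightarrow> frechet_derivative L (at z) = L"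
  using frechet_derivative_at[OF bounded_linear_imp_has_derivative] by metis

lemma dt_apply: "dt z v = fst (v 0)"
  by (simp add: differential_apply frechet_derivative_bounded_linear_self[OF bounded_linear_fst])

lemma dx_apply: "dx i z v = snd (v 0) $ i"
proof -
  have "bounded_linear (\<lambda>z::spacetime. snd z $ i)"
    using bounded_linear_compose[OF bounded_linear_vec_nth bounded_linear_snd] .
  then show ?thesis by (simp add: differential_apply frechet_derivative_bounded_linear_self)
qed

lemma form0_times_apply: "(form0 f * \<omega>) z v = f z * \<omega> z v"
  by (simp add: form0_def)

lemma dot_dx_apply: "dot_dx V z v = V z \<bullet> snd (v 0)"
  unfolding dot_dx_def plus_fun_apply form0_times_apply dx_apply by (simp add: inner_vec_def sum_3)

lemma dot_dx_dx_apply: "dot_dx_dx V z v = V z \<bullet> cross3 (snd (v 0)) (snd (v 1))"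
proof -
  have W: "wedge 1 1 (dx i) (dx j) z v = snd (v 0) $ i * snd (v 1) $ j - snd (v 1) $ i * snd (v 0) $ j" for i j
    by (rule wedge_1_1) (rule dx_apply)+
  show ?thesis
    unfolding dot_dx_dx_def plus_fun_apply form0_times_apply W
    by (simp add: inner_vec_def sum_3 cross3_def algebra_simps del: One_nat_def)
qed

text \<open>Freezing the field values turns statements about \<Omega> at a point into polynomial
  identities in components. Since the expression is linear in \<open>E\<close> and \<open>B\<close>,
  a derivative of \<Omega> is the same expression in their derivatives.\<close>

definition omega_at :: "real ^ 3 \<Rightarrow> real ^ 3 \<Rightarrow> spacetime \<Rightarrow> spacetime \<Rightarrow> real" where
  "omega_at E B x y = (E \<bullet> snd y) * fst x - (E \<bullet> snd x) * fst y + B \<bullet> cross3 (snd x) (snd y)"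

lemma Omega_apply:
  "Omega u B \<phi> z v = omega_at (grad \<phi> z + cross3 (u z) (B z)) (B z) (v 0) (v 1)"
proof -
  have "wedge 1 1 (dot_dx V) dt z v = (V z \<bullet> snd (v 0)) * fst (v 1) - (V z \<bullet> snd (v 1)) * fst (v 0)" for V
    by (rule wedge_1_1) (rule dot_dx_apply dt_apply)+
  then show ?thesis
    by (simp add: Omega_def omega_at_def dot_dx_dx_apply del: One_nat_def)
qed

lemma omega_at_anti: "omega_at E B y x = - omega_at E B x y"
  by (simp add: omega_at_def cross_skew[of "snd y"])

lemma omega_at_linear:
  "omega_at E B (x + x') y = omega_at E B x y + omega_at E B x' y"
  "omega_at E B (c *\<^sub>R x) y = c * omega_at E B x y"
  "omega_at E B x (y + y') = omega_at E B x y + omega_at E B x y'"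
  "omega_at E B x (c *\<^sub>R y) = c * omega_at E B x y"
  by (simp_all add: omega_at_def cross_add_left cross_add_right cross_mult_left cross_mult_right
      inner_add_right algebra_simps)

lemma inner_3: "(x::real ^ 3) \<bullet> y = x $ 1 * y $ 1 + x $ 2 * y $ 2 + x $ 3 * y $ 3"
  by (simp add: inner_vec_def sum_3)

text \<open>\<open>wedge_2_2\<close> reduces the square to a polynomial in components.
  \<open>cross3 (u z) (B z)\<close> is orthogonal to \<open>B z\<close>, which brings in
  \<open>B z \<bullet> grad \<phi> z\<close>; the minus sign is that of the \<open>dt\<close> part
  of \<open>Omega\<close>.\<close>

lemma half_Omega_squared:
  "form0 (\<lambda>z. 1 / 2) * wedge 2 2 (Omega u B \<phi>) (Omega u B \<phi>) = form0 (\<lambda>z. - (B z \<bullet> grad \<phi> z)) * volume_form"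
proof (intro ext)
  fix z and v :: "nat \<Rightarrow> spacetime"
  let ?A = "omega_at (grad \<phi> z + cross3 (u z) (B z)) (B z)"
  have L: "wedge 2 2 (Omega u B \<phi>) (Omega u B \<phi>) z v
      = 2 * (?A (v 0) (v 1) * ?A (v 2) (v 3) - ?A (v 0) (v 2) * ?A (v 1) (v 3) + ?A (v 0) (v 3) * ?A (v 1) (v 2))"
    by (rule wedge_2_2) (rule Omega_apply omega_at_anti)+
  let ?a = "\<lambda>x y. snd x $ 1 * snd y $ 2 - snd y $ 1 * snd x $ 2 :: real"
  let ?T = "\<lambda>x y w. ?a x y * snd w $ 3 - ?a x w * snd y $ 3 + ?a y w * snd x $ 3"
  have V2: "wedge 1 1 (dx 1) (dx 2) z v = ?a (v 0) (v 1)" for v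
    by (rule wedge_1_1) (rule dx_apply)+
  have V3: "wedge 2 1 (wedge 1 1 (dx 1) (dx 2)) (dx 3) z v = ?T (v 0) (v 1) (v 2)" for v
    by (rule wedge_2_1) (rule V2, rule dx_apply, simp)
  have V4: "volume_form z v = ?T (v 0) (v 1) (v 2) * fst (v 3) - ?T (v 0) (v 1) (v 3) * fst (v 2)
    + ?T (v 0) (v 2) (v 3) * fst (v 1) - ?T (v 1) (v 2) (v 3) * fst (v 0)"
    unfolding volume_form_def by (rule wedge_3_1) (rule V3, rule dt_apply, simp_all add: algebra_simps)
  obtain t0 x0 where 0: "v 0 = (t0, x0)" by (rule prod.exhaust)
  obtain t1 x1 where 1: "v 1 = (t1, x1)" by (rule prod.exhaust)
  obtain t2 x2 where 2: "v 2 = (t2, x2)" by (rule prod.exhaust)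
  obtain t3 x3 where 3: "v 3 = (t3, x3)" by (rule prod.exhaust)
  have EB: "B z \<bullet> grad \<phi> z = (grad \<phi> z + cross3 (u z) (B z)) \<bullet> B z"
    by (simp add: inner_3 cross3_def algebra_simps)
  have half: "1 / 2 * (2 * r) = r" for r :: real by simp
  define E where "E = grad \<phi> z + cross3 (u z) (B z)"
  show "(form0 (\<lambda>z. 1 / 2) * wedge 2 2 (Omega u B \<phi>) (Omega u B \<phi>)) z v = (form0 (\<lambda>z. - (B z \<bullet> grad \<phi> z)) * volume_form) z v"
    unfolding form0_times_apply L V4 EB
    unfolding half 0 1 2 3 E_def[symmetric] omega_at_def fst_conv snd_conv inner_3
    by (simp only: cross3_def vector_3, algebra)
qed

section \<open>Vector calculus in terms of the total derivative on space-time\<close>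

lemma has_derivative_compose_frechet:
  assumes "f differentiable (at (g s))" "(g has_derivative g') (at s)"
  shows "((\<lambda>s. f (g s)) has_derivative (\<lambda>v. frechet_derivative f (at (g s)) (g' v))) (at s)"
  using has_derivative_compose[OF assms(2)] assms(1) by (simp add: frechet_derivative_works)

lemma linear_derivative: "f differentiable (at z) \<Longrightarrow> linear (frechet_derivative f (at z))"
  unfolding frechet_derivative_works by (rule has_derivative_linear)

lemma time_deriv_eq:
  assumes "f differentiable (at z)"
  shows "time_deriv f z = frechet_derivative f (at z) (1, 0)"
proof -
  have "((\<lambda>s. (s, snd z)) has_derivative (\<lambda>h. (h, 0))) (at (fst z))"
    by (auto intro!: derivative_eq_intros)
  from has_derivative_compose_frechet[OF _ this, of f] assms
  have *: "((\<lambda>s. f (s, snd z)) has_derivative (\<lambda>h. frechet_derivative f (at z) (h, 0))) (at (fst z))" by simp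
  have lin: "frechet_derivative f (at z) (h, 0) = h *\<^sub>R frechet_derivative f (at z) (1, 0)" for h
    using linear_cmul[OF linear_derivative[OF assms], of h "(1, 0)"] by simp
  have "((\<lambda>s. f (s, snd z)) has_vector_derivative frechet_derivative f (at z) (1, 0)) (at (fst z))"
    unfolding has_vector_derivative_def by (rule has_derivative_eq_rhs[OF * ext[OF lin]])
  then show ?thesis unfolding time_deriv_def by (rule vector_derivative_at)
qed

lemma space_deriv_eq:
  assumes "f differentiable (at z)"
  shows "space_deriv i f z = frechet_derivative f (at z) (0, axis i 1)"
proof -
  have "((\<lambda>x. (fst z, x)) has_derivative (\<lambda>h. (0, h))) (at (snd z))"
    by (auto intro!: derivative_eq_intros)
  from has_derivative_compose_frechet[OF _ this, of f] assms
  have "((\<lambda>x. f (fst z, x)) has_derivative (\<lambda>h. frechet_derivative f (at z) (0, h))) (at (snd z))" by simp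
  from frechet_derivative_at[OF this] show ?thesis unfolding space_deriv_def by metis
qed

lemma derivative_nth:
  assumes "V differentiable (at z)"
  shows "frechet_derivative (\<lambda>w. V w $ i) (at z) v = frechet_derivative V (at z) v $ i"
  using frechet_derivative_bounded_linear[OF bounded_linear_vec_nth assms] by metis

lemma differentiable_nth: "V differentiable F \<Longrightarrow> (\<lambda>w. V w $ i) differentiable F"
  unfolding differentiable_def using bounded_linear.has_derivative[OF bounded_linear_vec_nth] by blast

lemma spacetime_linear_expand:
  fixes L :: "spacetime \<Rightarrow> 'b::real_vector"
  assumes "linear L"
  shows "L v = fst v *\<^sub>R L (1, 0) + (snd v $ 1 *\<^sub>R L (0, axis 1 1) + snd v $ 2 *\<^sub>R L (0, axis 2 1) + snd v $ 3 *\<^sub>R L (0, axis 3 1))"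
proof -
  have "v = fst v *\<^sub>R (1, 0) + (snd v $ 1 *\<^sub>R (0, axis 1 1) + snd v $ 2 *\<^sub>R (0, axis 2 1) + snd v $ 3 *\<^sub>R (0, axis 3 1))"
    by (simp add: prod_eq_iff vec_eq_iff forall_3 axis_def)
  then have "L v = L (fst v *\<^sub>R (1, 0) + (snd v $ 1 *\<^sub>R (0, axis 1 1) + snd v $ 2 *\<^sub>R (0, axis 2 1) + snd v $ 3 *\<^sub>R (0, axis 3 1)))"
    by (rule arg_cong)
  then show ?thesis by (simp only: linear_add[OF assms] linear_cmul[OF assms])
qed

lemma grad_nth: "f differentiable (at z) \<Longrightarrow> grad f z $ i = frechet_derivative f (at z) (0, axis i 1)"
  by (simp add: grad_def space_deriv_eq)

lemma derivative_eq_grad: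
  assumes "f differentiable (at z)"
  shows "frechet_derivative f (at z) v = fst v * frechet_derivative f (at z) (1, 0) + grad f z \<bullet> snd v"
proof -
  from spacetime_linear_expand[OF linear_derivative[OF assms], of v] show ?thesis
    by (simp add: inner_3 grad_nth[OF assms] mult.commute)
qed

lemma curl_eq:
  assumes "V differentiable (at z)"
  shows "curl V z = vector
    [frechet_derivative V (at z) (0, axis 2 1) $ 3 - frechet_derivative V (at z) (0, axis 3 1) $ 2,
     frechet_derivative V (at z) (0, axis 3 1) $ 1 - frechet_derivative V (at z) (0, axis 1 1) $ 3,
     frechet_derivative V (at z) (0, axis 1 1) $ 2 - frechet_derivative V (at z) (0, axis 2 1) $ 1]"
  unfolding curl_def space_deriv_eq[OF differentiable_nth[OF assms]] derivative_nth[OF assms] ..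

lemma divergence_eq:
  assumes "V differentiable (at z)"
  shows "divergence V z = frechet_derivative V (at z) (0, axis 1 1) $ 1 + frechet_derivative V (at z) (0, axis 2 1) $ 2
    + frechet_derivative V (at z) (0, axis 3 1) $ 3"
  unfolding divergence_def space_deriv_eq[OF differentiable_nth[OF assms]] derivative_nth[OF assms] sum_3 ..

lemma smooth_on_grad:
  assumes "open S" "smooth_on S f"
  shows "smooth_on S (grad f)"
proof (rule smooth_on_vec[OF assms(1)])
  fix i
  have "smooth_on S (\<lambda>z. frechet_derivative f (at z) (0, axis i 1))"
    by (rule smooth_on_derivative[OF assms(2)])
  then show "smooth_on S (\<lambda>z. grad f z $ i)"
    by (rule iffD2[OF smooth_on_cong[OF assms(1) grad_nth[OF smooth_on_differentiable[OF assms(2)]]], rotated])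
qed

lemma bounded_bilinear_cross3: "bounded_bilinear cross3"
proof -
  have "bilinear cross3"
    by (auto simp: bilinear_def linear_iff cross_add_left cross_add_right cross_mult_left cross_mult_right)
  then show ?thesis by (simp add: bilinear_conv_bounded_bilinear)
qed

lemma smooth_cross3: "smooth V \<Longrightarrow> smooth W \<Longrightarrow> smooth (\<lambda>w. cross3 (V w) (W w))"
  by (rule smooth_on_bounded_bilinear[OF open_UNIV bounded_bilinear_cross3])

lemma derivative_bilinear:
  assumes "bounded_bilinear pr" "f differentiable (at z)" "g differentiable (at z)"
  shows "frechet_derivative (\<lambda>w. pr (f w) (g w)) (at z) v
    = pr (f z) (frechet_derivative g (at z) v) + pr (frechet_derivative f (at z) v) (g z)"
proof -
  have "((\<lambda>w. pr (f w) (g w)) has_derivative (\<lambda>v. pr (f z) (frechet_derivative g (at z) v) + pr (frechet_derivative f (at z) v) (g z))) (at z)"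
    using assms by (intro bounded_bilinear.FDERIV) (auto simp: frechet_derivative_works)
  from frechet_derivative_at[OF this] show ?thesis by metis
qed

lemma derivative_add:
  assumes "f differentiable (at z)" "g differentiable (at z)"
  shows "frechet_derivative (\<lambda>w. f w + g w) (at z) v = frechet_derivative f (at z) v + frechet_derivative g (at z) v"
proof -
  have "((\<lambda>w. f w + g w) has_derivative (\<lambda>v. frechet_derivative f (at z) v + frechet_derivative g (at z) v)) (at z)"
    using assms by (intro has_derivative_add) (auto simp: frechet_derivative_works)
  from frechet_derivative_at[OF this] show ?thesis by metis
qed

text \<open>By symmetry of second derivatives the spatial direction becomes the outer one. In
  particular the time derivative of a gradient can be computed as the gradient of a time
  derivative.\<close>

lemma derivative_grad_nth:
  assumes "open S" "smooth_on S f" "z \<in> S"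
  shows "frechet_derivative (grad f) (at z) v $ i = frechet_derivative (\<lambda>w. frechet_derivative f (at w) v) (at z) (0, axis i 1)"
proof -
  have d: "grad f differentiable (at z)"
    using smooth_on_differentiable[OF smooth_on_grad[OF assms(1,2)] assms(3)] .
  have "frechet_derivative (grad f) (at z) v $ i = frechet_derivative (\<lambda>w. grad f w $ i) (at z) v"
    using derivative_nth[OF d] by simp
  also have "frechet_derivative (\<lambda>w. grad f w $ i) (at z) = frechet_derivative (\<lambda>w. frechet_derivative f (at w) (0, axis i 1)) (at z)"
    using differentiable_nth[OF d] assms(1,3)
    by (rule frechet_derivative_transform_within_open) (simp add: grad_nth[OF smooth_on_differentiable[OF assms(2)]])
  also have "\<dots> v = frechet_derivative (\<lambda>w. frechet_derivative f (at w) v) (at z) (0, axis i 1)"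
    by (rule second_derivative_commute[OF assms(1) smooth_onD[OF assms(2)] assms(3)])
  finally show ?thesis .
qed

lemma derivative_grad_symmetric:
  assumes "open S" "smooth_on S f" "z \<in> S"
  shows "frechet_derivative (grad f) (at z) (0, axis j 1) $ i = frechet_derivative (grad f) (at z) (0, axis i 1) $ j"
  unfolding derivative_grad_nth[OF assms]
  by (rule second_derivative_commute[OF assms(1) smooth_onD[OF assms(2)] assms(3)])

definition electric_field ::
  "(spacetime \<Rightarrow> real ^ 3) \<Rightarrow> (spacetime \<Rightarrow> real ^ 3) \<Rightarrow> (spacetime \<Rightarrow> real) \<Rightarrow> spacetime \<Rightarrow> real ^ 3" where
  "electric_field u B \<phi> z = grad \<phi> z + cross3 (u z) (B z)"

section \<open>The symplectic form, its Hamiltonian field and the Liouville density\<close>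

context
  fixes u B :: "spacetime \<Rightarrow> real ^ 3" and \<phi> :: "spacetime \<Rightarrow> real"
  assumes su: "smooth u" and sB: "smooth B" and s\<phi>: "smooth \<phi>"
    and div0: "\<And>z. divergence B z = 0"
    and frozen: "\<And>z. time_deriv B z - curl (\<lambda>w. cross3 (u w) (B w)) z = 0"
    and advected: "\<And>z. time_deriv \<phi> z + advect u \<phi> z = 0"
    and transversal: "\<And>z. B z \<bullet> grad \<phi> z \<noteq> 0"
begin

private abbreviation "E \<equiv> electric_field u B \<phi>"

private lemmas E_def = electric_field_def[of u B \<phi>]

private lemma d: "u differentiable (at z)" "B differentiable (at z)" "\<phi> differentiable (at z)" "grad \<phi> differentiable (at z)"
  by (rule smooth_on_differentiable[OF _ UNIV_I], fact su sB s\<phi> smooth_on_grad[OF open_UNIV s\<phi>])+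

lemma smooth_electric_field: "smooth E"
  unfolding E_def[abs_def] by (rule smooth_on_add[OF open_UNIV smooth_on_grad[OF open_UNIV s\<phi>] smooth_cross3[OF su sB]])

private lemma E_differentiable: "E differentiable (at z)" "(\<lambda>w. cross3 (u w) (B w)) differentiable (at z)"
  by (rule smooth_on_differentiable[OF _ UNIV_I], fact smooth_electric_field smooth_cross3[OF su sB])+

lemma time_deriv_B: "frechet_derivative B (at z) (1, 0) = curl (\<lambda>w. cross3 (u w) (B w)) z"
  using frozen[of z] time_deriv_eq[OF d(2)] by simp

lemma time_deriv_phi: "frechet_derivative \<phi> (at z) (1, 0) = - (u z \<bullet> grad \<phi> z)"
proof -
  have "advect u \<phi> z = u z \<bullet> grad \<phi> z"
    by (simp add: advect_def inner_vec_def grad_def)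
  then show ?thesis using advected[of z] time_deriv_eq[OF d(3)] by (simp add: eq_neg_iff_add_eq_0)
qed

lemma curl_electric_field: "frechet_derivative B (at z) (1, 0) = curl E z"
proof -
  have "frechet_derivative E (at z) v = frechet_derivative (grad \<phi>) (at z) v
      + frechet_derivative (\<lambda>w. cross3 (u w) (B w)) (at z) v" for v
    unfolding E_def[abs_def] by (rule derivative_add[OF d(4) E_differentiable(2)])
  then show ?thesis
    using derivative_grad_symmetric[OF open_UNIV s\<phi> UNIV_I, of z]
    unfolding time_deriv_B curl_eq[OF E_differentiable(1)] curl_eq[OF E_differentiable(2)]
    by (simp add: vec_eq_iff forall_3)
qed

lemma Omega_eq_omega_at: "Omega u B \<phi> z v = omega_at (E z) (B z) (v 0) (v 1)"
  unfolding Omega_apply E_def ..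

private lemma E_B: "E z \<bullet> B z \<noteq> 0"
proof -
  have "E z \<bullet> B z = B z \<bullet> grad \<phi> z"
    unfolding E_def by (simp add: inner_3 cross3_def algebra_simps)
  then show ?thesis using transversal by simp
qed

text \<open>The test vectors \<open>(1, 0)\<close>, \<open>(0, B z)\<close> and
  \<open>(0, w)\<close> show in turn that the spatial part of \<open>x\<close> is orthogonal to
  \<open>E z\<close>, that its time component vanishes, and that its spatial part is parallel to
  \<open>B z\<close>. A triple-product expansion then gives
  \<open>(E z \<bullet> B z) *\<^sub>R snd x = 0\<close>.\<close>

lemma nondegenerate_omega_at:
  assumes "\<And>y. omega_at (E z) (B z) x y = 0"
  shows "x = 0"
proof -
  have 1: "E z \<bullet> snd x = 0" using assms[of "(1, 0)"] by (simp add: omega_at_def)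
  have "omega_at (E z) (B z) x (0, B z) = (E z \<bullet> B z) * fst x"
    by (simp add: omega_at_def inner_3 cross3_def algebra_simps)
  then have 2: "fst x = 0" using assms[of "(0, B z)"] E_B by simp
  have "B z \<bullet> cross3 (snd x) w = 0" for w using assms[of "(0, w)"] 2 by (simp add: omega_at_def)
  then have "cross3 (B z) (snd x) \<bullet> w = 0" for w
    by (simp add: inner_3 cross3_def algebra_simps)
  then have 3: "cross3 (B z) (snd x) = 0" using inner_eq_zero_iff by blast
  have "(E z \<bullet> B z) *\<^sub>R snd x = (E z \<bullet> snd x) *\<^sub>R B z + cross3 (cross3 (B z) (snd x)) (E z)"
    by (simp add: vec_eq_iff forall_3 inner_3 cross3_def algebra_simps)
  then have "(E z \<bullet> B z) *\<^sub>R snd x = 0" using 1 3 by simp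
  then have "snd x = 0" using E_B by simp
  then show ?thesis using 2 by (simp add: prod_eq_iff)
qed

lemma derivative_omega_at:
  "frechet_derivative (\<lambda>w. omega_at (E w) (B w) x y) (at z) v
    = omega_at (frechet_derivative E (at z) v) (frechet_derivative B (at z) v) x y"
proof -
  have bl: "bounded_linear (\<lambda>p. omega_at (fst p) (snd p) x y)"
    unfolding linear_conv_bounded_linear[symmetric]
    by (rule linearI) (simp_all add: omega_at_def inner_add_left algebra_simps)
  have "((\<lambda>w. (E w, B w)) has_derivative (\<lambda>v. (frechet_derivative E (at z) v, frechet_derivative B (at z) v))) (at z)"
    using E_differentiable(1) d(2) by (intro has_derivative_Pair) (auto simp: frechet_derivative_works)
  from bounded_linear.has_derivative[OF bl this]
  have "((\<lambda>w. omega_at (E w) (B w) x y) has_derivative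
     (\<lambda>v. omega_at (frechet_derivative E (at z) v) (frechet_derivative B (at z) v) x y)) (at z)"
    unfolding fst_conv snd_conv .
  from fun_cong[OF frechet_derivative_at[OF this, symmetric]] show ?thesis .
qed

lemma symplectic_Omega: "symplectic_form (Omega u B \<phi>)"
  unfolding symplectic_form_def
proof (intro conjI)
  show "differential_form 2 (Omega u B \<phi>)"
    unfolding differential_form_def
  proof (intro conjI allI)
    fix z
    show "alternating 2 (Omega u B \<phi> z)"
      unfolding alternating_def
    proof (intro conjI allI impI)
      fix v w :: "nat \<Rightarrow> spacetime" assume "\<forall>i<2. v i = w i"
      then show "Omega u B \<phi> z v = Omega u B \<phi> z w" by (simp add: Omega_eq_omega_at)
    next
      fix v :: "nat \<Rightarrow> spacetime" and i :: nat assume "i < 2"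
      then consider "i = 0" | "i = 1" by linarith
      then have "(\<lambda>x. Omega u B \<phi> z (v(i := x))) = (\<lambda>x. omega_at (E z) (B z) x (v 1))
          \<or> (\<lambda>x. Omega u B \<phi> z (v(i := x))) = (\<lambda>x. omega_at (E z) (B z) (v 0) x)"
        by cases (simp_all add: Omega_eq_omega_at)
      moreover have "linear (\<lambda>x. omega_at (E z) (B z) x y)" "linear (\<lambda>x. omega_at (E z) (B z) y x)" for y
        by (rule linearI; simp only: omega_at_linear real_scaleR_def)+
      ultimately show "linear (\<lambda>x. Omega u B \<phi> z (v(i := x)))" by metis
    next
      fix v :: "nat \<Rightarrow> spacetime" and i j :: nat assume "i < j \<and> j < 2 \<and> v i = v j"
      then have "v 0 = v 1" by (cases "i = 0"; cases "j = 1") auto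
      then show "Omega u B \<phi> z v = 0"
        using omega_at_anti[of "E z" "B z" "v 1" "v 1"] by (simp add: Omega_eq_omega_at)
    qed
  next
    fix v
    show "smooth (\<lambda>z. Omega u B \<phi> z v)"
      unfolding Omega_eq_omega_at omega_at_def
      by (intro smooth_on_add smooth_on_diff smooth_on_mult smooth_on_inner smooth_on_const smooth_electric_field sB open_UNIV)
  qed
  show "ext_deriv 2 (Omega u B \<phi>) = 0"
  proof (intro ext)
    fix z and v :: "nat \<Rightarrow> spacetime"
    have "ext_deriv 2 (Omega u B \<phi>) z v =
       frechet_derivative (\<lambda>w. omega_at (E w) (B w) (v 1) (v 2)) (at z) (v 0)
       - frechet_derivative (\<lambda>w. omega_at (E w) (B w) (v 0) (v 2)) (at z) (v 1)
       + frechet_derivative (\<lambda>w. omega_at (E w) (B w) (v 0) (v 1)) (at z) (v 2)"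
      unfolding ext_deriv_def Omega_eq_omega_at by (simp add: numeral_2_eq_2)
    also have "\<dots> = 0"
    proof -
      let ?E = "frechet_derivative E (at z)" and ?B = "frechet_derivative B (at z)"
      have lin: "linear ?E" "linear ?B"
        by (rule linear_derivative[OF E_differentiable(1)], rule linear_derivative[OF d(2)])
      \<comment> \<open>With the partial derivatives named as plain vectors, closedness is a
        polynomial identity: Faraday's law eliminates \<open>bt\<close> and the vanishing divergence
        eliminates \<open>b3 $ 3\<close>.\<close>
      define et e1 e2 e3 bt b1 b2 b3 where "et = ?E (1, 0)" "e1 = ?E (0, axis 1 1)" "e2 = ?E (0, axis 2 1)" "e3 = ?E (0, axis 3 1)"
        "bt = ?B (1, 0)" "b1 = ?B (0, axis 1 1)" "b2 = ?B (0, axis 2 1)" "b3 = ?B (0, axis 3 1)"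
      note defs = this
      have bt: "bt $ 1 = e2 $ 3 - e3 $ 2" "bt $ 2 = e3 $ 1 - e1 $ 3" "bt $ 3 = e1 $ 2 - e2 $ 1"
        using curl_electric_field[of z] unfolding curl_eq[OF E_differentiable(1)] defs by simp_all
      have b33: "b3 $ 3 = - b1 $ 1 - b2 $ 2"
        using div0[of z] unfolding divergence_eq[OF d(2)] defs by simp
      obtain t0 x0 where 0: "v 0 = (t0, x0)" by (rule prod.exhaust)
      obtain t1 x1 where 1: "v 1 = (t1, x1)" by (rule prod.exhaust)
      obtain t2 x2 where 2: "v 2 = (t2, x2)" by (rule prod.exhaust)
      show ?thesis
        unfolding derivative_omega_at
        unfolding spacetime_linear_expand[OF lin(1), of "v _"] spacetime_linear_expand[OF lin(2), of "v _"]
        unfolding defs[symmetric] 0 1 2 fst_conv snd_conv omega_at_def inner_3 vector_add_component vector_scaleR_component bt b33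
        by (simp only: cross3_def vector_3 bt b33 real_scaleR_def, algebra)
    qed
    finally show "ext_deriv 2 (Omega u B \<phi>) z v = 0 z v" by simp
  qed
  show "nondegenerate (Omega u B \<phi>)"
    unfolding nondegenerate_def
  proof (intro allI impI)
    fix z x assume *: "\<forall>v. Omega u B \<phi> z (case_nat x v) = 0"
    show "x = 0"
    proof (rule nondegenerate_omega_at)
      show "omega_at (E z) (B z) x y = 0" for y
        using *[rule_format, of "\<lambda>_. y"] by (simp add: Omega_eq_omega_at)
    qed
  qed
qed

lemma hamiltonian_Omega: "hamiltonian_vector_field (Omega u B \<phi>) (\<lambda>z. (1, u z)) \<phi>"
  unfolding hamiltonian_vector_field_def
proof (intro ext)
  fix z and v :: "nat \<Rightarrow> spacetime"
  have "interior_product (\<lambda>z. (1, u z)) (Omega u B \<phi>) z v = omega_at (E z) (B z) (1, u z) (v 0)"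
    by (simp add: interior_product_def Omega_eq_omega_at)
  also have "\<dots> = fst (v 0) * - (u z \<bullet> grad \<phi> z) + grad \<phi> z \<bullet> snd (v 0)"
    unfolding omega_at_def E_def by (simp add: inner_3 cross3_def algebra_simps)
  also have "\<dots> = differential \<phi> z v"
    unfolding differential_apply derivative_eq_grad[OF d(3), of z "v 0"] time_deriv_phi ..
  finally show "interior_product (\<lambda>z. (1, u z)) (Omega u B \<phi>) z v = differential \<phi> z v" .
qed

lemma continuity_equation:
  fixes \<rho>
  defines "\<rho> \<equiv> \<lambda>z. - (B z \<bullet> grad \<phi> z)"
  shows "time_deriv \<rho> z + divergence (\<lambda>w. \<rho> w *\<^sub>R u w) z = 0"
proof -
  let ?u = "frechet_derivative u (at z)" and ?B = "frechet_derivative B (at z)" and ?g = "frechet_derivative (grad \<phi>) (at z)"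
  have bl: "bounded_linear (uminus :: real \<Rightarrow> real)" by (rule bounded_linear_minus[OF bounded_linear_ident])
  have smooth_dot: "smooth (\<lambda>w. B w \<bullet> grad \<phi> w)"
    by (rule smooth_on_inner[OF open_UNIV sB smooth_on_grad[OF open_UNIV s\<phi>]])
  have s\<rho>: "smooth \<rho>" unfolding \<rho>_def by (rule smooth_on_minus[OF open_UNIV smooth_dot])
  have d\<rho>: "\<rho> differentiable (at z)" by (rule smooth_on_differentiable[OF s\<rho> UNIV_I])
  have D\<rho>: "frechet_derivative \<rho> (at z) v = - (B z \<bullet> ?g v + ?B v \<bullet> grad \<phi> z)" for v
    unfolding \<rho>_def frechet_derivative_bounded_linear[OF bl smooth_on_differentiable[OF smooth_dot UNIV_I]]
    by (simp only: derivative_bilinear[OF bounded_bilinear_inner d(2,4)])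
  have D\<rho>u: "frechet_derivative (\<lambda>w. \<rho> w *\<^sub>R u w) (at z) v = \<rho> z *\<^sub>R ?u v + frechet_derivative \<rho> (at z) v *\<^sub>R u z" for v
    by (rule derivative_bilinear[OF bounded_bilinear_scaleR d\<rho> d(1)])
  have d\<rho>u: "(\<lambda>w. \<rho> w *\<^sub>R u w) differentiable (at z)"
    by (rule smooth_on_differentiable[OF smooth_on_scaleR[OF open_UNIV s\<rho> su] UNIV_I])
  have cross: "frechet_derivative (\<lambda>w. cross3 (u w) (B w)) (at z) v = cross3 (u z) (?B v) + cross3 (?u v) (B z)" for v
    by (rule derivative_bilinear[OF bounded_bilinear_cross3 d(1,2)])
  define bt b1 b2 b3 where "bt = ?B (1, 0)" "b1 = ?B (0, axis 1 1)" "b2 = ?B (0, axis 2 1)" "b3 = ?B (0, axis 3 1)"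
  note bdefs = this
  define u1 u2 u3 where "u1 = ?u (0, axis 1 1)" "u2 = ?u (0, axis 2 1)" "u3 = ?u (0, axis 3 1)"
  note udefs = this
  define gt g1 g2 g3 where "gt = ?g (1, 0)" "g1 = ?g (0, axis 1 1)" "g2 = ?g (0, axis 2 1)" "g3 = ?g (0, axis 3 1)"
  note gdefs = this
  define uz Bz gz where "uz = u z" "Bz = B z" "gz = grad \<phi> z"
  note zdefs = this
  have sym: "g2 $ 1 = g1 $ 2" "g3 $ 1 = g1 $ 3" "g3 $ 2 = g2 $ 3"
    unfolding gdefs by (rule derivative_grad_symmetric[OF open_UNIV s\<phi> UNIV_I])+
  have gt: "gt $ i = - (u z \<bullet> ?g (0, axis i 1) + ?u (0, axis i 1) \<bullet> grad \<phi> z)" for i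
  proof -
    have smooth_ug: "smooth (\<lambda>w. u w \<bullet> grad \<phi> w)"
      by (rule smooth_on_inner[OF open_UNIV su smooth_on_grad[OF open_UNIV s\<phi>]])
    show ?thesis
      unfolding gdefs derivative_grad_nth[OF open_UNIV s\<phi> UNIV_I] time_deriv_phi
        frechet_derivative_bounded_linear[OF bl smooth_on_differentiable[OF smooth_ug UNIV_I]]
      by (simp only: derivative_bilinear[OF bounded_bilinear_inner d(1,4)])
  qed
  have gt': "gt $ 1 = - (uz \<bullet> g1 + u1 \<bullet> gz)" "gt $ 2 = - (uz \<bullet> g2 + u2 \<bullet> gz)" "gt $ 3 = - (uz \<bullet> g3 + u3 \<bullet> gz)"
    unfolding gt unfolding gdefs udefs zdefs by (rule refl)+
  have bt: "bt = vector
    [(cross3 uz b2 + cross3 u2 Bz) $ 3 - (cross3 uz b3 + cross3 u3 Bz) $ 2,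
     (cross3 uz b3 + cross3 u3 Bz) $ 1 - (cross3 uz b1 + cross3 u1 Bz) $ 3,
     (cross3 uz b1 + cross3 u1 Bz) $ 2 - (cross3 uz b2 + cross3 u2 Bz) $ 1]"
    unfolding bdefs udefs zdefs time_deriv_B curl_eq[OF E_differentiable(2)] cross ..
  have b33: "b3 $ 3 = - b1 $ 1 - b2 $ 2"
    using div0[of z] unfolding divergence_eq[OF d(2)] bdefs by simp
  have "time_deriv \<rho> z + divergence (\<lambda>w. \<rho> w *\<^sub>R u w) z =
    - (Bz \<bullet> gt + bt \<bullet> gz) +
    ((- (Bz \<bullet> gz) *\<^sub>R u1 + - (Bz \<bullet> g1 + b1 \<bullet> gz) *\<^sub>R uz) $ 1 + (- (Bz \<bullet> gz) *\<^sub>R u2 + - (Bz \<bullet> g2 + b2 \<bullet> gz) *\<^sub>R uz) $ 2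
      + (- (Bz \<bullet> gz) *\<^sub>R u3 + - (Bz \<bullet> g3 + b3 \<bullet> gz) *\<^sub>R uz) $ 3)"
    unfolding time_deriv_eq[OF d\<rho>] divergence_eq[OF d\<rho>u] D\<rho>u D\<rho>
    unfolding bdefs udefs gdefs zdefs \<rho>_def ..
  also have "\<dots> = 0"
    unfolding inner_3 vector_add_component vector_scaleR_component gt'
    unfolding bt sym inner_3 vector_add_component
    by (simp only: cross3_def vector_3 b33 sym real_scaleR_def vector_add_component, algebra)
  finally show ?thesis .
qed

end

section \<open>Scalar potentials\<close>

text \<open>This is \<open>relative_Poincare\<close> with \<open>P\<close> the projection to the
  time axis: every time slice is contracted to \<open>x\<^sub>0\<close>, and the time enters as a
  smooth parameter.\<close>

lemma spatial_potential:
  fixes G :: "spacetime \<Rightarrow> real ^ 3"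
  assumes "open V" "smooth_on V G"
    and star: "\<And>t x \<tau>. (t, x) \<in> V \<Longrightarrow> \<tau> \<in> {0..1} \<Longrightarrow> (t, x\<^sub>0 + \<tau> *\<^sub>R (x - x\<^sub>0)) \<in> V"
    and curl: "\<And>z i j. z \<in> V \<Longrightarrow>
      frechet_derivative G (at z) (0, axis j 1) $ i = frechet_derivative G (at z) (0, axis i 1) $ j"
  obtains h where "smooth_on V h" "\<And>z. z \<in> V \<Longrightarrow> grad h z = G z"
proof -
  define \<omega> where "\<omega> z v = G z \<bullet> snd v" for z v :: spacetime
  have D\<omega>: "frechet_derivative (\<lambda>y. \<omega> y v) (at z) w = frechet_derivative G (at z) w \<bullet> snd v" if "z \<in> V" for z v w
    unfolding \<omega>_def
    using frechet_derivative_bounded_linear[OF bounded_linear_inner_left smooth_on_differentiable[OF assms(2) that]] by metis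
  have bl: "bounded_linear (\<lambda>z::spacetime. (fst z, 0::real ^ 3))"
    by (intro bounded_linear_Pair bounded_linear_fst bounded_linear_zero)
  let ?F = "\<lambda>z. integral {0..1} (\<lambda>t. \<omega> ((0, x\<^sub>0) + (fst z, 0) + t *\<^sub>R (z - ((0, x\<^sub>0) + (fst z, 0)))) (z - ((0, x\<^sub>0) + (fst z, 0))))"
  have 1: "(0, x\<^sub>0) + (fst z, 0) + t *\<^sub>R (z - ((0, x\<^sub>0) + (fst z, 0))) \<in> V" if "z \<in> V" "t \<in> {0..1}" for z t
    using star[of "fst z" "snd z" t] that by (simp add: minus_prod_def)
  have 2: "smooth_on V (\<lambda>z. \<omega> z v)" for v
    unfolding \<omega>_def by (rule smooth_on_inner[OF assms(1,2) smooth_on_const[OF assms(1)]])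
  have 3: "linear (\<omega> z)" for z
    unfolding \<omega>_def by (rule linearI) (simp_all add: inner_add_right)
  have 4: "frechet_derivative (\<lambda>y. \<omega> y v) (at z) w = frechet_derivative (\<lambda>y. \<omega> y w) (at z) v"
    if z: "z \<in> V" and "(fst v, 0::real ^ 3) = 0" "(fst w, 0::real ^ 3) = 0" for z v w
  proof -
    note lin = linear_derivative[OF smooth_on_differentiable[OF assms(2) z]]
    have 0: "fst v = 0" "fst w = 0" using that by (auto simp: prod_eq_iff)
    note c = curl[OF z, of 1 2] curl[OF z, of 1 3] curl[OF z, of 2 3]
    show ?thesis
      unfolding D\<omega>[OF z] spacetime_linear_expand[OF lin, of v] spacetime_linear_expand[OF lin, of w] 0
      by (simp add: inner_3 c algebra_simps)
  qed
  have "smooth_on V ?F" "\<And>z w. z \<in> V \<Longrightarrow> (fst w, 0::real ^ 3) = 0 \<Longrightarrow> frechet_derivative ?F (at z) w = \<omega> z w"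
    using relative_Poincare[of V "\<lambda>z. (fst z, 0)" "(0, x\<^sub>0)" \<omega>, OF assms(1) bl _ _ 1 2 3 4]
    by (simp_all add: zero_prod_def)
  note F = this
  show thesis
  proof (rule that[OF F(1)])
    fix z assume z: "z \<in> V"
    have "frechet_derivative ?F (at z) (0, axis i 1) = G z $ i" for i
      using F(2)[OF z, of "(0, axis i 1)"] by (simp add: \<omega>_def inner_axis zero_prod_def)
    then show "grad ?F z = G z"
      unfolding vec_eq_iff grad_nth[OF smooth_on_differentiable[OF F(1) z]] by blast
  qed
qed

lemma theta_apply: "theta \<psi> A z v = - (\<psi> z * fst (v 0) + A z \<bullet> snd (v 0))"
  unfolding theta_def uminus_apply plus_fun_apply form0_times_apply dt_apply dot_dx_apply ..

lemma theta_can_apply: "theta_can q p h z v = - (p z * frechet_derivative q (at z) (v 0) + h z * fst (v 0))"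
  unfolding theta_can_def uminus_apply plus_fun_apply form0_times_apply dt_apply
  unfolding differential_apply ..

lemma grad_add:
  assumes "f differentiable (at z)" "g differentiable (at z)"
  shows "grad (\<lambda>w. f w + g w) z = grad f z + grad g z"
proof -
  have "(\<lambda>w. f w + g w) differentiable (at z)" using assms by simp
  then show ?thesis using assms by (simp add: vec_eq_iff grad_nth derivative_add)
qed

lemma grad_zero_imp_time_only:
  assumes "smooth f" "\<And>z. grad f z = 0"
  shows "f (t, x) = f (t, 0)"
proof -
  have "((\<lambda>x. f (t, x)) has_derivative (\<lambda>h. 0)) (at x within UNIV)" for x
  proof -
    have df: "f differentiable (at (t, x))" by (rule smooth_on_differentiable[OF assms(1) UNIV_I])
    have "((\<lambda>x. (t, x)) has_derivative (\<lambda>h. (0, h))) (at x)" by (auto intro!: derivative_eq_intros)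
    note * = has_derivative_compose_frechet[OF df this]
    have "frechet_derivative f (at (t, x)) (0, h) = 0" for h
      by (subst derivative_eq_grad[OF df]) (simp add: assms(2))
    with * show ?thesis by simp
  qed
  from has_derivative_zero_constant[OF convex_UNIV this]
  obtain c where "\<forall>x\<in>UNIV. f (t, x) = c" by (rule exE)
  then show ?thesis by simp
qed

section \<open>The scalar potential \<psi> and exactness\<close>

context
  fixes u B A :: "spacetime \<Rightarrow> real ^ 3" and \<phi> :: "spacetime \<Rightarrow> real"
  assumes su: "smooth u" and sB: "smooth B" and s\<phi>: "smooth \<phi>" and sA: "smooth A"
    and frozen: "\<And>z. time_deriv B z - curl (\<lambda>w. cross3 (u w) (B w)) z = 0"
    and BA: "\<And>z. B z = curl A z"
begin

private definition "At z = frechet_derivative A (at z) (1, 0)"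
text \<open>The gradient that \<open>potential_equation\<close> prescribes for \<psi>.\<close>

private definition "G z = At z - cross3 (u z) (B z) - grad \<phi> z"

private lemma dA: "A differentiable (at z)" and dB: "B differentiable (at z)" and d\<phi>: "\<phi> differentiable (at z)"
  by (rule smooth_on_differentiable[OF _ UNIV_I], fact sA sB s\<phi>)+

private lemma smooth_At: "smooth At"
  unfolding At_def by (rule smooth_on_derivative[OF sA])

private lemma smooth_G: "smooth G"
  unfolding G_def
  by (rule smooth_on_diff[OF open_UNIV smooth_on_diff[OF open_UNIV smooth_At smooth_cross3[OF su sB]] smooth_on_grad[OF open_UNIV s\<phi>]])

text \<open>Time derivative and curl commute, by symmetry of second derivatives.\<close>

private lemma curl_At: "curl At z = frechet_derivative B (at z) (1, 0)"
proof -
  have X: "frechet_derivative At (at z) v = frechet_derivative (\<lambda>w. frechet_derivative A (at w) v) (at z) (1, 0)" for v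
    unfolding At_def by (rule second_derivative_commute[OF open_UNIV smooth_onD[OF sA] UNIV_I])
  have d: "(\<lambda>w. frechet_derivative A (at w) v) differentiable (at z)" for v
    by (rule smooth_on_differentiable[OF smooth_on_derivative[OF sA] UNIV_I])
  have diff: "frechet_derivative (\<lambda>w. frechet_derivative A (at w) v $ i - frechet_derivative A (at w) v' $ j) (at z) (1, 0)
     = frechet_derivative At (at z) v $ i - frechet_derivative At (at z) v' $ j" for v v' i j
  proof -
    have "((\<lambda>w. frechet_derivative A (at w) v $ i - frechet_derivative A (at w) v' $ j) has_derivative
      (\<lambda>x. frechet_derivative (\<lambda>w. frechet_derivative A (at w) v) (at z) x $ i
         - frechet_derivative (\<lambda>w. frechet_derivative A (at w) v') (at z) x $ j)) (at z)"
      using d by (intro has_derivative_diff bounded_linear.has_derivative[OF bounded_linear_vec_nth])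
        (auto simp: frechet_derivative_works)
    from fun_cong[OF frechet_derivative_at[OF this, symmetric]] show ?thesis unfolding X .
  qed
  have B: "(\<lambda>w. B w $ i) = (\<lambda>w. curl A w $ i)" for i by (simp add: BA)
  have "frechet_derivative B (at z) (1, 0) $ i = frechet_derivative (\<lambda>w. curl A w $ i) (at z) (1, 0)" for i
    unfolding B[symmetric] derivative_nth[OF dB] ..
  then show ?thesis
    unfolding curl_eq[OF smooth_on_differentiable[OF smooth_At UNIV_I]]
    by (simp add: vec_eq_iff forall_3 curl_eq[OF dA] diff)
qed

private lemma curl_G:
  "frechet_derivative G (at z) (0, axis j 1) $ i = frechet_derivative G (at z) (0, axis i 1) $ j"
proof -
  note d = smooth_on_differentiable[OF smooth_At UNIV_I, of z] smooth_on_differentiable[OF smooth_cross3[OF su sB] UNIV_I, of z]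
    smooth_on_differentiable[OF smooth_on_grad[OF open_UNIV s\<phi>] UNIV_I, of z]
  let ?D = "\<lambda>f. frechet_derivative f (at z)" and ?c = "\<lambda>w. cross3 (u w) (B w)"
  have "(G has_derivative (\<lambda>v. ?D At v - ?D ?c v - ?D (grad \<phi>) v)) (at z)"
    unfolding G_def[abs_def] using d by (intro has_derivative_diff) (auto simp: frechet_derivative_works)
  note DG = fun_cong[OF frechet_derivative_at[OF this, symmetric]]
  have "curl At z = curl ?c z"
    using curl_At[of z] frozen[of z] time_deriv_eq[OF dB, of z] by simp
  then have c: "?D At (0, axis 2 1) $ 3 - ?D At (0, axis 3 1) $ 2 = ?D ?c (0, axis 2 1) $ 3 - ?D ?c (0, axis 3 1) $ 2"
    "?D At (0, axis 3 1) $ 1 - ?D At (0, axis 1 1) $ 3 = ?D ?c (0, axis 3 1) $ 1 - ?D ?c (0, axis 1 1) $ 3"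
    "?D At (0, axis 1 1) $ 2 - ?D At (0, axis 2 1) $ 1 = ?D ?c (0, axis 1 1) $ 2 - ?D ?c (0, axis 2 1) $ 1"
    unfolding curl_eq[OF d(1)] curl_eq[OF d(2)] by (simp_all add: vec_eq_iff forall_3)
  have sym: "?D (grad \<phi>) (0, axis j 1) $ i = ?D (grad \<phi>) (0, axis i 1) $ j" for i j
    by (rule derivative_grad_symmetric[OF open_UNIV s\<phi> UNIV_I])
  have "\<forall>i j. ?D G (0, axis j 1) $ i = ?D G (0, axis i 1) $ j"
    unfolding forall_3 DG vector_minus_component
    using c sym[of 1 2] sym[of 1 3] sym[of 2 3] by (intro conjI) linarith+
  then show ?thesis by blast
qed

private lemma potential_equation_iff:
  assumes "smooth \<psi>"
  shows "potential_equation u A \<phi> \<psi> \<longleftrightarrow> (\<forall>z. grad \<psi> z = G z)"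
proof -
  have "grad (\<lambda>w. \<phi> w + \<psi> w) z = grad \<phi> z + grad \<psi> z" for z
    by (rule grad_add[OF d\<phi> smooth_on_differentiable[OF assms UNIV_I]])
  then show ?thesis
    unfolding potential_equation_def G_def At_def time_deriv_eq[OF dA] BA[symmetric]
    by (auto simp: algebra_simps)
qed

private lemma potential_grad: "smooth \<psi> \<Longrightarrow> potential_equation u A \<phi> \<psi> \<Longrightarrow> grad \<psi> z = G z"
  using potential_equation_iff by blast

lemma potential_exists: "\<exists>\<psi>. smooth \<psi> \<and> potential_equation u A \<phi> \<psi>"
proof -
  obtain \<psi> where "smooth \<psi>" "\<And>z. z \<in> UNIV \<Longrightarrow> grad \<psi> z = G z"
    by (rule spatial_potential[OF open_UNIV smooth_G UNIV_I curl_G]) (rule that)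
  then show ?thesis using potential_equation_iff UNIV_I by metis
qed

lemma potential_unique:
  assumes \<psi>: "smooth \<psi>" "potential_equation u A \<phi> \<psi>"
  shows "smooth \<psi>' \<and> potential_equation u A \<phi> \<psi>' \<longleftrightarrow>
    (\<exists>c :: real \<Rightarrow> real. smooth c \<and> (\<forall>z. \<psi>' z = \<psi> z + c (fst z)))"
proof safe
  assume \<psi>': "smooth \<psi>'" "potential_equation u A \<phi> \<psi>'"
  define f where "f z = \<psi>' z - \<psi> z" for z
  have sf: "smooth f" unfolding f_def by (rule smooth_on_diff[OF open_UNIV \<psi>'(1) \<psi>(1)])
  have "grad f z = 0" for z
  proof -
    have "\<psi>' = (\<lambda>w. \<psi> w + f w)" by (simp add: f_def fun_eq_iff)
    then have "grad \<psi>' z = grad \<psi> z + grad f z"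
      using grad_add[OF smooth_on_differentiable[OF \<psi>(1) UNIV_I] smooth_on_differentiable[OF sf UNIV_I], of z] by simp
    then show ?thesis unfolding potential_grad[OF \<psi>] potential_grad[OF \<psi>'] by simp
  qed
  then have f: "f (t, x) = f (t, 0)" for t x by (rule grad_zero_imp_time_only[OF sf])
  have "bounded_linear (\<lambda>t::real. (t, 0::real ^ 3))"
    by (intro bounded_linear_Pair bounded_linear_ident bounded_linear_zero)
  then have "smooth (\<lambda>t. f (t, 0))"
    by (intro smooth_on_compose[OF open_UNIV open_UNIV _ _ sf] smooth_on_linear[OF open_UNIV]) auto
  moreover have "\<psi>' z = \<psi> z + f (fst z, 0)" for z
    using f[of "fst z" "snd z"] by (simp add: f_def)
  ultimately show "\<exists>c :: real \<Rightarrow> real. smooth c \<and> (\<forall>z. \<psi>' z = \<psi> z + c (fst z))" by blast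
next
  fix c :: "real \<Rightarrow> real" assume c: "smooth c" "\<forall>z. \<psi>' z = \<psi> z + c (fst z)"
  have sc: "smooth (\<lambda>z::spacetime. c (fst z))"
    by (rule smooth_on_compose[OF open_UNIV open_UNIV subset_UNIV smooth_on_linear[OF open_UNIV bounded_linear_fst] c(1)])
  have \<psi>': "\<psi>' = (\<lambda>z. \<psi> z + c (fst z))" using c(2) by auto
  show s: "smooth \<psi>'" unfolding \<psi>' by (rule smooth_on_add[OF open_UNIV \<psi>(1) sc])
  have dc: "(\<lambda>z::spacetime. c (fst z)) differentiable (at z)" for z by (rule smooth_on_differentiable[OF sc UNIV_I])
  have "grad (\<lambda>z. c (fst z)) z = 0" for z :: spacetime
  proof -
    have "frechet_derivative (\<lambda>z::spacetime. c (fst z)) (at z) (0, w) = 0" for w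
      using derivative_compose[of c fst z "(0, w)"] smooth_on_differentiable[OF c(1) UNIV_I]
        frechet_derivative_bounded_linear_self[OF bounded_linear_fst, of z]
        linear_0[OF linear_derivative[OF smooth_on_differentiable[OF c(1) UNIV_I]]]
      by (simp add: bounded_linear_imp_differentiable bounded_linear_fst)
    then show ?thesis by (simp add: vec_eq_iff grad_nth[OF dc])
  qed
  then have "grad \<psi>' z = grad \<psi> z" for z
    unfolding \<psi>' using grad_add[OF smooth_on_differentiable[OF \<psi>(1) UNIV_I] dc, of z] by simp
  then show "potential_equation u A \<phi> \<psi>'"
    unfolding potential_equation_iff[OF s] potential_grad[OF \<psi>] by blast
qed

text \<open>Kept as a pointwise identity for two purposes: exactness of \<Omega>, and closedness of
  \<open>theta_can q p h - theta \<psi> A\<close> on a Darboux domain.\<close>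

lemma derivative_theta:
  assumes \<psi>: "smooth \<psi>" "potential_equation u A \<phi> \<psi>"
  shows "(frechet_derivative \<psi> (at z) v * fst w + frechet_derivative A (at z) v \<bullet> snd w)
    - (frechet_derivative \<psi> (at z) w * fst v + frechet_derivative A (at z) w \<bullet> snd v)
    = omega_at (grad \<phi> z + cross3 (u z) (B z)) (B z) v w"
proof -
  note d\<psi> = smooth_on_differentiable[OF \<psi>(1) UNIV_I, of z]
  let ?A = "frechet_derivative A (at z)"
  define a1 a2 a3 where "a1 = ?A (0, axis 1 1)" "a2 = ?A (0, axis 2 1)" "a3 = ?A (0, axis 3 1)"
  note adefs = this
  have g': "At z = grad \<psi> z + (grad \<phi> z + cross3 (u z) (B z))"
    unfolding potential_grad[OF \<psi>] by (simp add: G_def)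
  define e where "e = grad \<phi> z + cross3 (u z) (B z)"
  define g where "g = grad \<psi> z"
  have B: "B z = vector [a2 $ 3 - a3 $ 2, a3 $ 1 - a1 $ 3, a1 $ 2 - a2 $ 1]"
    unfolding BA curl_eq[OF dA] adefs ..
  have At: "?A (1, 0) = g + e" using g' by (simp add: At_def g_def e_def)
  obtain t x where v: "v = (t, x)" by (rule prod.exhaust)
  obtain s y where w: "w = (s, y)" by (rule prod.exhaust)
  show ?thesis
    unfolding e_def[symmetric] derivative_eq_grad[OF d\<psi>, of v] derivative_eq_grad[OF d\<psi>, of w]
      spacetime_linear_expand[OF linear_derivative[OF dA], of z v] spacetime_linear_expand[OF linear_derivative[OF dA], of z w]
    unfolding At adefs[symmetric] g_def[symmetric] v w omega_at_def fst_conv snd_conv inner_3 B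
    by (simp only: cross3_def vector_3 vector_add_component vector_scaleR_component real_scaleR_def, algebra)
qed

lemma Omega_exact:
  assumes \<psi>: "smooth \<psi>" "potential_equation u A \<phi> \<psi>"
  shows "Omega u B \<phi> = - ext_deriv 1 (theta \<psi> A)"
proof (intro ext)
  fix z and v :: "nat \<Rightarrow> spacetime"
  have D: "frechet_derivative (\<lambda>w. - (\<psi> w * fst x + A w \<bullet> snd x)) (at z) y
    = - (frechet_derivative \<psi> (at z) y * fst x + frechet_derivative A (at z) y \<bullet> snd x)" for x y
  proof -
    have "((\<lambda>w. - (\<psi> w * fst x + A w \<bullet> snd x)) has_derivative
       (\<lambda>y. - (frechet_derivative \<psi> (at z) y * fst x + frechet_derivative A (at z) y \<bullet> snd x))) (at z)"
      using smooth_on_differentiable[OF \<psi>(1) UNIV_I, of z] dA[of z]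
      by (intro has_derivative_minus has_derivative_add has_derivative_mult_left has_derivative_inner_left)
        (auto simp: frechet_derivative_works)
    from fun_cong[OF frechet_derivative_at[OF this, symmetric]] show ?thesis .
  qed
  have "ext_deriv 1 (theta \<psi> A) z v = frechet_derivative (\<lambda>w. - (\<psi> w * fst (v 1) + A w \<bullet> snd (v 1))) (at z) (v 0)
     - frechet_derivative (\<lambda>w. - (\<psi> w * fst (v 0) + A w \<bullet> snd (v 0))) (at z) (v 1)"
    unfolding ext_deriv_def theta_apply by simp
  then show "Omega u B \<phi> z v = (- ext_deriv 1 (theta \<psi> A)) z v"
    unfolding D uminus_apply Omega_apply derivative_theta[OF \<psi>, of z "v 0" "v 1", symmetric] by simp
qed

end

section \<open>Darboux coordinates\<close>

lemma vector_4:
  "(vector [x, y, z, w] :: ('a::zero) ^ 4) $ 1 = x"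
  "(vector [x, y, z, w] :: ('a::zero) ^ 4) $ 2 = y"
  "(vector [x, y, z, w] :: ('a::zero) ^ 4) $ 3 = z"
  "(vector [x, y, z, w] :: ('a::zero) ^ 4) $ 4 = w"
  unfolding vector_def by simp_all

text \<open>The inverse is wanted between open subsets of \<open>'a\<close> itself, whereas
  coordinate maps take values in \<open>real ^ 'n\<close>. The isomorphism \<open>\<kappa>\<close>
  mediates, and \<open>'n\<close> stands for the dimension.\<close>

lemma local_inverse:
  fixes f :: "'a::euclidean_space \<Rightarrow> 'a"
  assumes dim: "DIM('a) = CARD('n::finite)" and "open S" "smooth_on S f" "z \<in> S"
    and inj: "\<And>v. frechet_derivative f (at z) v = 0 \<Longrightarrow> v = 0"
  obtains U V g where "open U" "z \<in> U" "U \<subseteq> S" "open V" "f ` U = V" "smooth_on V g"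
    "\<And>x. x \<in> U \<Longrightarrow> g (f x) = x"
proof -
  have "DIM('a) = DIM(real ^ 'n)" using dim by simp
  from isomorphisms_UNIV_UNIV[OF this]
  obtain \<kappa> :: "'a \<Rightarrow> real ^ 'n" and \<iota>
    where \<kappa>: "linear \<kappa>" "linear \<iota>" "\<And>x. \<iota> (\<kappa> x) = x" "\<And>y. \<kappa> (\<iota> y) = y"
    by metis
  have bl: "bounded_linear \<kappa>" "bounded_linear \<iota>" using \<kappa> by (auto simp: linear_conv_bounded_linear)
  have s: "smooth_on S (\<lambda>x. \<kappa> (f x))" by (rule smooth_on_bounded_linear[OF assms(2) bl(1) assms(3)])
  have "frechet_derivative (\<lambda>x. \<kappa> (f x)) (at z) v = \<kappa> (frechet_derivative f (at z) v)" for v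
    using frechet_derivative_bounded_linear[OF bl(1) smooth_on_differentiable[OF assms(3,4)]] by simp
  then have "v = 0" if "frechet_derivative (\<lambda>x. \<kappa> (f x)) (at z) v = 0" for v
    using inj[of v] that \<kappa>(3) linear_0[OF \<kappa>(2)] by metis
  from local_coordinates_if_injective_derivative[OF dim assms(2) s assms(4) this]
  obtain U where U: "U \<subseteq> S" "z \<in> U" "local_coordinates U (\<lambda>x. \<kappa> (f x))" by blast
  let ?F = "\<lambda>x. \<kappa> (f x)"
  have lc: "open U" "inj_on ?F U" "open (?F ` U)" "smooth_on (?F ` U) (inv_into U ?F)"
    using U(3) by (auto simp: local_coordinates_def)
  have im: "f ` U = \<kappa> -` (?F ` U)" using inj_vimage_image_eq[OF inj_on_inverseI[of UNIV \<iota> \<kappa>], of "f ` U"] \<kappa>(3)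
    by (simp add: image_image)
  have oV: "open (f ` U)" unfolding im
    using lc(3) linear_continuous_on[OF bl(1)] by (intro open_vimage) auto
  show thesis
  proof (rule that[OF lc(1) U(2,1) oV refl, of "\<lambda>y. inv_into U ?F (\<kappa> y)"])
    show "smooth_on (f ` U) (\<lambda>y. inv_into U ?F (\<kappa> y))"
      by (rule smooth_on_compose[OF oV lc(3) _ smooth_on_linear[OF oV bl(1)] lc(4)]) auto
    show "inv_into U ?F (\<kappa> (f x)) = x" if "x \<in> U" for x
      by (rule inv_into_f_f[OF lc(2) that])
  qed
qed

lemma orthonormal_frame_3:
  fixes b :: "real ^ 3"
  assumes "norm b = 1"
  obtains m n where "norm m = 1" "norm n = 1" "m \<bullet> b = 0" "n \<bullet> b = 0" "n \<bullet> m = 0"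
    "\<And>x. x = (m \<bullet> x) *\<^sub>R m + (n \<bullet> x) *\<^sub>R n + (b \<bullet> x) *\<^sub>R b"
proof -
  obtain y where y: "y \<noteq> 0" "orthogonal b y"
    using orthogonal_to_vector_exists[of b] by auto
  define m where "m = y /\<^sub>R norm y"
  have m: "norm m = 1" "m \<bullet> b = 0" using y by (auto simp: m_def orthogonal_def inner_commute)
  define n where "n = cross3 b m"
  have n0: "n \<bullet> b = 0" "n \<bullet> m = 0" unfolding n_def by (simp_all add: inner_3 cross3_def algebra_simps)
  have "n \<bullet> n = (b \<bullet> b) * (m \<bullet> m) - (m \<bullet> b)\<^sup>2"
    unfolding n_def by (simp add: inner_3 cross3_def power2_eq_square algebra_simps)
  then have nn: "n \<bullet> n = 1" using m assms by (simp add: norm_eq_1)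
  then have n: "norm n = 1" by (simp add: norm_eq_1)
  have "x = (m \<bullet> x) *\<^sub>R m + (n \<bullet> x) *\<^sub>R n + (b \<bullet> x) *\<^sub>R b" for x
  proof -
    define r where "r = x - ((m \<bullet> x) *\<^sub>R m + (n \<bullet> x) *\<^sub>R n + (b \<bullet> x) *\<^sub>R b)"
    have r: "r \<bullet> m = 0" "r \<bullet> n = 0" "r \<bullet> b = 0"
      using m n0 nn assms
      by (simp_all add: r_def inner_diff_left inner_add_left inner_diff_right inner_add_right norm_eq_1 inner_commute)
    \<comment> \<open>The remainder \<open>r\<close> is orthogonal to \<open>n\<close>, and a
      vanishing cross product makes it parallel to \<open>n\<close> as well; so it is 0.\<close>
    have "cross3 r n = (r \<bullet> m) *\<^sub>R b - (r \<bullet> b) *\<^sub>R m"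
      unfolding n_def by (simp add: vec_eq_iff forall_3 inner_3 cross3_def algebra_simps)
    then have "cross3 r n = 0" using r by simp
    then have "r = 0 \<or> n = 0" using norm_and_cross_eq_0 r(2) by blast
    then show ?thesis using n by (auto simp: r_def)
  qed
  then show thesis using that m n n0 by blast
qed

text \<open>
  \<open>\<Psi>\<close> follows the flow of \<open>B\<close> for the time \<open>l (z - z\<^sub>0)\<close>, starting from the projection of \<open>z\<close> along
  \<open>B z\<^sub>0\<close> to the hyperplane \<open>l (z - z\<^sub>0) = 0\<close>. Its derivative at \<open>z\<^sub>0\<close> is the identity.
\<close>

lemma flow_box:
  fixes B :: "spacetime \<Rightarrow> real ^ 3"
  assumes sB: "smooth B" and b: "B z\<^sub>0 \<noteq> 0"
  obtains U V \<Psi> g where "open U" "z\<^sub>0 \<in> U" "open V" "\<Psi> ` U = V" "smooth_on U \<Psi>" "smooth_on V g"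
    "\<Psi> z\<^sub>0 = z\<^sub>0" "\<And>y. y \<in> U \<Longrightarrow> g (\<Psi> y) = y" "\<And>y. y \<in> U \<Longrightarrow> fst (\<Psi> y) = fst y"
    "\<And>y. y \<in> U \<Longrightarrow> frechet_derivative \<Psi> (at y) (0, B z\<^sub>0) = (0, B (\<Psi> y))"
proof -
  let ?b = "B z\<^sub>0"
  \<comment> \<open>The zero time component keeps the flow inside a time slice, while the slice
    varies with the initial point.\<close>
  define W where "W z = (0::real, B z)" for z
  have sW: "smooth W" unfolding W_def by (rule smooth_on_Pair[OF open_UNIV smooth_on_const[OF open_UNIV] sB])
  obtain a N \<Phi> where a: "a > 0" and N: "open N" "z\<^sub>0 \<in> N" and s\<Phi>: "smooth_on ({-a<..<a} \<times> N) \<Phi>"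
    and eq: "\<And>s z. (s, z) \<in> {-a<..<a} \<times> N \<Longrightarrow> \<Phi> (s, z) = z + int_from_0 (\<lambda>t. W (\<Phi> (t, z))) s"
    and D1: "\<And>q. q \<in> {-a<..<a} \<times> N \<Longrightarrow> frechet_derivative \<Phi> (at q) (1, 0) = W (\<Phi> q)"
    by (rule smooth_local_flow[OF sW, of z\<^sub>0]) (rule that)
  let ?D = "{-a<..<a} \<times> N"
  have oD: "open ?D" using N by (simp add: open_Times)
  have \<Phi>0: "\<Phi> (0, z) = z" if "z \<in> N" for z
    using eq[of 0 z] that a by (simp add: int_from_0_def)
  have \<Phi>fst: "fst (\<Phi> (s, z)) = fst z" if sz: "(s, z) \<in> ?D" for s z
  proof -
    have "continuous_on {-\<bar>s\<bar>..\<bar>s\<bar>} (\<lambda>t. (t, z))" by (intro continuous_on_Pair continuous_on_id continuous_on_const)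
    moreover have "(\<lambda>t. (t, z)) ` {-\<bar>s\<bar>..\<bar>s\<bar>} \<subseteq> ?D" using sz by auto
    ultimately have "continuous_on {-\<bar>s\<bar>..\<bar>s\<bar>} (\<lambda>t. \<Phi> (t, z))"
      by (rule continuous_on_compose2[OF Ck_on_continuous[OF smooth_onD[OF s\<Phi>]]])
    then have "continuous_on {-\<bar>s\<bar>..\<bar>s\<bar>} (\<lambda>t. W (\<Phi> (t, z)))"
      by (rule continuous_on_compose2[OF Ck_on_continuous[OF smooth_onD[OF sW]] _ subset_UNIV])
    then have "continuous_on {0..1} (\<lambda>\<sigma>. W (\<Phi> (s * \<sigma>, z)))"
      by (rule int_from_0_continuous_integrand) auto
    then have "(\<lambda>\<sigma>. W (\<Phi> (s * \<sigma>, z))) integrable_on {0..1}" by (rule integrable_continuous_real)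
    from integral_linear[OF this bounded_linear_fst]
    have "fst (integral {0..1} (\<lambda>\<sigma>. W (\<Phi> (s * \<sigma>, z)))) = integral {0..1} (\<lambda>\<sigma>. fst (W (\<Phi> (s * \<sigma>, z))))"
      by (simp add: o_def)
    also have "\<dots> = 0" by (simp add: W_def)
    finally show ?thesis unfolding eq[OF sz] int_from_0_def by simp
  qed
  \<comment> \<open>Divided by \<open>?b \<bullet> ?b\<close> so that a step along
    \<open>(0, ?b)\<close> advances the flow time by exactly that step.\<close>
  define l where "l v = (?b \<bullet> snd v) / (?b \<bullet> ?b)" for v :: spacetime
  have bl: "bounded_linear l"
    unfolding l_def linear_conv_bounded_linear[symmetric]
    by (rule linearI) (simp_all add: inner_add_right add_divide_distrib)
  have lb: "l (0, ?b) = 1" using b by (simp add: l_def)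
  \<comment> \<open>Splits a displacement into flow time and displacement of the starting point.
    Since \<open>R (0, ?b) = (1, 0)\<close>, the map \<Psi> carries the constant field
    \<open>(0, ?b)\<close> to \<open>(0, B)\<close>.\<close>
  define R where "R v = (l v, v - l v *\<^sub>R (0, ?b))" for v :: spacetime
  have blR: "bounded_linear R"
    unfolding R_def
    by (intro bounded_linear_Pair bl bounded_linear_sub bounded_linear_ident bounded_linear_scaleR_const)
  define \<tau> where "\<tau> z = (0, z\<^sub>0) + R (z - z\<^sub>0)" for z
  have s\<tau>: "smooth \<tau>" unfolding \<tau>_def
    by (intro smooth_on_add[OF open_UNIV] smooth_on_const[OF open_UNIV] smooth_on_bounded_linear[OF open_UNIV blR]
        smooth_on_diff[OF open_UNIV] smooth_on_ident[OF open_UNIV])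
  have D\<tau>: "(\<tau> has_derivative R) (at z)" for z
  proof -
    have "((\<lambda>z. z - z\<^sub>0) has_derivative (\<lambda>v. v)) (at z)" by (auto intro!: derivative_eq_intros)
    from bounded_linear.has_derivative[OF blR this]
    have "((\<lambda>z. R (z - z\<^sub>0)) has_derivative R) (at z)" .
    then show ?thesis unfolding \<tau>_def[abs_def] by (auto intro!: derivative_eq_intros)
  qed
  define S where "S = \<tau> -` ?D"
  have oS: "open S" unfolding S_def
    by (rule open_vimage[OF oD Ck_on_continuous[OF smooth_onD[OF s\<tau>]]])
  have R0: "R 0 = 0" by (simp add: R_def l_def zero_prod_def)
  have \<tau>0: "\<tau> z\<^sub>0 = (0, z\<^sub>0)" by (simp add: \<tau>_def R0)
  have zS: "z\<^sub>0 \<in> S" using a N by (simp add: S_def \<tau>0)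
  define \<Psi> where "\<Psi> z = \<Phi> (\<tau> z)" for z
  have s\<Psi>: "smooth_on S \<Psi>" unfolding \<Psi>_def
    by (rule smooth_on_compose[OF oS oD _ smooth_on_subset[OF s\<tau> subset_UNIV] s\<Phi>]) (auto simp: S_def)
  have D\<Psi>: "frechet_derivative \<Psi> (at y) v = frechet_derivative \<Phi> (at (\<tau> y)) (R v)" if "y \<in> S" for y v
  proof -
    have "\<Phi> differentiable (at (\<tau> y))" using smooth_on_differentiable[OF s\<Phi>] that by (simp add: S_def)
    from frechet_derivative_at[OF has_derivative_compose_frechet[OF this D\<tau>], symmetric]
    show ?thesis unfolding \<Psi>_def[abs_def] by (rule fun_cong)
  qed
  have Rb: "R (0, ?b) = (1, 0)" by (simp add: R_def lb zero_prod_def)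
  have D\<Phi>0: "frechet_derivative \<Phi> (at (0, z\<^sub>0)) (0, w) = w" for w
  proof (rule derivative_along_line_eq[where f = \<Phi> and x = "(0, z\<^sub>0)" and v = "(0, w)"])
    show "(\<Phi> has_derivative frechet_derivative \<Phi> (at (0, z\<^sub>0))) (at (0, z\<^sub>0))"
      by (rule smooth_on_has_derivative[OF s\<Phi>]) (use a N in auto)
    have o: "open ((\<lambda>s. z\<^sub>0 + s *\<^sub>R w) -` N)" by (intro open_vimage[OF N(1)] continuous_intros)
    have d: "((\<lambda>s. z\<^sub>0 + s *\<^sub>R w) has_vector_derivative w) (at 0)"
      by (auto intro!: derivative_eq_intros)
    show "((\<lambda>s. \<Phi> ((0, z\<^sub>0) + s *\<^sub>R (0, w))) has_vector_derivative w) (at 0)"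
      by (rule has_vector_derivative_transform_within_open[OF d o]) (simp_all add: N(2) \<Phi>0)
  qed
  have D\<Psi>0: "frechet_derivative \<Psi> (at z\<^sub>0) v = v" for v
  proof -
    have lin: "linear (frechet_derivative \<Phi> (at (0, z\<^sub>0)))"
      by (rule linear_derivative[OF smooth_on_differentiable[OF s\<Phi>]]) (use a N in auto)
    have "R v = l v *\<^sub>R (1, 0) + (0, v - l v *\<^sub>R (0, ?b))" by (simp add: R_def)
    then have "frechet_derivative \<Psi> (at z\<^sub>0) v = l v *\<^sub>R W (\<Phi> (0, z\<^sub>0)) + (v - l v *\<^sub>R (0, ?b))"
      unfolding D\<Psi>[OF zS] \<tau>0 using D1[of "(0, z\<^sub>0)"] a N
      by (simp only: linear_add[OF lin] linear_cmul[OF lin] D\<Phi>0) auto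
    then show ?thesis using \<Phi>0[OF N(2)] by (simp add: W_def)
  qed
  have dim: "DIM(spacetime) = CARD(4)" by simp
  obtain U V g where U: "open U" "z\<^sub>0 \<in> U" "U \<subseteq> S" "open V" "\<Psi> ` U = V" "smooth_on V g"
    "\<And>x. x \<in> U \<Longrightarrow> g (\<Psi> x) = x"
    by (rule local_inverse[OF dim oS s\<Psi> zS]) (simp add: D\<Psi>0, rule that)
  show thesis
  proof (rule that[OF U(1,2,4,5) smooth_on_subset[OF s\<Psi> U(3)] U(6) _ U(7)])
    show "\<Psi> z\<^sub>0 = z\<^sub>0" using \<Phi>0[OF N(2)] by (simp add: \<Psi>_def \<tau>0)
    show "fst (\<Psi> y) = fst y" if "y \<in> U" for y
    proof -
      have D: "(fst (\<tau> y), snd (\<tau> y)) \<in> ?D" using that U(3) by (auto simp: S_def)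
      show ?thesis using \<Phi>fst[OF D] by (simp add: \<Psi>_def) (simp add: \<tau>_def R_def)
    qed
    show "frechet_derivative \<Psi> (at y) (0, ?b) = (0, B (\<Psi> y))" if "y \<in> U" for y
    proof -
      have "y \<in> S" using that U(3) by blast
      then have "\<tau> y \<in> ?D" by (simp add: S_def)
      then show ?thesis unfolding D\<Psi>[OF \<open>y \<in> S\<close>] Rb using D1 by (simp add: \<Psi>_def W_def)
    qed
  qed
qed

text \<open>\<open>J\<close> is the matrix with columns \<open>b1\<close>, \<open>b2\<close>,
  \<open>b3\<close>. Letting it act in turn on the three entries of the triple product of
  \<open>c\<close>, \<open>m\<close>, \<open>n\<close> and adding up gives the trace of
  \<open>J\<close> times that product; here the trace vanishes.\<close>

lemma trace_identity:
  fixes b1 b2 b3 c m n :: "real ^ 3"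
  defines "J \<equiv> \<lambda>a. a $ 1 *\<^sub>R b1 + (a $ 2 *\<^sub>R b2 + a $ 3 *\<^sub>R b3)"
  assumes "b1 $ 1 + b2 $ 2 + b3 $ 3 = 0"
  shows "J c \<bullet> cross3 m n + c \<bullet> (cross3 m (J n) + cross3 (J m) n) = 0"
proof -
  have b: "b3 $ 3 = - b1 $ 1 - b2 $ 2" using assms(2) by linarith
  show ?thesis
    unfolding J_def inner_3 vector_add_component
    by (simp only: cross3_def vector_3 vector_add_component vector_scaleR_component real_scaleR_def b, algebra)
qed

text \<open>In flow-box coordinates \<open>y = g z\<close> the field is parallel to the constant
  \<open>?b\<close>, and its flux is the density \<open>\<mu>\<close> times the area form of
  \<open>m\<close> and \<open>n\<close>. With \<open>q\<close> the \<open>n\<close>-coordinate and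
  \<open>p\<close> an integral of \<open>\<mu>\<close> in direction \<open>m\<close>, the form dp
  \<and> dq is this flux on every time slice.\<close>

lemma Euler_potentials:
  fixes B :: "spacetime \<Rightarrow> real ^ 3"
  assumes sB: "smooth B" and div0: "\<And>z. divergence B z = 0" and "B z\<^sub>0 \<noteq> 0"
  obtains V p q where "open V" "z\<^sub>0 \<in> V" "smooth_on V p" "smooth_on V q"
    "\<And>z. z \<in> V \<Longrightarrow> B z = cross3 (grad p z) (grad q z)"
proof -
  let ?b = "B z\<^sub>0"
  obtain U0 V0 \<Psi> g where U0: "open U0" "z\<^sub>0 \<in> U0" "open V0" "\<Psi> ` U0 = V0" "smooth_on U0 \<Psi>" "smooth_on V0 g"
    and \<Psi>0: "\<Psi> z\<^sub>0 = z\<^sub>0" and g\<Psi>0: "\<And>y. y \<in> U0 \<Longrightarrow> g (\<Psi> y) = y" and \<Psi>fst0: "\<And>y. y \<in> U0 \<Longrightarrow> fst (\<Psi> y) = fst y"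
    and D\<Psi>b0: "\<And>y. y \<in> U0 \<Longrightarrow> frechet_derivative \<Psi> (at y) (0, ?b) = (0, B (\<Psi> y))"
    by (rule flow_box[OF sB assms(3)]) (rule that)
  \<comment> \<open>A ball around \<open>z\<^sub>0\<close> admits the contraction below, because the
    projection \<open>P\<close> does not increase norms.\<close>
  obtain r where r: "r > 0" "ball z\<^sub>0 r \<subseteq> U0" using U0(1,2) open_contains_ball by blast
  let ?U = "ball z\<^sub>0 r"
  have U: "y \<in> U0" if "y \<in> ?U" for y using r that by blast
  have s\<Psi>: "smooth_on ?U \<Psi>" by (rule smooth_on_subset[OF U0(5) r(2)])
  note g\<Psi> = g\<Psi>0[OF U] and \<Psi>fst = \<Psi>fst0[OF U] and D\<Psi>b = D\<Psi>b0[OF U]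
  have d\<Psi>: "\<Psi> differentiable (at y)" if "y \<in> ?U" for y by (rule smooth_on_differentiable[OF s\<Psi> that])
  let ?D = "\<lambda>y. frechet_derivative \<Psi> (at y)"
  have linD: "linear (?D y)" if "y \<in> ?U" for y by (rule linear_derivative[OF d\<Psi>[OF that]])
  have fstD: "fst (?D y v) = fst v" if y: "y \<in> ?U" for y v
  proof -
    have "(fst has_derivative fst) (at y)" by (rule bounded_linear_imp_has_derivative[OF bounded_linear_fst])
    then have "((\<lambda>y. fst (\<Psi> y)) has_derivative fst) (at y)"
      by (rule has_derivative_transform_within_open[OF _ open_ball y]) (simp add: \<Psi>fst)
    from fun_cong[OF frechet_derivative_at[OF this, symmetric]]
    show ?thesis using frechet_derivative_bounded_linear[OF bounded_linear_fst d\<Psi>[OF y]] by metis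
  qed
  have "norm (?b /\<^sub>R norm ?b) = 1" using assms(3) by simp
  then obtain m n where mn: "norm m = 1" "norm n = 1" "m \<bullet> (?b /\<^sub>R norm ?b) = 0" "n \<bullet> (?b /\<^sub>R norm ?b) = 0" "n \<bullet> m = 0"
    and expand': "\<And>x. x = (m \<bullet> x) *\<^sub>R m + (n \<bullet> x) *\<^sub>R n + ((?b /\<^sub>R norm ?b) \<bullet> x) *\<^sub>R (?b /\<^sub>R norm ?b)"
    by (rule orthonormal_frame_3) (rule that)
  have orth: "m \<bullet> ?b = 0" "n \<bullet> ?b = 0" "n \<bullet> m = 0" "m \<bullet> m = 1" "n \<bullet> n = 1" "m \<bullet> n = 0"
    using mn assms(3) by (auto simp: norm_eq_1 inner_commute)
  define \<gamma> where "\<gamma> x = (?b \<bullet> x) / (norm ?b)\<^sup>2" for x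
  have expand: "x = (m \<bullet> x) *\<^sub>R m + (n \<bullet> x) *\<^sub>R n + \<gamma> x *\<^sub>R ?b" for x
    using expand'[of x] by (simp add: \<gamma>_def power2_eq_square divide_inverse mult_ac)
  have expand_spatial: "v = (m \<bullet> snd v) *\<^sub>R (0, m) + (n \<bullet> snd v) *\<^sub>R (0, n) + \<gamma> (snd v) *\<^sub>R (0, ?b)" if "fst v = 0" for v :: spacetime
    using that expand[of "snd v"] by (simp add: prod_eq_iff)
  \<comment> \<open>the flux density of \<open>B\<close> in the coordinates of the flow box\<close>
  define \<mu> where "\<mu> y = B (\<Psi> y) \<bullet> cross3 (snd (?D y (0, m))) (snd (?D y (0, n)))" for y
  have sB\<Psi>: "smooth_on ?U (\<lambda>y. B (\<Psi> y))"
    by (rule smooth_on_compose[OF open_ball open_UNIV subset_UNIV s\<Psi> sB])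
  have sD: "smooth_on ?U (\<lambda>y. snd (?D y v))" for v
    by (rule smooth_on_snd[OF open_ball smooth_on_derivative[OF s\<Psi>]])
  have s\<mu>: "smooth_on ?U \<mu>" unfolding \<mu>_def
    by (intro smooth_on_inner[OF open_ball] smooth_on_bounded_bilinear[OF open_ball bounded_bilinear_cross3] sB\<Psi> sD)
  \<comment> \<open>Since \<Psi> carries \<open>?b\<close> to \<open>B\<close>, differentiating its
    derivative along \<open>?b\<close> composes that derivative with the derivative of
    \<open>B\<close>. The product rule then produces the three terms of
    \<open>trace_identity\<close>, with the divergence of \<open>B\<close> as the trace.\<close>
  have D\<mu>: "frechet_derivative \<mu> (at y) (0, ?b) = 0" if y: "y \<in> ?U" for y
  proof -
    let ?B = "frechet_derivative B (at (\<Psi> y))"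
    let ?M = "snd (?D y (0, m))" and ?N = "snd (?D y (0, n))"
    have dB: "B differentiable (at x)" for x by (rule smooth_on_differentiable[OF sB UNIV_I])
    have DB\<Psi>: "frechet_derivative (\<lambda>y. B (\<Psi> y)) (at y) v = ?B (?D y v)" for v
      by (rule derivative_compose[OF dB d\<Psi>[OF y]])
    have DD: "frechet_derivative (\<lambda>y. snd (?D y (0, v))) (at y) (0, ?b) = ?B (?D y (0, v))" for v
    proof -
      have dd: "(\<lambda>y. ?D y v) differentiable (at y)" for v
        by (rule smooth_on_differentiable[OF smooth_on_derivative[OF s\<Psi>] y])
      have "frechet_derivative (\<lambda>y. snd (?D y (0, v))) (at y) (0, ?b) = snd (frechet_derivative (\<lambda>y. ?D y (0, v)) (at y) (0, ?b))"
        using frechet_derivative_bounded_linear[OF bounded_linear_snd dd] by metis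
      also have "frechet_derivative (\<lambda>y. ?D y (0, v)) (at y) (0, ?b) = frechet_derivative (\<lambda>y. ?D y (0, ?b)) (at y) (0, v)"
        by (rule second_derivative_commute[OF open_ball smooth_onD[OF s\<Psi>] y])
      also have "snd (frechet_derivative (\<lambda>y. ?D y (0, ?b)) (at y) (0, v)) = frechet_derivative (\<lambda>y. snd (?D y (0, ?b))) (at y) (0, v)"
        using frechet_derivative_bounded_linear[OF bounded_linear_snd dd] by metis
      also have "frechet_derivative (\<lambda>y. snd (?D y (0, ?b))) (at y) = frechet_derivative (\<lambda>y. B (\<Psi> y)) (at y)"
        by (rule frechet_derivative_transform_within_open[OF smooth_on_differentiable[OF sD y] open_ball y]) (simp add: D\<Psi>b)
      finally show ?thesis by (simp add: DB\<Psi>)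
    qed
    have dB\<Psi>: "(\<lambda>y. B (\<Psi> y)) differentiable (at y)" by (rule smooth_on_differentiable[OF sB\<Psi> y])
    have dsD: "(\<lambda>y. snd (?D y v)) differentiable (at y)" for v by (rule smooth_on_differentiable[OF sD y])
    have dcr: "(\<lambda>y. cross3 (snd (?D y (0, m))) (snd (?D y (0, n)))) differentiable (at y)"
      by (rule smooth_on_differentiable[OF smooth_on_bounded_bilinear[OF open_ball bounded_bilinear_cross3 sD sD] y])
    have D\<mu>: "frechet_derivative \<mu> (at y) (0, ?b) = B (\<Psi> y) \<bullet> (cross3 ?M (?B (?D y (0, n))) + cross3 (?B (?D y (0, m))) ?N)
        + ?B (?D y (0, ?b)) \<bullet> cross3 ?M ?N"
      unfolding \<mu>_def[abs_def] derivative_bilinear[OF bounded_bilinear_inner dB\<Psi> dcr]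
        derivative_bilinear[OF bounded_bilinear_cross3 dsD dsD] DD DB\<Psi> ..
    have "?B v = snd v $ 1 *\<^sub>R ?B (0, axis 1 1) + (snd v $ 2 *\<^sub>R ?B (0, axis 2 1) + snd v $ 3 *\<^sub>R ?B (0, axis 3 1))"
      if "fst v = 0" for v
      using spacetime_linear_expand[OF linear_derivative[OF dB], of "\<Psi> y" v] unfolding that by simp
    note Bv = this
    have "fst (?D y (0, v)) = 0" for v using fstD[OF y, of "(0, v)"] by simp
    note Bv = Bv[OF this]
    have "snd (?D y (0, ?b)) = B (\<Psi> y)" by (simp add: D\<Psi>b[OF y])
    with D\<mu> show ?thesis
      using trace_identity[of "?B (0, axis 1 1)" "?B (0, axis 2 1)" "?B (0, axis 3 1)" "B (\<Psi> y)" ?M ?N]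
        div0[of "\<Psi> y"] unfolding divergence_eq[OF dB] by (simp only: Bv) (simp add: add.commute)
  qed
  \<comment> \<open>\<open>P\<close> keeps the time and the \<open>n\<close>-coordinate, which
    become parameters; its kernel is spanned by \<open>m\<close> and \<open>?b\<close>. There the
    one-form \<open>\<omega>\<close> is closed because \<open>\<mu>\<close> is constant along
    \<open>?b\<close>.\<close>
  define P where "P v = (fst v, (n \<bullet> snd v) *\<^sub>R n)" for v :: spacetime
  have blP: "bounded_linear P" unfolding P_def linear_conv_bounded_linear[symmetric]
    by (rule linearI) (simp_all add: inner_add_right scaleR_add_left)
  interpret P: bounded_linear P by (rule blP)
  have PP: "P (P v) = P v" for v by (simp add: P_def orth)
  have P0: "P v = 0 \<longleftrightarrow> fst v = 0 \<and> n \<bullet> snd v = 0" for v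
    using mn(2) by (auto simp: P_def zero_prod_def)
  have normP: "norm (P v) \<le> norm v" for v
  proof -
    have "\<bar>n \<bullet> snd v\<bar> \<le> norm (snd v)" using Cauchy_Schwarz_ineq2[of n "snd v"] mn(2) by simp
    then have "(n \<bullet> snd v)\<^sup>2 \<le> (norm (snd v))\<^sup>2" by (simp add: abs_le_square_iff[symmetric])
    then show ?thesis using mn(2) by (cases v) (simp add: P_def norm_Pair)
  qed
  \<comment> \<open>Chosen so that \<open>c + P z\<^sub>0 = z\<^sub>0\<close>; then base points of
    the fibres through the ball lie in the ball.\<close>
  define c where "c = z\<^sub>0 - P z\<^sub>0"
  have Pc: "P c = 0" by (simp add: c_def P.diff PP)
  have star: "c + P y + t *\<^sub>R (y - (c + P y)) \<in> ?U" if "y \<in> ?U" "t \<in> {0..1}" for y t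
  proof -
    have eq: "c + P y = z\<^sub>0 + P (y - z\<^sub>0)" by (simp add: c_def P.diff)
    have "dist z\<^sub>0 (z\<^sub>0 + P (y - z\<^sub>0)) \<le> norm (y - z\<^sub>0)" using normP[of "y - z\<^sub>0"] by (simp add: dist_norm)
    then have "c + P y \<in> ?U" using that(1) unfolding eq by (simp add: dist_norm norm_minus_commute)
    moreover have "c + P y + t *\<^sub>R (y - (c + P y)) = (1 - t) *\<^sub>R (c + P y) + t *\<^sub>R y" by (simp add: algebra_simps)
    ultimately show ?thesis using that convexD_alt[OF convex_ball, of "c + P y" z\<^sub>0 r y t] by simp
  qed
  define \<omega> where "\<omega> y v = \<mu> y * (m \<bullet> snd v)" for y v :: spacetime
  have s\<omega>: "smooth_on ?U (\<lambda>y. \<omega> y v)" for v unfolding \<omega>_def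
    by (rule smooth_on_mult[OF open_ball s\<mu> smooth_on_const[OF open_ball]])
  have lin\<omega>: "linear (\<omega> y)" for y unfolding \<omega>_def by (rule linearI) (simp_all add: inner_add_right algebra_simps)
  have d\<mu>: "\<mu> differentiable (at y)" if "y \<in> ?U" for y by (rule smooth_on_differentiable[OF s\<mu> that])
  have D\<omega>: "frechet_derivative (\<lambda>y. \<omega> y v) (at y) w = frechet_derivative \<mu> (at y) w * (m \<bullet> snd v)" if "y \<in> ?U" for y v w
    unfolding \<omega>_def
    using frechet_derivative_bounded_linear[OF bounded_linear_mult_left d\<mu>[OF that], of "m \<bullet> snd v"] by metis
  have D\<mu>_ker: "frechet_derivative \<mu> (at y) w = (m \<bullet> snd w) * frechet_derivative \<mu> (at y) (0, m)" if y: "y \<in> ?U" and w: "P w = 0" for y w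
  proof -
    note lin = linear_derivative[OF d\<mu>[OF y]]
    have "w = (m \<bullet> snd w) *\<^sub>R (0, m) + \<gamma> (snd w) *\<^sub>R (0, ?b)"
      using expand_spatial[of w] w unfolding P0 by simp
    then have "frechet_derivative \<mu> (at y) w = frechet_derivative \<mu> (at y) ((m \<bullet> snd w) *\<^sub>R (0, m) + \<gamma> (snd w) *\<^sub>R (0, ?b))"
      by (rule arg_cong)
    then show ?thesis by (simp only: linear_add[OF lin] linear_cmul[OF lin] D\<mu>[OF y]) simp
  qed
  have closed: "frechet_derivative (\<lambda>y. \<omega> y v) (at y) w = frechet_derivative (\<lambda>y. \<omega> y w) (at y) v"
    if "y \<in> ?U" "P v = 0" "P w = 0" for y v w
    unfolding D\<omega>[OF that(1)] D\<mu>_ker[OF that(1,2)] D\<mu>_ker[OF that(1,3)] by simp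
  let ?F = "\<lambda>z. integral {0..1} (\<lambda>t. \<omega> (c + P z + t *\<^sub>R (z - (c + P z))) (z - (c + P z)))"
  obtain F where F: "smooth_on ?U F" "\<And>z w. z \<in> ?U \<Longrightarrow> P w = 0 \<Longrightarrow> frechet_derivative F (at z) w = \<omega> z w"
    by (rule that[of ?F])
      (rule relative_Poincare[OF open_ball blP PP Pc star s\<omega> lin\<omega> closed]; assumption)+
  define V where "V = V0 \<inter> g -` ?U"
  have oV: "open V" unfolding V_def
    using continuous_open_preimage[OF Ck_on_continuous[OF smooth_onD[OF U0(6)]] U0(3) open_ball] .
  have "\<Psi> z\<^sub>0 \<in> V0" using U0(2,4) by blast
  then have zV: "z\<^sub>0 \<in> V" using g\<Psi>0[OF U0(2)] \<Psi>0 r(1) by (simp add: V_def)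
  have sg: "smooth_on V g" using U0(6) by (rule smooth_on_subset) (simp add: V_def)
  have gU: "g z \<in> ?U" if "z \<in> V" for z using that by (simp add: V_def)
  have \<Psi>g: "\<Psi> (g z) = z" if "z \<in> V" for z
  proof -
    have "z \<in> \<Psi> ` U0" using that U0(4) by (simp add: V_def)
    then obtain y where "y \<in> U0" "z = \<Psi> y" by blast
    then show ?thesis using g\<Psi>0 by simp
  qed
  have dg: "g differentiable (at z)" if "z \<in> V" for z by (rule smooth_on_differentiable[OF sg that])
  have DD: "?D (g z) (frechet_derivative g (at z) v) = v" if z: "z \<in> V" for z v
  proof -
    have "((\<lambda>z. z) has_derivative (\<lambda>v. v)) (at z)" by (rule has_derivative_ident)
    then have "((\<lambda>z. \<Psi> (g z)) has_derivative (\<lambda>v. v)) (at z)"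
      by (rule has_derivative_transform_within_open[OF _ oV z]) (simp add: \<Psi>g)
    from fun_cong[OF frechet_derivative_at[OF this, symmetric], of v]
    show ?thesis unfolding derivative_compose[OF d\<Psi>[OF gU[OF z]] dg[OF z]] .
  qed
  define p q where "p z = F (g z)" and "q z = n \<bullet> snd (g z)" for z
  have sp: "smooth_on V p" unfolding p_def
    by (rule smooth_on_compose[OF oV open_ball _ sg F(1)]) (use gU in blast)
  have sq: "smooth_on V q" unfolding q_def
    by (rule smooth_on_inner[OF oV smooth_on_const[OF oV] smooth_on_snd[OF oV sg]])
  \<comment> \<open>After expansion in \<open>m\<close>, \<open>n\<close> and \<open>?b\<close> the
    \<open>?b\<close>-parts drop out on both sides: \<Psi> carries \<open>?b\<close> to
    \<open>B z\<close> itself, and neither \<open>F\<close> nor the \<open>n\<close>-coordinate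
    changes along \<open>?b\<close>.\<close>
  have form: "B z \<bullet> cross3 v w = frechet_derivative p (at z) (0, v) * frechet_derivative q (at z) (0, w)
      - frechet_derivative p (at z) (0, w) * frechet_derivative q (at z) (0, v)" if z: "z \<in> V" for z v w
  proof -
    let ?g = "frechet_derivative g (at z)" and ?y = "g z"
    let ?F = "frechet_derivative F (at ?y)"
    note y = gU[OF z]
    have linF: "linear ?F" by (rule linear_derivative[OF smooth_on_differentiable[OF F(1) y]])
    have Dp: "frechet_derivative p (at z) x = ?F (?g x)" for x
      unfolding p_def[abs_def] by (rule derivative_compose[OF smooth_on_differentiable[OF F(1) y] dg[OF z]])
    have bl: "bounded_linear (\<lambda>x::spacetime. n \<bullet> snd x)"
      by (rule bounded_linear_compose[OF bounded_linear_inner_right bounded_linear_snd])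
    have Dq: "frechet_derivative q (at z) x = n \<bullet> snd (?g x)" for x
      unfolding q_def[abs_def] using frechet_derivative_bounded_linear[OF bl dg[OF z]] by metis
    have fg: "fst (?g (0, x)) = 0" for x
      using fstD[OF y, of "?g (0, x)"] unfolding DD[OF z] by simp
    have Fm: "?F (0, m) = \<mu> ?y" "?F (0, ?b) = 0"
      using F(2)[OF y, of "(0, m)"] F(2)[OF y, of "(0, ?b)"] by (simp_all add: P0 \<omega>_def orth)
    have F_expand: "?F x = (m \<bullet> snd x) * \<mu> ?y + (n \<bullet> snd x) * ?F (0, n)" if "fst x = 0" for x
    proof -
      from arg_cong[OF expand_spatial[OF that], of ?F]
      show ?thesis by (simp only: linear_add[OF linF] linear_cmul[OF linF] Fm) simp
    qed
    have D_expand: "snd (?D ?y x) = (m \<bullet> snd x) *\<^sub>R snd (?D ?y (0, m)) + (n \<bullet> snd x) *\<^sub>R snd (?D ?y (0, n)) + \<gamma> (snd x) *\<^sub>R B z"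
      if "fst x = 0" for x
    proof -
      from arg_cong[OF expand_spatial[OF that], of "\<lambda>x. snd (?D ?y x)"]
      show ?thesis
        by (simp only: linear_add[OF linD[OF y]] linear_cmul[OF linD[OF y]] D\<Psi>b[OF y] \<Psi>g[OF z] snd_add snd_scaleR snd_conv)
    qed
    define v' w' where "v' = ?g (0, v)" "w' = ?g (0, w)"
    note vw = this
    have f0: "fst v' = 0" "fst w' = 0" unfolding vw by (rule fg)+
    define M N where "M = snd (?D ?y (0, m))" "N = snd (?D ?y (0, n))"
    note MN = this
    have v: "v = (m \<bullet> snd v') *\<^sub>R M + (n \<bullet> snd v') *\<^sub>R N + \<gamma> (snd v') *\<^sub>R B z"
      using D_expand[OF f0(1)] unfolding vw DD[OF z] MN by simp
    have w: "w = (m \<bullet> snd w') *\<^sub>R M + (n \<bullet> snd w') *\<^sub>R N + \<gamma> (snd w') *\<^sub>R B z"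
      using D_expand[OF f0(2)] unfolding vw DD[OF z] MN by simp
    have mu: "\<mu> ?y = B z \<bullet> cross3 M N" by (simp add: \<mu>_def MN \<Psi>g[OF z])
    have tri: "b \<bullet> cross3 (\<alpha> *\<^sub>R M + \<nu> *\<^sub>R N + s *\<^sub>R b) (\<alpha>' *\<^sub>R M + \<nu>' *\<^sub>R N + s' *\<^sub>R b)
        = (\<alpha> * \<nu>' - \<alpha>' * \<nu>) * (b \<bullet> cross3 M N)" for b :: "real ^ 3" and \<alpha> \<nu> s \<alpha>' \<nu>' s'
      unfolding inner_3
      by (simp only: cross3_def vector_3 vector_add_component vector_scaleR_component real_scaleR_def, algebra)
    have "B z \<bullet> cross3 v w = ((m \<bullet> snd v') * (n \<bullet> snd w') - (m \<bullet> snd w') * (n \<bullet> snd v')) * \<mu> ?y"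
      unfolding mu by (subst v, subst w, rule tri)
    then show ?thesis
      unfolding Dp Dq vw[symmetric] F_expand[OF f0(1)] F_expand[OF f0(2)] by (simp add: algebra_simps)
  qed
  show thesis
  proof (rule that[OF oV zV sp sq])
    fix z assume z: "z \<in> V"
    note gr = grad_nth[OF smooth_on_differentiable[OF sp z]] grad_nth[OF smooth_on_differentiable[OF sq z]]
    have "B z \<bullet> cross3 (axis 2 1) (axis 3 1) = B z $ 1" "B z \<bullet> cross3 (axis 3 1) (axis 1 1) = B z $ 2"
      "B z \<bullet> cross3 (axis 1 1) (axis 2 1) = B z $ 3"
      by (simp_all add: inner_3 cross3_def axis_def)
    then show "B z = cross3 (grad p z) (grad q z)"
      using form[OF z, of "axis 2 1" "axis 3 1"] form[OF z, of "axis 3 1" "axis 1 1"] form[OF z, of "axis 1 1" "axis 2 1"]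
      unfolding vec_eq_iff forall_3 by (simp add: cross3_def gr)
  qed
qed

lemma wedge_differential_apply:
  "(wedge 1 1 (differential p) (differential q) + wedge 1 1 (differential h) dt) z v =
    frechet_derivative p (at z) (v 0) * frechet_derivative q (at z) (v 1)
    - frechet_derivative p (at z) (v 1) * frechet_derivative q (at z) (v 0)
    + (frechet_derivative h (at z) (v 0) * fst (v 1) - frechet_derivative h (at z) (v 1) * fst (v 0))"
proof -
  have "wedge 1 1 (differential p) (differential q) z v =
    frechet_derivative p (at z) (v 0) * frechet_derivative q (at z) (v 1)
    - frechet_derivative p (at z) (v 1) * frechet_derivative q (at z) (v 0)"
    by (rule wedge_1_1) (rule differential_apply)+
  moreover have "wedge 1 1 (differential h) dt z v =
    frechet_derivative h (at z) (v 0) * fst (v 1) - frechet_derivative h (at z) (v 1) * fst (v 0)"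
    by (rule wedge_1_1) (rule differential_apply dt_apply)+
  ultimately show ?thesis unfolding plus_fun_apply by simp
qed

text \<open>Comparing the dx \<and> dt coefficients of \<Omega> and dp \<and> dq + dh \<and> dt
  forces \<open>G\<close> to be the spatial gradient of \<open>h\<close>. Its curl vanishes because
  the time derivative of the product of gradients is the curl of \<open>E\<close>.\<close>

lemma curl_cross_grads:
  assumes V: "open V" "smooth_on V p" "smooth_on V q" "z \<in> V"
    and B: "\<And>z. z \<in> V \<Longrightarrow> B z = cross3 (grad p z) (grad q z)"
    and sE: "smooth E" and curl: "frechet_derivative B (at z) (1, 0) = curl E z"
  defines "G \<equiv> \<lambda>z. - E z - frechet_derivative q (at z) (1, 0) *\<^sub>R grad p z + frechet_derivative p (at z) (1, 0) *\<^sub>R grad q z"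
  shows "smooth_on V G"
    and "frechet_derivative G (at z) (0, axis j 1) $ i = frechet_derivative G (at z) (0, axis i 1) $ j"
proof -
  let ?pt = "\<lambda>z. frechet_derivative p (at z) (1, 0)" and ?qt = "\<lambda>z. frechet_derivative q (at z) (1, 0)"
  have sE': "smooth_on V E" by (rule smooth_on_subset[OF sE subset_UNIV])
  have sp: "smooth_on V (grad p)" and sq: "smooth_on V (grad q)"
    by (rule smooth_on_grad[OF V(1,2)], rule smooth_on_grad[OF V(1,3)])
  have spt: "smooth_on V ?pt" and sqt: "smooth_on V ?qt"
    by (rule smooth_on_derivative[OF V(2)], rule smooth_on_derivative[OF V(3)])
  show "smooth_on V G" unfolding G_def
    by (intro smooth_on_add[OF V(1)] smooth_on_diff[OF V(1)] smooth_on_minus[OF V(1)] smooth_on_scaleR[OF V(1)] sE' sp sq spt sqt)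
  note d = smooth_on_differentiable[OF sE' V(4)] smooth_on_differentiable[OF sp V(4)] smooth_on_differentiable[OF sq V(4)]
    smooth_on_differentiable[OF spt V(4)] smooth_on_differentiable[OF sqt V(4)]
  let ?D = "\<lambda>f. frechet_derivative f (at z)"
  have "(G has_derivative (\<lambda>v. - ?D E v - (?qt z *\<^sub>R ?D (grad p) v + ?D ?qt v *\<^sub>R grad p z)
      + (?pt z *\<^sub>R ?D (grad q) v + ?D ?pt v *\<^sub>R grad q z))) (at z)"
    unfolding G_def using d
    by (intro has_derivative_add has_derivative_diff has_derivative_minus has_derivative_scaleR)
      (auto simp: frechet_derivative_works)
  note DG = fun_cong[OF frechet_derivative_at[OF this, symmetric]]
  have dB: "?D B (1, 0) = cross3 (grad p z) (?D (grad q) (1, 0)) + cross3 (?D (grad p) (1, 0)) (grad q z)"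
  proof -
    have "(\<lambda>w. cross3 (grad p w) (grad q w)) differentiable (at z)"
      by (rule smooth_on_differentiable[OF smooth_on_bounded_bilinear[OF V(1) bounded_bilinear_cross3 sp sq] V(4)])
    then have "?D (\<lambda>w. cross3 (grad p w) (grad q w)) = ?D B"
      by (rule frechet_derivative_transform_within_open[OF _ V(1,4)]) (simp add: B)
    then show ?thesis using derivative_bilinear[OF bounded_bilinear_cross3 d(2,3), of "(1, 0)"] by simp
  qed
  have pt: "?D ?pt (0, axis i 1) = ?D (grad p) (1, 0) $ i" for i
    by (rule derivative_grad_nth[OF V(1,2,4), symmetric])
  have qt: "?D ?qt (0, axis i 1) = ?D (grad q) (1, 0) $ i" for i
    by (rule derivative_grad_nth[OF V(1,3,4), symmetric])
  note sym = derivative_grad_symmetric[OF V(1,2,4)] derivative_grad_symmetric[OF V(1,3,4)]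
  define gp gq gpt gqt where "gp = grad p z" "gq = grad q z" "gpt = ?D (grad p) (1, 0)" "gqt = ?D (grad q) (1, 0)"
  note gdefs = this
  have c: "?D E (0, axis 2 1) $ 3 - ?D E (0, axis 3 1) $ 2 = (cross3 gp gqt + cross3 gpt gq) $ 1"
    "?D E (0, axis 3 1) $ 1 - ?D E (0, axis 1 1) $ 3 = (cross3 gp gqt + cross3 gpt gq) $ 2"
    "?D E (0, axis 1 1) $ 2 - ?D E (0, axis 2 1) $ 1 = (cross3 gp gqt + cross3 gpt gq) $ 3"
    unfolding gdefs dB[symmetric] curl curl_eq[OF d(1)] by simp_all
  have "\<forall>i j. ?D G (0, axis j 1) $ i = ?D G (0, axis i 1) $ j"
    unfolding forall_3 DG pt qt gdefs[symmetric]
    using c sym(1)[of 1 2] sym(1)[of 1 3] sym(1)[of 2 3] sym(2)[of 1 2] sym(2)[of 1 3] sym(2)[of 2 3]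
    by (simp add: cross3_def algebra_simps)
  then show "?D G (0, axis j 1) $ i = ?D G (0, axis i 1) $ j" by blast
qed

section \<open>Local existence of the coordinates \<open>q\<close>, \<open>p\<close>,
  \<open>t\<close>, \<open>h\<close>\<close>

context
  fixes u B :: "spacetime \<Rightarrow> real ^ 3" and \<phi> :: "spacetime \<Rightarrow> real"
  assumes su: "smooth u" and sB: "smooth B" and s\<phi>: "smooth \<phi>"
    and div0: "\<And>z. divergence B z = 0"
    and frozen: "\<And>z. time_deriv B z - curl (\<lambda>w. cross3 (u w) (B w)) z = 0"
    and advected: "\<And>z. time_deriv \<phi> z + advect u \<phi> z = 0"
    and transversal: "\<And>z. B z \<bullet> grad \<phi> z \<noteq> 0"
begin

private lemmas fields = su sB s\<phi> div0 frozen advected transversal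

lemma local_Darboux: "\<exists>U q p h. z\<^sub>0 \<in> U \<and> darboux_coordinates (Omega u B \<phi>) U q p h"
proof -
  let ?E = "electric_field u B \<phi>"
  have "B z\<^sub>0 \<noteq> 0" using transversal[of z\<^sub>0] by auto
  then obtain V0 p q where V0: "open V0" "z\<^sub>0 \<in> V0" "smooth_on V0 p" "smooth_on V0 q"
    "\<And>z. z \<in> V0 \<Longrightarrow> B z = cross3 (grad p z) (grad q z)"
    by (rule Euler_potentials[OF sB div0]) (rule that)
  obtain r where r: "r > 0" "ball z\<^sub>0 r \<subseteq> V0" using V0(1,2) open_contains_ball by blast
  let ?V = "ball z\<^sub>0 r"
  have sp: "smooth_on ?V p" and sq: "smooth_on ?V q" using V0(3,4) r(2) by (auto intro: smooth_on_subset)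
  have B: "B z = cross3 (grad p z) (grad q z)" if "z \<in> ?V" for z using V0(5) r(2) that by blast
  have sE: "smooth ?E" by (rule smooth_electric_field[OF fields])
  have curlE: "frechet_derivative B (at z) (1, 0) = curl ?E z" for z by (rule curl_electric_field[OF fields])
  define G where "G z = - ?E z - frechet_derivative q (at z) (1, 0) *\<^sub>R grad p z + frechet_derivative p (at z) (1, 0) *\<^sub>R grad q z" for z
  have zV: "z\<^sub>0 \<in> ?V" using r by simp
  \<comment> \<open>Shrinking the spatial displacement at fixed time cannot increase the distance to
    the centre.\<close>
  have star: "(t, snd z\<^sub>0 + \<tau> *\<^sub>R (x - snd z\<^sub>0)) \<in> ?V" if "(t, x) \<in> ?V" "\<tau> \<in> {0..1}" for t x \<tau>
  proof -
    have "\<tau> * norm (x - snd z\<^sub>0) \<le> 1 * norm (x - snd z\<^sub>0)" using that by (intro mult_right_mono) auto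
    then have "(\<tau> * norm (x - snd z\<^sub>0))\<^sup>2 \<le> (norm (x - snd z\<^sub>0))\<^sup>2"
      using that by (intro power_mono) auto
    then have "norm (t - fst z\<^sub>0, \<tau> *\<^sub>R (x - snd z\<^sub>0)) \<le> norm (t - fst z\<^sub>0, x - snd z\<^sub>0)"
      by (simp add: norm_Pair power_mult_distrib)
    moreover have "norm (t - fst z\<^sub>0, x - snd z\<^sub>0) < r"
      using that(1) unfolding mem_ball dist_commute[of z\<^sub>0] unfolding dist_norm by (simp add: minus_prod_def)
    moreover have "dist z\<^sub>0 (t, snd z\<^sub>0 + \<tau> *\<^sub>R (x - snd z\<^sub>0)) = norm (t - fst z\<^sub>0, \<tau> *\<^sub>R (x - snd z\<^sub>0))"
      unfolding dist_commute[of z\<^sub>0] unfolding dist_norm by (simp add: minus_prod_def)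
    ultimately show ?thesis by simp
  qed
  obtain h where h: "smooth_on ?V h" "\<And>z. z \<in> ?V \<Longrightarrow> grad h z = G z"
  proof (rule spatial_potential[of ?V G "snd z\<^sub>0"])
    show "smooth_on ?V G" unfolding G_def
      by (rule curl_cross_grads(1)[OF open_ball sp sq zV B sE curlE])
    show "frechet_derivative G (at z) (0, axis j 1) $ i = frechet_derivative G (at z) (0, axis i 1) $ j" if "z \<in> ?V" for z i j
      unfolding G_def by (rule curl_cross_grads(2)[OF open_ball sp sq that B sE curlE])
  qed (use star in auto)
  have form: "omega_at (?E z) (B z) x y =
      frechet_derivative p (at z) x * frechet_derivative q (at z) y - frechet_derivative p (at z) y * frechet_derivative q (at z) x
      + (frechet_derivative h (at z) x * fst y - frechet_derivative h (at z) y * fst x)" if z: "z \<in> ?V" for z x y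
  proof -
    note d = smooth_on_differentiable[OF sp z] smooth_on_differentiable[OF sq z] smooth_on_differentiable[OF h(1) z]
    note ex = derivative_eq_grad[OF d(1)] derivative_eq_grad[OF d(2)] derivative_eq_grad[OF d(3)]
    define pt qt ht where "pt = frechet_derivative p (at z) (1, 0)" "qt = frechet_derivative q (at z) (1, 0)"
      "ht = frechet_derivative h (at z) (1, 0)"
    note tdefs = this
    define gp gq e where "gp = grad p z" "gq = grad q z" "e = ?E z"
    note gdefs = this
    have gh: "grad h z = - e - qt *\<^sub>R gp + pt *\<^sub>R gq" unfolding h(2)[OF z] G_def tdefs gdefs ..
    obtain s a where x: "x = (s, a)" by (rule prod.exhaust)
    obtain t b where y: "y = (t, b)" by (rule prod.exhaust)
    show ?thesis
      unfolding ex[of x] ex[of y] B[OF z]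
      unfolding tdefs[symmetric] gh
      unfolding gdefs[symmetric] x y omega_at_def fst_conv snd_conv inner_3
      by (simp only: cross3_def vector_3 vector_add_component vector_minus_component vector_uminus_component vector_scaleR_component real_scaleR_def, algebra)
  qed
  let ?f = "\<lambda>z. vector [q z, p z, fst z, h z] :: real ^ 4"
  have nth: "(\<lambda>z. ?f z $ 1) = q" "(\<lambda>z. ?f z $ 2) = p" "(\<lambda>z. ?f z $ 3) = fst" "(\<lambda>z. ?f z $ 4) = h"
    by (simp_all add: vector_4)
  have sf: "smooth_on ?V ?f"
  proof (rule smooth_on_vec[OF open_ball])
    fix i :: 4
    have "\<forall>i::4. smooth_on ?V (\<lambda>z. ?f z $ i)"
      unfolding forall_4 nth using sp sq h(1) smooth_on_linear[OF open_ball bounded_linear_fst] by blast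
    then show "smooth_on ?V (\<lambda>z. ?f z $ i)" by blast
  qed
  \<comment> \<open>By \<open>form\<close>, a vector annihilated by all four coordinate
    differentials lies in the kernel of \<Omega>, so nondegeneracy makes it 0.\<close>
  have "v = 0" if v: "frechet_derivative ?f (at z\<^sub>0) v = 0" for v
  proof (rule nondegenerate_omega_at[OF fields, of z\<^sub>0])
    have "frechet_derivative (\<lambda>z. ?f z $ i) (at z\<^sub>0) v = 0" for i
      unfolding derivative_nth[OF smooth_on_differentiable[OF sf zV]] v by simp
    from this[of 1] this[of 2] this[of 3] this[of 4]
    have "frechet_derivative q (at z\<^sub>0) v = 0" "frechet_derivative p (at z\<^sub>0) v = 0" "fst v = 0" "frechet_derivative h (at z\<^sub>0) v = 0"
      unfolding nth frechet_derivative_bounded_linear_self[OF bounded_linear_fst] by blast+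
    then show "omega_at (?E z\<^sub>0) (B z\<^sub>0) v y = 0" for y
      unfolding form[OF zV] by simp
  qed
  moreover have "DIM(spacetime) = CARD(4)" by simp
  ultimately obtain U where U: "U \<subseteq> ?V" "z\<^sub>0 \<in> U" "local_coordinates U ?f"
    using local_coordinates_if_injective_derivative[OF _ open_ball sf zV] by blast
  have "Omega u B \<phi> z = (wedge 1 1 (differential p) (differential q) + wedge 1 1 (differential h) dt) z" if "z \<in> U" for z
  proof
    fix v
    have z: "z \<in> ?V" using that U(1) by blast
    show "Omega u B \<phi> z v = (wedge 1 1 (differential p) (differential q) + wedge 1 1 (differential h) dt) z v"
      unfolding wedge_differential_apply Omega_eq_omega_at[OF fields] form[OF z] ..
  qed
  then have "darboux_coordinates (Omega u B \<phi>) U q p h"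
    unfolding darboux_coordinates_def using U(3) by blast
  then show ?thesis using U(2) by blast
qed

end

section \<open>The generating function and the Clebsch representation\<close>

context
  fixes u B A :: "spacetime \<Rightarrow> real ^ 3" and \<phi> \<psi> :: "spacetime \<Rightarrow> real"
    and U :: "spacetime set" and q p h :: "spacetime \<Rightarrow> real"
  assumes su: "smooth u" and sB: "smooth B" and s\<phi>: "smooth \<phi>" and sA: "smooth A"
    and frozen: "\<And>z. time_deriv B z - curl (\<lambda>w. cross3 (u w) (B w)) z = 0"
    and BA: "\<And>z. B z = curl A z"
    and \<psi>: "smooth \<psi>" "potential_equation u A \<phi> \<psi>"
    and darboux: "darboux_coordinates (Omega u B \<phi>) U q p h"
begin

private lemma coordinates: "open U" "smooth_on U q" "smooth_on U p" "smooth_on U h"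
proof -
  let ?f = "\<lambda>z. vector [q z, p z, fst z, h z] :: real ^ 4"
  have U: "open U" "smooth_on U ?f" using darboux by (auto simp: darboux_coordinates_def local_coordinates_def)
  then show "open U" by blast
  have "smooth_on U (\<lambda>z. ?f z $ i)" for i by (rule smooth_on_vec_nth[OF U])
  from this[of 1] this[of 2] this[of 4] show "smooth_on U q" "smooth_on U p" "smooth_on U h"
    by (simp_all add: vector_4)
qed

private lemma coordinates_differentiable:
  assumes "z \<in> U" shows "q differentiable (at z)" "p differentiable (at z)" "h differentiable (at z)"
  using smooth_on_differentiable[OF coordinates(2) assms] smooth_on_differentiable[OF coordinates(3) assms]
    smooth_on_differentiable[OF coordinates(4) assms] .

private definition "\<omega> z x = - (p z * frechet_derivative q (at z) x + h z * fst x) + (\<psi> z * fst x + A z \<bullet> snd x)"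

private lemma theta_difference_apply: "(theta_can q p h - theta \<psi> A) z v = \<omega> z (v 0)"
  by (simp add: fun_diff_def theta_can_apply theta_apply \<omega>_def)

lemma generating_function_exists:
  assumes "simply_connected U"
  shows "\<exists>s. generating_function U (theta_can q p h) (theta \<psi> A) s"
proof -
  have dq: "(\<lambda>z. frechet_derivative q (at z) x) differentiable (at z)" if "z \<in> U" for x z
    by (rule smooth_on_differentiable[OF smooth_on_derivative[OF coordinates(2)] that])
  have D\<omega>: "frechet_derivative (\<lambda>w. \<omega> w x) (at z) y =
      - (p z * frechet_derivative (\<lambda>w. frechet_derivative q (at w) x) (at z) y + frechet_derivative p (at z) y * frechet_derivative q (at z) x
        + frechet_derivative h (at z) y * fst x)
      + (frechet_derivative \<psi> (at z) y * fst x + frechet_derivative A (at z) y \<bullet> snd x)" if z: "z \<in> U" for x y z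
  proof -
    note d = coordinates_differentiable[OF z] dq[OF z, of x] smooth_on_differentiable[OF \<psi>(1) UNIV_I, of z]
      smooth_on_differentiable[OF sA UNIV_I, of z]
    have "((\<lambda>w. \<omega> w x) has_derivative (\<lambda>y.
      - (p z * frechet_derivative (\<lambda>w. frechet_derivative q (at w) x) (at z) y + frechet_derivative p (at z) y * frechet_derivative q (at z) x
        + frechet_derivative h (at z) y * fst x)
      + (frechet_derivative \<psi> (at z) y * fst x + frechet_derivative A (at z) y \<bullet> snd x))) (at z)"
      unfolding \<omega>_def using d
      by (intro has_derivative_minus has_derivative_add has_derivative_mult has_derivative_mult_left has_derivative_inner_left)
        (auto simp: frechet_derivative_works)
    from fun_cong[OF frechet_derivative_at[OF this, symmetric]] show ?thesis .
  qed
  \<comment> \<open>The second derivatives of \<open>q\<close> are symmetric; the remaining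
    antisymmetric part is the difference of dp \<and> dq + dh \<and> dt and \<Omega>, which vanishes
    in Darboux coordinates.\<close>
  have closed: "frechet_derivative (\<lambda>w. \<omega> w x) (at z) y = frechet_derivative (\<lambda>w. \<omega> w y) (at z) x" if z: "z \<in> U" for x y z
  proof -
    have "frechet_derivative (\<lambda>w. frechet_derivative q (at w) x) (at z) y = frechet_derivative (\<lambda>w. frechet_derivative q (at w) y) (at z) x"
      by (rule second_derivative_commute[OF coordinates(1) smooth_onD[OF coordinates(2)] z])
    moreover have "Omega u B \<phi> z (case_nat y (\<lambda>_. x)) = (wedge 1 1 (differential p) (differential q) + wedge 1 1 (differential h) dt) z (case_nat y (\<lambda>_. x))"
      using darboux z unfolding darboux_coordinates_def by simp
    note this[unfolded wedge_differential_apply Omega_apply derivative_theta[OF su sB s\<phi> sA frozen BA \<psi>, symmetric]]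
    ultimately show ?thesis unfolding D\<omega>[OF z] by simp
  qed
  have s\<omega>: "smooth_on U (\<lambda>z. \<omega> z x)" for x
    unfolding \<omega>_def
    by (intro smooth_on_add[OF coordinates(1)] smooth_on_minus[OF coordinates(1)] smooth_on_mult[OF coordinates(1)]
        smooth_on_inner[OF coordinates(1)] smooth_on_const[OF coordinates(1)] smooth_on_derivative coordinates
        smooth_on_subset[OF \<psi>(1) subset_UNIV] smooth_on_subset[OF sA subset_UNIV])
  have lin: "linear (\<omega> z)" if "z \<in> U" for z
    unfolding \<omega>_def using linear_derivative[OF coordinates_differentiable(1)[OF that]]
    by (intro linearI) (simp_all add: linear_add linear_cmul inner_add_right algebra_simps)
  obtain s where s: "smooth_on U s" "\<And>z. z \<in> U \<Longrightarrow> (s has_derivative \<omega> z) (at z)"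
    using closed_one_form_exact[OF coordinates(1) assms s\<omega> lin closed] by blast
  have "differential s z = (theta_can q p h - theta \<psi> A) z" if "z \<in> U" for z
  proof
    fix v
    show "differential s z v = (theta_can q p h - theta \<psi> A) z v"
      unfolding differential_apply theta_difference_apply
      using frechet_derivative_at[OF s(2)[OF that]] by metis
  qed
  then show ?thesis using s(1) unfolding generating_function_def by blast
qed

text \<open>On purely spatial vectors the \<open>dt\<close> terms of
  \<open>theta_can q p h - theta \<psi> A\<close> vanish, so the differential of \<open>s\<close>
  there is \<open>dot_dx A\<close> minus \<open>p\<close> times the differential of
  \<open>q\<close>.\<close>

lemma Clebsch_representation:
  assumes "generating_function U (theta_can q p h) (theta \<psi> A) s" "z \<in> U"
  shows "A z = grad s z + p z *\<^sub>R grad q z"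
proof -
  have ds: "s differentiable (at z)" and eq: "differential s z = (theta_can q p h - theta \<psi> A) z"
    using assms smooth_on_differentiable by (auto simp: generating_function_def)
  have "frechet_derivative s (at z) x = \<omega> z x" for x
    using fun_cong[OF eq, of "\<lambda>_. x"] unfolding differential_apply theta_difference_apply .
  then show ?thesis
    by (simp add: vec_eq_iff grad_nth[OF ds] grad_nth[OF coordinates_differentiable(1)[OF assms(2)]] \<omega>_def inner_axis)
qed

end

theorem proposition2:
  fixes u F B :: "spacetime \<Rightarrow> real ^ 3" and \<phi> :: "spacetime \<Rightarrow> real"
  assumes "smooth u" and "smooth B" and "smooth \<phi>"
    and "\<And>z. time_deriv u z + advect u u z = F z"
    and "\<And>z. divergence B z = 0"
    and "\<And>z. time_deriv B z - curl (\<lambda>w. cross3 (u w) (B w)) z = 0"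
    and "\<And>z. time_deriv \<phi> z + advect u \<phi> z = 0"
    and "\<And>z. B z \<bullet> grad \<phi> z \<noteq> 0"
  defines "\<Omega> \<equiv> Omega u B \<phi>"
    and "\<rho> \<equiv> (\<lambda>z. - (B z \<bullet> grad \<phi> z))"
  shows "(symplectic_form \<Omega> \<and> hamiltonian_vector_field \<Omega> (\<lambda>z. (1, u z)) \<phi>)
    \<and> (form0 (\<lambda>z. 1 / 2) * wedge 2 2 \<Omega> \<Omega> = form0 \<rho> * volume_form \<and>
       (\<forall>z. time_deriv \<rho> z + divergence (\<lambda>w. \<rho> w *\<^sub>R u w) z = 0))
    \<and> (\<forall>A. smooth A \<and> (\<forall>z. B z = curl A z) \<longrightarrow>
         ((\<exists>\<psi>. smooth \<psi> \<and> potential_equation u A \<phi> \<psi>) \<and>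
          (\<forall>\<psi>. smooth \<psi> \<and> potential_equation u A \<phi> \<psi> \<longrightarrow>
             (\<forall>\<psi>'. smooth \<psi>' \<and> potential_equation u A \<phi> \<psi>' \<longleftrightarrow>
                (\<exists>c :: real \<Rightarrow> real. smooth c \<and> (\<forall>z. \<psi>' z = \<psi> z + c (fst z)))) \<and>
             \<Omega> = - ext_deriv 1 (theta \<psi> A)))
       \<and> ((\<forall>z. \<exists>U q p h. z \<in> U \<and> darboux_coordinates \<Omega> U q p h) \<and>
          (\<forall>\<psi> U q p h. smooth \<psi> \<and> potential_equation u A \<phi> \<psi> \<and>
             simply_connected U \<and> darboux_coordinates \<Omega> U q p h \<longrightarrow>
               (\<exists>s. generating_function U (theta_can q p h) (theta \<psi> A) s) \<and>
               (\<forall>s. generating_function U (theta_can q p h) (theta \<psi> A) s \<longrightarrow>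
                  (\<forall>z\<in>U. A z = grad s z + p z *\<^sub>R grad q z)))))"
proof (intro conjI allI impI)
  note fields = assms(1-3,5-8)
  show "symplectic_form \<Omega>" unfolding \<Omega>_def by (rule symplectic_Omega[OF fields])
  show "hamiltonian_vector_field \<Omega> (\<lambda>z. (1, u z)) \<phi>" unfolding \<Omega>_def by (rule hamiltonian_Omega[OF fields])
  show "form0 (\<lambda>z. 1 / 2) * wedge 2 2 \<Omega> \<Omega> = form0 \<rho> * volume_form"
    unfolding \<Omega>_def \<rho>_def by (rule half_Omega_squared)
  show "time_deriv \<rho> z + divergence (\<lambda>w. \<rho> w *\<^sub>R u w) z = 0" for z
    unfolding \<rho>_def by (rule continuity_equation[OF fields])
  fix A assume A: "smooth A \<and> (\<forall>z. B z = curl A z)"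
  note fields_A = assms(1-3) conjunct1[OF A] assms(6) spec[OF conjunct2[OF A]]
  show "\<exists>\<psi>. smooth \<psi> \<and> potential_equation u A \<phi> \<psi>" by (rule potential_exists[OF fields_A])
  show "smooth \<psi>' \<and> potential_equation u A \<phi> \<psi>' \<longleftrightarrow>
      (\<exists>c :: real \<Rightarrow> real. smooth c \<and> (\<forall>z. \<psi>' z = \<psi> z + c (fst z)))"
    if "smooth \<psi> \<and> potential_equation u A \<phi> \<psi>" for \<psi> \<psi>'
    by (rule potential_unique[OF fields_A conjunct1[OF that] conjunct2[OF that]])
  show "\<Omega> = - ext_deriv 1 (theta \<psi> A)" if "smooth \<psi> \<and> potential_equation u A \<phi> \<psi>" for \<psi>
    unfolding \<Omega>_def by (rule Omega_exact[OF fields_A conjunct1[OF that] conjunct2[OF that]])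
  show "\<exists>U q p h. z \<in> U \<and> darboux_coordinates \<Omega> U q p h" for z
    unfolding \<Omega>_def by (rule local_Darboux[OF fields])
  fix \<psi> U q p h
  assume *: "smooth \<psi> \<and> potential_equation u A \<phi> \<psi> \<and> simply_connected U \<and> darboux_coordinates \<Omega> U q p h"
  then have hyps: "smooth \<psi>" "potential_equation u A \<phi> \<psi>" "darboux_coordinates (Omega u B \<phi>) U q p h" "simply_connected U"
    by (auto simp: \<Omega>_def)
  show "\<exists>s. generating_function U (theta_can q p h) (theta \<psi> A) s"
    by (rule generating_function_exists[OF fields_A hyps])
  fix s assume "generating_function U (theta_can q p h) (theta \<psi> A) s"
  then show "\<forall>z\<in>U. A z = grad s z + p z *\<^sub>R grad q z"
    using Clebsch_representation[OF fields_A hyps(1-3)] by blast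
qed

end
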